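(* Let $n\ge 5$ be an integer and $\alpha,\beta,p,\lambda,\mu\in\mathbb{R}$ with $-2<\alpha<n-4$, $p>1$, $\frac{n+\alpha}{2}+\frac{n+\beta}{p+1}=n-2$, $\mu>0$ and $\lambda\le(n-2)(\alpha+2)-2\sqrt{\mu}$. Let $u\in C^4(\mathbb{R}^n\setminus\{0\})$ be a positive radial solution of $$\Delta(|x|^{-\alpha}\Delta u)+\lambda\,\mathrm{div}(|x|^{-\alpha-2}\nabla u)+\mu|x|^{-\alpha-4}u=|x|^{\beta}u^{p}\quad\text{in }\mathbb{R}^n\setminus\{0\}$$ with non-removable singularity at the origin, and define $v(t)=|x|^{\frac{n-4-\alpha}{2}}u(|x|)$ with $t=-\ln|x|$. Then: (i) $v$ is periodic. (ii) Let $l:=K_0^{\frac{1}{p-1}}$ and $a\in(0,l)$. Then there exists a unique (up to translations) periodic solution $v$ of $$v^{(4)}-K_2v''+K_0v=v^p\quad\text{in }\mathbb{R}$$ with minimal value $a$.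
   Context: Here $$K_2=\frac{(n-2)^2+(\alpha+2)^2}{2}-\lambda,\qquad K_0=\frac{(n-4-\alpha)^2(n+\alpha)^2}{16}-\lambda\left(\frac{n-4-\alpha}{2}\right)^2+\mu .$$ With $v(t)=|x|^{\frac{n-4-\alpha}{2}}u(|x|)$, $t=-\ln|x|$, the PDE for positive radial $u$ is equivalent to the ODE $v^{(4)}-K_2v''+K_0v=v^p$ on $\mathbb{R}$. "Non-removable singularity at the origin" means that $u$ is not bounded near the origin (the sense used in the paper). *)

theory Defs
  imports "HOL-Analysis.Analysis"
begin

definition partial :: "'n::finite \<Rightarrow> (real^'n \<Rightarrow> real) \<Rightarrow> real^'n \<Rightarrow> real" where
  "partial i f x = frechet_derivative f (at x) (axis i 1)"

definition gradient :: "(real^'n \<Rightarrow> real) \<Rightarrow> real^'n \<Rightarrow> real^'n" where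
  "gradient f x = (\<chi> i. partial i f x)"

definition divergence :: "(real^'n \<Rightarrow> real^'n) \<Rightarrow> real^'n \<Rightarrow> real" where
  "divergence F x = (\<Sum>i\<in>UNIV. partial i (\<lambda>y. F y $ i) x)"

definition laplacian :: "(real^'n \<Rightarrow> real) \<Rightarrow> real^'n \<Rightarrow> real" where
  "laplacian f x = (\<Sum>i\<in>UNIV. partial i (partial i f) x)"

text \<open>The class $C^k(S)$; intended for open \<open>S\<close> only, since \<open>partial\<close> uses the
  derivative in the full space.\<close>

fun Ck_on :: "nat \<Rightarrow> (real^'n \<Rightarrow> real) \<Rightarrow> (real^'n) set \<Rightarrow> bool" where
  "Ck_on 0 f S \<longleftrightarrow> continuous_on S f"
| "Ck_on (Suc k) f S \<longleftrightarrow> f differentiable_on S \<and> (\<forall>i. Ck_on k (partial i f) S)"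

text \<open>Functions on the punctured space are total functions whose value at the origin is
  irrelevant, so radial symmetry does not involve that value.\<close>

definition radial_off_origin :: "(real^'n \<Rightarrow> real) \<Rightarrow> bool" where
  "radial_off_origin u \<longleftrightarrow> (\<forall>x y. x \<noteq> 0 \<longrightarrow> y \<noteq> 0 \<longrightarrow> norm x = norm y \<longrightarrow> u x = u y)"

text \<open>The filter \<open>at 0\<close> is punctured: this says that \<open>u\<close> is unbounded on every punctured
  neighbourhood of the origin.\<close>

definition nonremovable_singularity :: "(real^'n \<Rightarrow> real) \<Rightarrow> bool" where
  "nonremovable_singularity u \<longleftrightarrow> \<not> Bfun u (at 0)"

text \<open>Constant functions count as periodic.\<close>

definition periodic :: "(real \<Rightarrow> real) \<Rightarrow> bool" where
  "periodic v \<longleftrightarrow> (\<exists>T>0. \<forall>t. v (t + T) = v t)"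

definition K2 :: "nat \<Rightarrow> real \<Rightarrow> real \<Rightarrow> real" where
  "K2 n \<alpha> lam = ((real n - 2)\<^sup>2 + (\<alpha> + 2)\<^sup>2) / 2 - lam"

definition K0 :: "nat \<Rightarrow> real \<Rightarrow> real \<Rightarrow> real \<Rightarrow> real" where
  "K0 n \<alpha> lam \<mu> =
     (real n - 4 - \<alpha>)\<^sup>2 * (real n + \<alpha>)\<^sup>2 / 16 - lam * ((real n - 4 - \<alpha>) / 2)\<^sup>2 + \<mu>"

text \<open>Classical solutions of $v^{(4)} - k_2 v'' + k_0 v = v^p$ on the real line. Since
  \<open>powr\<close> takes junk values at negative arguments, this is meaningful for \<open>v \<ge> 0\<close>.\<close>

definition ode_solution :: "real \<Rightarrow> real \<Rightarrow> real \<Rightarrow> (real \<Rightarrow> real) \<Rightarrow> bool" where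
  "ode_solution k2 k0 p v \<longleftrightarrow>
     (\<forall>k<4. \<forall>t. (deriv ^^ k) v field_differentiable at t) \<and>
     (\<forall>t. (deriv ^^ 4) v t - k2 * (deriv ^^ 2) v t + k0 * v t = v t powr p)"

definition minimal_value :: "real \<Rightarrow> (real \<Rightarrow> real) \<Rightarrow> bool" where
  "minimal_value a v \<longleftrightarrow> a \<in> range v \<and> (\<forall>t. a \<le> v t)"

end

theory Submission
  imports Defs
begin

text \<open>
  In the variable \<open>t = - ln |x|\<close> the radial equation becomes
  \<open>v'''' - K2 v'' + K0 v = v^p\<close>. With \<open>\<gamma> = (n - 4 - \<alpha>) / 2\<close> the characteristic polynomial
  \<open>P(s) = s^2 - K2 s + K0\<close> satisfies \<open>P(\<gamma>^2) = \<mu>\<close>, and its discriminant is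
  \<open>((n - 2) (\<alpha> + 2) - lam)^2 - 4 \<mu>\<close>. The hypotheses on \<open>\<mu>\<close> and on the coefficient \<open>lam\<close> of the
  equation therefore make the roots of \<open>P\<close> real and larger than \<open>\<gamma>^2\<close>
  (\<open>real_decay_rates\<close>). From here on \<open>lam\<close> and \<open>nu\<close> denote these roots.

  Reality of the roots makes the equation order preserving. Put \<open>z = v'' - lam v\<close>; then
  \<open>v'' = lam v + z\<close> and \<open>z'' = nu z + v^p\<close>, a system with non-decreasing couplings. If
  two distinct solutions are ordered at one time together with \<open>v'\<close>, \<open>z\<close> and \<open>z'\<close>, they stay ordered
  and their difference is unbounded (\<open>cooperative_system\<close>). So bounded solutions cannot be
  ordered in this way, and this rigidity replaces a phase plane: comparing \<open>v\<close> with its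
  reflection shows that a bounded solution is symmetric about each of its critical points, hence
  periodic as soon as it has two of them; comparing two solutions at their minima shows that the
  minimal value determines the solution up to translation.

  The quantity \<open>q = v'' - K2 v\<close> satisfies \<open>q'' = v^p - K0 v\<close>. If the right-hand side has one
  strict sign on the whole line, or stays away from \<open>0\<close> near infinity, then \<open>q\<close> and with it \<open>v\<close>
  is unbounded. Hence a bounded positive solution cannot stay on one side of the equilibrium \<open>l\<close>,
  its limits are equilibria, and if it has at most one critical point it tends to \<open>0\<close> (\<open>periodic_or_vanishing\<close>). The same quantity, the
  conserved energy, which bounds the critical values, and finite time blow-up of solutions in the
  forward invariant cone show that every positive entire solution is bounded
  (\<open>positive_solution_bounded\<close>).

  Part (i): if \<open>v\<close> is not periodic, it tends to \<open>0\<close>, and since both roots exceed \<open>\<gamma>^2\<close>, it is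
  \<open>O(exp (- \<gamma> t))\<close> (\<open>exponential_decay\<close>). As \<open>u = |x|^(- \<gamma>) v\<close>, this makes \<open>u\<close> bounded near the
  origin.

  Part (ii): existence is by shooting (\<open>bounded_shot_exists\<close>). Among the solutions with
  \<open>v(0) = a\<close>, \<open>v'(0) = v'''(0) = 0\<close> and \<open>v''(0) = b\<close>, the one with \<open>b = 0\<close> falls below \<open>a\<close> and those
  with \<open>b \<ge> lam a\<close> start in the cone. The supremum of the falling values of \<open>b\<close> gives an even
  solution that does neither; it is bounded and does not tend to \<open>0\<close>, hence periodic. To have
  all solutions defined on the whole line the power is first replaced by a function of linear
  growth that agrees with it on the relevant range.
\<close>

section \<open>Global solutions of Lipschitz differential equations\<close>

lemma antiderivative_exists:
  fixes g :: "real \<Rightarrow> 'a::euclidean_space"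
  assumes "continuous_on UNIV g"
  shows "\<exists>G. G 0 = c \<and> (\<forall>t. (G has_vector_derivative g t) (at t))"
proof -
  have "\<exists>G. \<forall>x::real. -\<infinity> < ereal x \<longrightarrow> ereal x < \<infinity> \<longrightarrow> (G has_vector_derivative g x) (at x)"
    using assms by (intro einterval_antiderivative)
      (auto simp: continuous_on_eq_continuous_at)
  then obtain G where G: "\<And>x. (G has_vector_derivative g x) (at x)" by auto
  have "((\<lambda>t. G t - G 0 + c) has_vector_derivative g t) (at t)" for t
    using has_vector_derivative_add[OF
        has_vector_derivative_diff[OF G[of t] has_vector_derivative_const[of "G 0"]]
        has_vector_derivative_const[of c]]
    by simp
  then show ?thesis by (intro exI[of _ "\<lambda>t. G t - G 0 + c"]) auto
qed

lemma norm_bound_exp_forward: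
  fixes D :: "real \<Rightarrow> 'a::euclidean_space"
  assumes "D 0 = 0" "K > 0" "t \<ge> 0"
    and der: "\<And>s. 0 \<le> s \<Longrightarrow> (D has_vector_derivative D' s) (at s)"
    and bd: "\<And>s. 0 \<le> s \<Longrightarrow> norm (D' s) \<le> A * exp (K * s)"
  shows "norm (D t) \<le> A / K * exp (K * t)"
proof (cases "t = 0")
  case True
  have "A \<ge> 0" using bd[of 0] norm_ge_zero[of "D' 0"] by (simp del: norm_ge_zero)
  then show ?thesis using True assms by simp
next
  case False
  have "norm (D t - D 0) \<le> A / K * exp (K * t) - A / K * exp (K * 0)"
  proof (rule differentiable_bound_general[where f' = D' and \<phi>' = "\<lambda>s. A * exp (K * s)"])
    show "0 < t" using False assms by simp
    show "continuous_on {0..t} D"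
      using der by (intro continuous_at_imp_continuous_on ballI) (auto intro: has_vector_derivative_continuous)
    show "continuous_on {0..t} (\<lambda>s. A / K * exp (K * s))" by (intro continuous_intros)
    show "((\<lambda>s. A / K * exp (K * s)) has_vector_derivative A * exp (K * s)) (at s)" for s
      unfolding has_real_derivative_iff_has_vector_derivative[symmetric]
      using \<open>K > 0\<close> by (auto intro!: derivative_eq_intros)
    show "(D has_vector_derivative D' s) (at s)" if "0 < s" "s < t" for s using that der by simp
    show "norm (D' s) \<le> A * exp (K * s)" if "0 < s" "s < t" for s using that bd by simp
  qed
  moreover have "A \<ge> 0" using bd[of 0] norm_ge_zero[of "D' 0"] by (simp del: norm_ge_zero)
  then have "A / K * exp (K * 0) \<ge> 0" using \<open>K > 0\<close> by simp
  ultimately show ?thesis using assms(1) by simp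
qed

text \<open>Integration against the weight \<open>exp (K * |t|)\<close> gains the factor \<open>1 / K\<close>, which may be made as
  small as desired. This is what lets Picard iteration contract on the whole line.\<close>

lemma norm_bound_exp:
  fixes D :: "real \<Rightarrow> 'a::euclidean_space"
  assumes "D 0 = 0" "K > 0"
    and der: "\<And>s. (D has_vector_derivative D' s) (at s)"
    and bd: "\<And>s. norm (D' s) \<le> A * exp (K * \<bar>s\<bar>)"
  shows "norm (D t) \<le> A / K * exp (K * \<bar>t\<bar>)"
proof (cases "t \<ge> 0")
  case True
  have "norm (D t) \<le> A / K * exp (K * t)"
  proof (rule norm_bound_exp_forward[where D' = D'])
    show "norm (D' s) \<le> A * exp (K * s)" if "0 \<le> s" for s using bd[of s] that by simp
  qed (use assms True in auto)
  then show ?thesis using True by simp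
next
  case False
  have "norm (D (- (- t))) \<le> A / K * exp (K * - t)"
  proof (rule norm_bound_exp_forward[where D = "\<lambda>s. D (- s)" and D' = "\<lambda>s. - D' (- s)"])
    fix s :: real assume "0 \<le> s"
    have "(uminus has_real_derivative -1) (at s)" by (auto intro!: derivative_eq_intros)
    then have "(D \<circ> uminus has_vector_derivative (-1) *\<^sub>R D' (- s)) (at s)"
      by (intro vector_diff_chain_at der) (simp add: has_real_derivative_iff_has_vector_derivative)
    then show "((\<lambda>s. D (- s)) has_vector_derivative - D' (- s)) (at s)" by (simp add: o_def)
    show "norm (- D' (- s)) \<le> A * exp (K * s)" using bd[of "- s"] \<open>0 \<le> s\<close> by simp
  qed (use False assms in auto)
  then show ?thesis using False by simp
qed

text \<open>Picard iteration. Measured with the weight \<open>exp (2 * L * |t|)\<close>, each step halves the distance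
  between consecutive iterates, so they converge on the whole line at once and no local solutions
  have to be continued.\<close>

theorem lipschitz_ode_exists:
  fixes F :: "'a::euclidean_space \<Rightarrow> 'a"
  assumes lip: "\<And>x y. norm (F x - F y) \<le> L * norm (x - y)" and L: "L > 0"
  shows "\<exists>y. y 0 = c \<and> (\<forall>t. (y has_vector_derivative F (y t)) (at t))"
proof -
  have F_cont: "continuous_on UNIV F"
  proof -
    have "L-lipschitz_on UNIV F"
      using lip L by (intro lipschitz_onI) (auto simp: dist_norm)
    then show ?thesis by (rule lipschitz_on_continuous_on)
  qed
  define I where "I = (\<lambda>g::real\<Rightarrow>'a. SOME G. G 0 = c \<and> (\<forall>t. (G has_vector_derivative g t) (at t)))"
  have I: "I g 0 = c \<and> (\<forall>t. (I g has_vector_derivative g t) (at t))" if "continuous_on UNIV g" for g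
    unfolding I_def using someI_ex[OF antiderivative_exists[OF that, of c]] by blast
  define y where "y = (\<lambda>n. ((\<lambda>g. I (\<lambda>t. F (g t))) ^^ n) (\<lambda>_. c))"
  have y0: "y 0 = (\<lambda>_. c)" and ySuc: "y (Suc n) = I (\<lambda>t. F (y n t))" for n
    by (simp_all add: y_def)
  have F_comp: "continuous_on UNIV (\<lambda>t. F (g t))" if "continuous_on UNIV g" for g :: "real \<Rightarrow> 'a"
    using continuous_on_compose2[OF F_cont that] by simp
  have y_cont: "continuous_on UNIV (y n)" for n
  proof (induction n)
    case 0 then show ?case by (simp add: y0)
  next
    case (Suc n)
    show ?case unfolding ySuc using I[OF F_comp[OF Suc]]
      by (intro continuous_at_imp_continuous_on ballI) (auto intro: has_vector_derivative_continuous)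
  qed
  have y_at0: "y n 0 = c" for n
    by (cases n) (use I[OF F_comp[OF y_cont]] in \<open>auto simp: y0 ySuc\<close>)
  have y_der: "(y (Suc n) has_vector_derivative F (y n t)) (at t)" for n t
    unfolding ySuc using I[OF F_comp[OF y_cont]] by blast
  define B where "B = norm (F c) / (2 * L)"
  have B0: "B \<ge> 0" using L by (simp add: B_def)
  have step: "norm (y (Suc n) t - y n t) \<le> B / 2 ^ n * exp (2 * L * \<bar>t\<bar>)" for n t
  proof (induction n arbitrary: t)
    case 0
    have "norm (y 1 t - c) \<le> norm (F c) / (2 * L) * exp (2 * L * \<bar>t\<bar>)"
    proof (rule norm_bound_exp[where D' = "\<lambda>s. F c"])
      show "((\<lambda>t. y 1 t - c) has_vector_derivative F c) (at s)" for s
        using has_vector_derivative_diff[OF y_der[of 0 s] has_vector_derivative_const[of c]] by (simp add: y0)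
      show "norm (F c) \<le> norm (F c) * exp (2 * L * \<bar>s\<bar>)" for s
        using L by (simp add: mult_le_cancel_left1)
    qed (use L y_at0 in auto)
    then show ?case by (simp add: y0 B_def)
  next
    case (Suc n)
    have "norm (y (Suc (Suc n)) t - y (Suc n) t) \<le> (L * (B / 2 ^ n)) / (2 * L) * exp (2 * L * \<bar>t\<bar>)"
    proof (rule norm_bound_exp[where D' = "\<lambda>s. F (y (Suc n) s) - F (y n s)"])
      show "((\<lambda>t. y (Suc (Suc n)) t - y (Suc n) t) has_vector_derivative F (y (Suc n) s) - F (y n s)) (at s)" for s
        by (intro has_vector_derivative_diff y_der)
      show "norm (F (y (Suc n) s) - F (y n s)) \<le> L * (B / 2 ^ n) * exp (2 * L * \<bar>s\<bar>)" for s
        using lip[of "y (Suc n) s" "y n s"] mult_left_mono[OF Suc[of s], of L] L by (simp add: mult.assoc)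
    qed (use L y_at0 in auto)
    then show ?case using L by (simp add: field_simps)
  qed
  have tele: "norm (y (n + k) t - y n t) \<le> (2 / 2 ^ n - 2 / 2 ^ (n + k)) * (B * exp (2 * L * \<bar>t\<bar>))" for n k t
  proof (induction k)
    case (Suc k)
    have "norm (y (n + Suc k) t - y n t) \<le> norm (y (Suc (n + k)) t - y (n + k) t) + norm (y (n + k) t - y n t)"
      using norm_triangle_ineq[of "y (Suc (n + k)) t - y (n + k) t" "y (n + k) t - y n t"] by simp
    also have "\<dots> \<le> B / 2 ^ (n + k) * exp (2 * L * \<bar>t\<bar>) + (2 / 2 ^ n - 2 / 2 ^ (n + k)) * (B * exp (2 * L * \<bar>t\<bar>))"
      by (intro add_mono step Suc)
    also have "\<dots> = (2 / 2 ^ n - 2 / 2 ^ (n + Suc k)) * (B * exp (2 * L * \<bar>t\<bar>))"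
      by (simp add: field_simps)
    finally show ?case .
  qed simp
  have tail: "norm (y m t - y n t) \<le> 2 / 2 ^ n * (B * exp (2 * L * \<bar>t\<bar>))" if "n \<le> m" for m n t
  proof -
    have "norm (y m t - y n t) \<le> (2 / 2 ^ n - 2 / 2 ^ m) * (B * exp (2 * L * \<bar>t\<bar>))"
      using tele[where n = n and k = "m - n"] that by simp
    also have "\<dots> \<le> 2 / 2 ^ n * (B * exp (2 * L * \<bar>t\<bar>))"
      using B0 by (intro mult_right_mono) auto
    finally show ?thesis .
  qed
  have small: "(\<lambda>n. 2 / 2 ^ n * b) \<longlonglongrightarrow> 0" for b :: real
  proof -
    have "(\<lambda>n. 2 * b * (1 / 2) ^ n) \<longlonglongrightarrow> 2 * b * 0"
      by (intro tendsto_mult tendsto_const LIMSEQ_realpow_zero) auto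
    then show ?thesis by (simp add: power_one_over field_simps)
  qed
  have conv: "convergent (\<lambda>n. y n t)" for t
  proof (rule Cauchy_convergent, rule CauchyI')
    fix e :: real assume "e > 0"
    have "\<forall>\<^sub>F n in sequentially. 2 / 2 ^ n * (B * exp (2 * L * \<bar>t\<bar>)) < e"
      using small \<open>e > 0\<close> by (intro order_tendstoD)
    then obtain N where N: "\<And>n. n \<ge> N \<Longrightarrow> 2 / 2 ^ n * (B * exp (2 * L * \<bar>t\<bar>)) < e"
      by (auto simp: eventually_sequentially)
    show "\<exists>M. \<forall>m\<ge>M. \<forall>n>m. dist (y m t) (y n t) < e"
    proof (intro exI allI impI)
      fix m n assume "N \<le> m" "m < n"
      then show "dist (y m t) (y n t) < e"
        using tail[of m n t] N[of m] by (simp add: dist_norm norm_minus_commute)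
    qed
  qed
  define Y where "Y = (\<lambda>t. lim (\<lambda>n. y n t))"
  have Y: "(\<lambda>n. y n t) \<longlonglongrightarrow> Y t" for t
    using conv unfolding Y_def by (simp add: convergent_LIMSEQ_iff)
  have Ytail: "norm (Y t - y n t) \<le> 2 / 2 ^ n * (B * exp (2 * L * \<bar>t\<bar>))" for n t
    by (rule LIMSEQ_le_const2[where X = "\<lambda>m. norm (y m t - y n t)"])
       (use tail in \<open>auto intro!: tendsto_intros Y\<close>)
  have Ycont: "continuous_on UNIV Y"
  proof (rule continuous_at_imp_continuous_on, rule ballI)
    fix t0 :: real
    define R where "R = \<bar>t0\<bar> + 1"
    have "uniform_limit {-R<..<R} y Y sequentially"
    proof (rule uniform_limitI)
      fix e :: real assume "e > 0"
      have "\<forall>\<^sub>F n in sequentially. 2 / 2 ^ n * (B * exp (2 * L * R)) < e"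
        using small \<open>e > 0\<close> by (intro order_tendstoD)
      then show "\<forall>\<^sub>F n in sequentially. \<forall>t\<in>{-R<..<R}. dist (y n t) (Y t) < e"
      proof eventually_elim
        case (elim n)
        show ?case
        proof
          fix t assume "t \<in> {-R<..<R}"
          then have "exp (2 * L * \<bar>t\<bar>) \<le> exp (2 * L * R)" using L by auto
          then have "2 / 2 ^ n * (B * exp (2 * L * \<bar>t\<bar>)) \<le> 2 / 2 ^ n * (B * exp (2 * L * R))"
            using B0 by (intro mult_left_mono) auto
          then show "dist (y n t) (Y t) < e"
            using Ytail[of t n] elim by (simp add: dist_norm norm_minus_commute)
        qed
      qed
    qed
    then have "continuous_on {-R<..<R} Y"
      by (rule uniform_limit_theorem[rotated])
         (auto intro!: always_eventually continuous_on_subset[OF y_cont])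
    moreover have "t0 \<in> {-R<..<R}" by (auto simp: R_def)
    ultimately show "isCont Y t0" by (simp add: continuous_on_eq_continuous_at)
  qed
  define G where "G = I (\<lambda>t. F (Y t))"
  have G: "G 0 = c" "(G has_vector_derivative F (Y t)) (at t)" for t
    unfolding G_def using I[OF F_comp[OF Ycont]] by blast+
  have "G t = Y t" for t
  proof -
    have "norm (G t - y (Suc n) t) \<le> (L * (2 / 2 ^ n * B)) / (2 * L) * exp (2 * L * \<bar>t\<bar>)" for n
    proof (rule norm_bound_exp[where D' = "\<lambda>s. F (Y s) - F (y n s)"])
      show "((\<lambda>t. G t - y (Suc n) t) has_vector_derivative F (Y s) - F (y n s)) (at s)" for s
        by (intro has_vector_derivative_diff y_der G)
      show "norm (F (Y s) - F (y n s)) \<le> L * (2 / 2 ^ n * B) * exp (2 * L * \<bar>s\<bar>)" for s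
        using lip[of "Y s" "y n s"] mult_left_mono[OF Ytail[of s n], of L] L by (simp add: mult.assoc)
    qed (use L y_at0 G in auto)
    then have bd: "norm (G t - y (Suc n) t) \<le> 2 / 2 ^ n * (B / 2 * exp (2 * L * \<bar>t\<bar>))" for n
      using L by (simp add: field_simps)
    have "(\<lambda>n. G t - y (Suc n) t) \<longlonglongrightarrow> 0"
      by (rule Lim_null_comparison[OF always_eventually[OF allI[OF bd]] small])
    moreover have "(\<lambda>n. G t - y (Suc n) t) \<longlonglongrightarrow> G t - Y t"
      by (intro tendsto_intros LIMSEQ_Suc Y)
    ultimately show ?thesis using LIMSEQ_unique by fastforce
  qed
  then have "G = Y" by auto
  then show ?thesis using G by (intro exI[of _ Y]) auto
qed

text \<open>Gronwall's argument: the squared distance of two solutions, damped by \<open>exp (- 2 * L * t)\<close>, does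
  not increase.\<close>

lemma lipschitz_ode_dependence_forward:
  fixes F :: "'a::euclidean_space \<Rightarrow> 'a"
  assumes lip: "\<And>x y. norm (F x - F y) \<le> L * norm (x - y)"
    and x: "\<And>t. (x has_vector_derivative F (x t)) (at t)"
    and y: "\<And>t. (y has_vector_derivative F (y t)) (at t)"
    and t: "t \<ge> 0"
  shows "norm (x t - y t) \<le> exp (L * t) * norm (x 0 - y 0)"
proof -
  define N where "N = (\<lambda>s. exp (-2 * L * s) * ((x s - y s) \<bullet> (x s - y s)))"
  have "N t \<le> N 0"
  proof (rule DERIV_nonpos_imp_nonincreasing[OF t])
    fix s
    let ?d = "x s - y s"
    have d: "((\<lambda>s. x s - y s) has_vector_derivative F (x s) - F (y s)) (at s)"
      by (intro has_vector_derivative_diff x y)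
    have sq: "((\<lambda>s. (x s - y s) \<bullet> (x s - y s)) has_real_derivative 2 * (?d \<bullet> (F (x s) - F (y s)))) (at s)"
      using bounded_bilinear.has_vector_derivative[OF bounded_bilinear_inner d d]
      by (simp add: has_real_derivative_iff_has_vector_derivative inner_commute)
    have ex: "((\<lambda>s. exp (-2 * L * s)) has_real_derivative exp (-2 * L * s) * (-2 * L)) (at s)"
      by (auto intro!: derivative_eq_intros)
    have "(N has_real_derivative exp (-2 * L * s) * (2 * (?d \<bullet> (F (x s) - F (y s))) - 2 * L * (?d \<bullet> ?d))) (at s)"
      unfolding N_def using DERIV_mult[OF ex sq] by (simp add: algebra_simps)
    moreover have "?d \<bullet> (F (x s) - F (y s)) \<le> L * (?d \<bullet> ?d)"
    proof -
      have "?d \<bullet> (F (x s) - F (y s)) \<le> norm ?d * norm (F (x s) - F (y s))"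
        by (rule norm_cauchy_schwarz)
      also have "\<dots> \<le> norm ?d * (L * norm ?d)" by (intro mult_left_mono lip) auto
      also have "\<dots> = L * (?d \<bullet> ?d)" by (simp add: dot_square_norm power2_eq_square)
      finally show ?thesis .
    qed
    ultimately show "\<exists>D. (N has_real_derivative D) (at s) \<and> D \<le> 0"
      by (intro exI[of _ "exp (-2 * L * s) * (2 * (?d \<bullet> (F (x s) - F (y s))) - 2 * L * (?d \<bullet> ?d))"] conjI)
         (auto simp: mult_le_0_iff)
  qed
  then have "exp (-2 * L * t) * (norm (x t - y t))\<^sup>2 \<le> (norm (x 0 - y 0))\<^sup>2"
    by (simp add: N_def dot_square_norm)
  then have "exp (2 * L * t) * (exp (-2 * L * t) * (norm (x t - y t))\<^sup>2) \<le> exp (2 * L * t) * (norm (x 0 - y 0))\<^sup>2"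
    by (intro mult_left_mono) auto
  then have "(norm (x t - y t))\<^sup>2 \<le> exp (2 * L * t) * (norm (x 0 - y 0))\<^sup>2"
    by (simp add: mult.assoc[symmetric] exp_add[symmetric])
  also have "\<dots> = (exp (L * t) * norm (x 0 - y 0))\<^sup>2"
    by (simp add: power_mult_distrib exp_double[symmetric] mult.assoc)
  finally show ?thesis by (rule power2_le_imp_le) simp
qed

section \<open>Order preservation\<close>

lemma linear_lower_bound:
  fixes g :: "real \<Rightarrow> real"
  assumes "a \<le> t"
    and der: "\<And>s. a \<le> s \<Longrightarrow> s \<le> t \<Longrightarrow> (g has_real_derivative g' s) (at s)"
    and ge: "\<And>s. a \<le> s \<Longrightarrow> s \<le> t \<Longrightarrow> c \<le> g' s"
  shows "g a + c * (t - a) \<le> g t"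
proof -
  have "g a - c * a \<le> g t - c * t"
  proof (rule DERIV_nonneg_imp_nondecreasing[OF \<open>a \<le> t\<close>])
    fix s assume "a \<le> s" "s \<le> t"
    then have "((\<lambda>s. g s - c * s) has_real_derivative g' s - c) (at s)"
      using der by (auto intro!: derivative_eq_intros)
    then show "\<exists>y. ((\<lambda>s. g s - c * s) has_real_derivative y) (at s) \<and> 0 \<le> y"
      using ge \<open>a \<le> s\<close> \<open>s \<le> t\<close> by force
  qed
  then show ?thesis by (simp add: algebra_simps)
qed

lemma first_zero:
  fixes g :: "real \<Rightarrow> real"
  assumes cont: "continuous_on {a..b} g" and "a \<le> b" "g a > 0" "g b \<le> 0"
  obtains s where "a < s" "s \<le> b" "g s = 0" "\<And>r. a \<le> r \<Longrightarrow> r < s \<Longrightarrow> g r > 0"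
proof -
  define Z where "Z = {s \<in> {a..b}. g s \<le> 0}"
  have "closed Z"
  proof -
    have "Z = {a..b} \<inter> g -` {..0}" by (auto simp: Z_def)
    then show ?thesis using continuous_closed_preimage[OF cont closed_atLeastAtMost closed_atMost] by simp
  qed
  moreover have "b \<in> Z" using assms by (simp add: Z_def)
  moreover have bdd: "bdd_below Z" by (rule bdd_belowI[of _ a]) (auto simp: Z_def)
  ultimately have "Inf Z \<in> Z" using closed_contains_Inf by blast
  then have s: "a \<le> Inf Z" "Inf Z \<le> b" "g (Inf Z) \<le> 0" by (auto simp: Z_def)
  have before: "g r > 0" if "a \<le> r" "r < Inf Z" for r
  proof (rule ccontr)
    assume "\<not> g r > 0"
    then have "r \<in> Z" using that s by (auto simp: Z_def)
    then show False using cInf_lower[OF _ bdd] that by force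
  qed
  have "a < Inf Z" using s \<open>g a > 0\<close> by (cases "a = Inf Z") auto
  moreover have "g (Inf Z) = 0"
  proof (rule ccontr)
    assume "g (Inf Z) \<noteq> 0"
    then have neg: "g (Inf Z) < 0" using s by simp
    have "\<exists>x\<ge>a. x \<le> Inf Z \<and> g x = 0"
      by (rule IVT2') (use s neg assms in \<open>auto intro: continuous_on_subset[OF cont]\<close>)
    then obtain x where "a \<le> x" "x \<le> Inf Z" "g x = 0" by blast
    then show False using before[of x] neg by (cases "x = Inf Z") auto
  qed
  ultimately show thesis using that[of "Inf Z"] s before by blast
qed

text \<open>With \<open>k = sqrt \<kappa>\<close> the operator factors as \<open>g'' - \<kappa> g = (d/dt - k) (d/dt + k) g\<close>, and both
  first order factors preserve nonnegativity after multiplication by an integrating factor. This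
  covers vanishing initial data, where an argument by first zeros would fail.\<close>

lemma second_order_nonneg:
  fixes g :: "real \<Rightarrow> real"
  assumes k: "\<kappa> \<ge> 0" and t: "a \<le> t"
    and d0: "\<And>s. a \<le> s \<Longrightarrow> s \<le> t \<Longrightarrow> (g has_real_derivative g' s) (at s)"
    and d1: "\<And>s. a \<le> s \<Longrightarrow> s \<le> t \<Longrightarrow> (g' has_real_derivative g'' s) (at s)"
    and ge: "\<And>s. a \<le> s \<Longrightarrow> s \<le> t \<Longrightarrow> \<kappa> * g s \<le> g'' s"
    and init: "0 \<le> g a" "0 \<le> g' a"
  shows "0 \<le> g t \<and> 0 \<le> g' t"
proof -
  define k where "k = sqrt \<kappa>"
  have k0: "k \<ge> 0" and kk: "k * k = \<kappa>" using k by (simp_all add: k_def)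
  have P: "0 \<le> g' s + k * g s" if s: "a \<le> s" "s \<le> t" for s
  proof -
    have "exp (- k * a) * (g' a + k * g a) \<le> exp (- k * s) * (g' s + k * g s)"
    proof (rule DERIV_nonneg_imp_nondecreasing[OF \<open>a \<le> s\<close>])
      fix r assume r: "a \<le> r" "r \<le> s"
      have "((\<lambda>s. exp (- k * s) * (g' s + k * g s)) has_real_derivative
          exp (- k * r) * (g'' r - (k * k) * g r)) (at r)"
        using d0[of r] d1[of r] r s by (auto intro!: derivative_eq_intros simp: algebra_simps)
      moreover have "0 \<le> exp (- k * r) * (g'' r - (k * k) * g r)"
        using ge[of r] r s kk by simp
      ultimately show "\<exists>y. ((\<lambda>s. exp (- k * s) * (g' s + k * g s)) has_real_derivative y) (at r) \<and> 0 \<le> y"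
        by blast
    qed
    moreover have "0 \<le> exp (- k * a) * (g' a + k * g a)" using init k0 by simp
    ultimately have "0 \<le> exp (- k * s) * (g' s + k * g s)" by linarith
    then show ?thesis by (simp add: zero_le_mult_iff)
  qed
  have G: "0 \<le> g s" if s: "a \<le> s" "s \<le> t" for s
  proof -
    have "exp (k * a) * g a \<le> exp (k * s) * g s"
    proof (rule DERIV_nonneg_imp_nondecreasing[OF \<open>a \<le> s\<close>])
      fix r assume r: "a \<le> r" "r \<le> s"
      have "((\<lambda>s. exp (k * s) * g s) has_real_derivative exp (k * r) * (g' r + k * g r)) (at r)"
        using d0[of r] r s by (auto intro!: derivative_eq_intros simp: algebra_simps)
      moreover have "0 \<le> exp (k * r) * (g' r + k * g r)" using P[of r] r s by simp
      ultimately show "\<exists>y. ((\<lambda>s. exp (k * s) * g s) has_real_derivative y) (at r) \<and> 0 \<le> y"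
        by blast
    qed
    moreover have "0 \<le> exp (k * a) * g a" using init by simp
    ultimately have "0 \<le> exp (k * s) * g s" by linarith
    then show ?thesis by (simp add: zero_le_mult_iff)
  qed
  have "g' a + 0 * (t - a) \<le> g' t"
  proof (rule linear_lower_bound[OF t d1])
    fix s assume s: "a \<le> s" "s \<le> t"
    have "0 \<le> \<kappa> * g s" using k G[OF s] by simp
    then show "0 \<le> g'' s" using ge[OF s] by linarith
  qed
  then show ?thesis using G[of t] t init by simp
qed

lemma eventually_pos_right:
  fixes g :: "real \<Rightarrow> real"
  assumes "(g has_real_derivative l) (at a)" "g a > 0 \<or> g a = 0 \<and> l > 0"
  shows "eventually (\<lambda>t. g t > 0) (at_right a)"
proof (cases "g a > 0")
  case True
  have "(g \<longlongrightarrow> g a) (at_right a)"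
    using DERIV_isCont[OF assms(1)] by (simp add: isCont_def filterlim_at_split)
  then show ?thesis using True by (rule order_tendstoD)
next
  case False
  then have "g a = 0" "l > 0" using assms by auto
  obtain d where "d > 0" and d: "\<And>h. 0 < h \<Longrightarrow> h < d \<Longrightarrow> g a < g (a + h)"
    using has_real_derivative_pos_inc_right[OF assms(1) \<open>l > 0\<close>] by auto
  have "g t > 0" if "a < t" "t < a + d" for t
    using d[of "t - a"] that \<open>g a = 0\<close> by simp
  then show ?thesis unfolding eventually_at_right_field
    using \<open>d > 0\<close> by (intro exI[of _ "a + d"]) auto
qed

text \<open>The system solved by the difference of two solutions: \<open>D\<close> is the difference of the solutions,
  \<open>E\<close> that of the quantities \<open>v'' - lam v\<close>, and \<open>h\<close> that of the nonlinear terms,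
  which inherits its sign from \<open>D\<close> when the nonlinearity is non-decreasing.\<close>

locale cooperative_system =
  fixes lam nu :: real and D D1 E E1 h :: "real \<Rightarrow> real"
  assumes lam: "lam > 0" and nu: "nu > 0"
    and dD: "\<And>t. (D has_real_derivative D1 t) (at t)"
    and dD1: "\<And>t. (D1 has_real_derivative lam * D t + E t) (at t)"
    and dE: "\<And>t. (E has_real_derivative E1 t) (at t)"
    and dE1: "\<And>t. (E1 has_real_derivative nu * E t + h t) (at t)"
    and h: "\<And>t. D t \<ge> 0 \<Longrightarrow> h t \<ge> 0"
begin

text \<open>As long as \<open>D\<close> is nonnegative, so is \<open>h\<close>; this keeps \<open>E\<close>, \<open>E1\<close> and then \<open>D1\<close> nonnegative, so
  \<open>D\<close> does not decrease and cannot reach its first zero.\<close>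

lemma cone_invariant:
  assumes init: "D a > 0" "D1 a \<ge> 0" "E a \<ge> 0" "E1 a \<ge> 0" and t: "a \<le> t"
  shows "D a \<le> D t \<and> 0 \<le> D1 t \<and> 0 \<le> E t \<and> 0 \<le> E1 t"
proof -
  have while_nonneg: "D a \<le> D s \<and> 0 \<le> D1 s \<and> 0 \<le> E s \<and> 0 \<le> E1 s"
    if as: "a \<le> s" and pos: "\<And>r. a \<le> r \<Longrightarrow> r \<le> s \<Longrightarrow> 0 \<le> D r" for s
  proof -
    have E: "0 \<le> E r \<and> 0 \<le> E1 r" if "a \<le> r" "r \<le> s" for r
      by (rule second_order_nonneg[where \<kappa> = nu, OF _ \<open>a \<le> r\<close> dE dE1])
         (use nu init h pos that in auto)
    have D1: "0 \<le> D1 r" if r: "a \<le> r" "r \<le> s" for r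
    proof -
      have "D1 a + 0 * (r - a) \<le> D1 r"
      proof (rule linear_lower_bound[OF \<open>a \<le> r\<close> dD1])
        fix q assume "a \<le> q" "q \<le> r"
        then show "0 \<le> lam * D q + E q" using lam E[of q] pos[of q] r by simp
      qed
      then show ?thesis using init by simp
    qed
    have "D a + 0 * (s - a) \<le> D s"
      by (rule linear_lower_bound[OF as dD]) (use D1 in auto)
    then show ?thesis using E[of s] D1[of s] as by simp
  qed
  have "0 \<le> D r" if "a \<le> r" "r \<le> t" for r
  proof (rule ccontr)
    assume "\<not> 0 \<le> D r"
    then have "D r \<le> 0" by simp
    have "continuous_on {a..r} D"
      using dD by (intro continuous_at_imp_continuous_on ballI) (auto intro: DERIV_isCont)
    then obtain s where s: "a < s" "s \<le> r" "D s = 0" "\<And>q. a \<le> q \<Longrightarrow> q < s \<Longrightarrow> D q > 0"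
      using first_zero[OF _ \<open>a \<le> r\<close> init(1) \<open>D r \<le> 0\<close>] by blast
    have "D a \<le> D s"
      using while_nonneg[of s] s by (metis less_eq_real_def)
    then show False using s init by simp
  qed
  then show ?thesis using while_nonneg[OF t] by simp
qed

text \<open>In the cone \<open>D'' \<ge> lam * D\<close> stays above a positive constant.\<close>

lemma cone_unbounded:
  assumes init: "D a > 0" "D1 a \<ge> 0" "E a \<ge> 0" "E1 a \<ge> 0"
  shows "\<exists>t\<ge>a. D t > B"
proof -
  define c where "c = lam * D a"
  have c: "c > 0" using lam init by (simp add: c_def)
  have D2: "c \<le> lam * D s + E s" if "a \<le> s" for s
  proof -
    have "lam * D a \<le> lam * D s" using cone_invariant[OF init that] lam by simp
    then show ?thesis using cone_invariant[OF init that] by (simp add: c_def)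
  qed
  have D1: "c \<le> D1 s" if s: "a + 1 \<le> s" for s
  proof -
    have "D1 a + c * (s - a) \<le> D1 s"
      by (rule linear_lower_bound[OF _ dD1]) (use s D2 in auto)
    moreover have "c * 1 \<le> c * (s - a)" using c s by (intro mult_left_mono) auto
    ultimately show ?thesis using init by simp
  qed
  define t where "t = a + 1 + (\<bar>B\<bar> + 1) / c"
  have t: "a + 1 \<le> t" using c by (simp add: t_def)
  have "D (a + 1) + c * (t - (a + 1)) \<le> D t"
    by (rule linear_lower_bound[OF t dD]) (use D1 in auto)
  moreover have "c * (t - (a + 1)) = \<bar>B\<bar> + 1" using c by (simp add: t_def)
  moreover have "D (a + 1) > 0" using cone_invariant[OF init, of "a + 1"] init by simp
  ultimately have "D t > B" by linarith
  then show ?thesis using t by (intro exI[of _ t]) auto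
qed

text \<open>At a point of contact of order one, the sign of the second or third derivative decides: the
  difference enters the cone at once.\<close>

lemma cone_entry:
  assumes init: "D a = 0" "D1 a = 0" "E a \<ge> 0" "E1 a \<ge> 0" "E a > 0 \<or> E1 a > 0" and t: "a < t"
  shows "D t > 0 \<and> D1 t \<ge> 0 \<and> E t \<ge> 0 \<and> E1 t \<ge> 0"
proof -
  have "\<forall>\<^sub>F s in at_right a. lam * D s + E s > 0"
  proof (rule eventually_pos_right)
    show "((\<lambda>s. lam * D s + E s) has_real_derivative lam * D1 a + E1 a) (at a)"
      using dD dE by (auto intro!: derivative_eq_intros)
  qed (use init in auto)
  moreover have "\<forall>\<^sub>F s in at_right a. E s > 0"
    by (rule eventually_pos_right[OF dE]) (use init in auto)
  moreover have "\<forall>\<^sub>F s in at_right a. E1 s > 0"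
    by (rule eventually_pos_right[OF dE1]) (use init h[of a] nu in \<open>auto simp: add_pos_nonneg\<close>)
  ultimately have "\<forall>\<^sub>F s in at_right a. lam * D s + E s > 0 \<and> E s > 0 \<and> E1 s > 0"
    by eventually_elim simp
  then obtain b where b: "b > a" "\<And>s. a < s \<Longrightarrow> s < b \<Longrightarrow> lam * D s + E s > 0 \<and> E s > 0 \<and> E1 s > 0"
    unfolding eventually_at_right_field by blast
  have D1: "D1 s > 0" if s: "a < s" "s < b" for s
  proof -
    obtain r where "a < r" "r < s" "D1 s - D1 a = (s - a) * (lam * D r + E r)"
      using MVT2[OF \<open>a < s\<close> dD1] by blast
    then show ?thesis using b(2)[of r] s init by simp
  qed
  have D: "D s > 0" if s: "a < s" "s < b" for s
  proof -
    obtain r where "a < r" "r < s" "D s - D a = (s - a) * D1 r"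
      using MVT2[OF \<open>a < s\<close> dD] by blast
    then show ?thesis using D1[of r] s init by simp
  qed
  define s where "s = min t ((a + b) / 2)"
  have s: "a < s" "s < b" "s \<le> t" using t b by (auto simp: s_def min_def)
  have "D s \<le> D t \<and> 0 \<le> D1 t \<and> 0 \<le> E t \<and> 0 \<le> E1 t"
    by (rule cone_invariant) (use s D D1 b(2)[of s] in \<open>auto intro: less_imp_le\<close>)
  then show ?thesis using D[of s] s by auto
qed

end

text \<open>Solutions are represented by their jets: \<open>y k\<close> is the \<open>k\<close>-th derivative of the solution \<open>y 0\<close>.
  The parameters \<open>lam\<close> and \<open>nu\<close> are the two characteristic roots, so the linear part is
  \<open>(d\<^sup>2/dt\<^sup>2 - lam) (d\<^sup>2/dt\<^sup>2 - nu)\<close>.\<close>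

definition solves :: "real \<Rightarrow> real \<Rightarrow> (real \<Rightarrow> real) \<Rightarrow> (nat \<Rightarrow> real \<Rightarrow> real) \<Rightarrow> bool" where
  "solves lam nu f y \<longleftrightarrow> (\<forall>t.
     (y 0 has_real_derivative y 1 t) (at t) \<and>
     (y 1 has_real_derivative y 2 t) (at t) \<and>
     (y 2 has_real_derivative y 3 t) (at t) \<and>
     (y 3 has_real_derivative (lam + nu) * y 2 t - lam * nu * y 0 t + f (y 0 t)) (at t))"

definition translate :: "real \<Rightarrow> (nat \<Rightarrow> real \<Rightarrow> real) \<Rightarrow> nat \<Rightarrow> real \<Rightarrow> real" where
  "translate c y = (\<lambda>k t. y k (t + c))"

definition reflect :: "(nat \<Rightarrow> real \<Rightarrow> real) \<Rightarrow> nat \<Rightarrow> real \<Rightarrow> real" where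
  "reflect y = (\<lambda>k t. (-1) ^ k * y k (- t))"

lemma reflect_simps [simp]:
  "reflect y 0 t = y 0 (- t)" "reflect y (Suc 0) t = - y 1 (- t)"
  "reflect y 2 t = y 2 (- t)" "reflect y 3 t = - y 3 (- t)"
  by (simp_all add: reflect_def)

lemma translate_simps [simp]: "translate c y k t = y k (t + c)"
  by (simp add: translate_def)

lemma solvesD:
  assumes "solves lam nu f y"
  shows "(y 0 has_real_derivative y 1 t) (at t)"
    and "(y 1 has_real_derivative y 2 t) (at t)"
    and "(y 2 has_real_derivative y 3 t) (at t)"
    and "(y 3 has_real_derivative (lam + nu) * y 2 t - lam * nu * y 0 t + f (y 0 t)) (at t)"
  using assms by (simp_all add: solves_def)

lemma solves_translate:
  assumes "solves lam nu f y" shows "solves lam nu f (translate c y)"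
  using assms unfolding solves_def translate_def by (simp add: DERIV_shift[symmetric])

lemma solves_reflect:
  assumes "solves lam nu f y" shows "solves lam nu f (reflect y)"
proof -
  have *: "((\<lambda>t. s * g (- t)) has_real_derivative - s * g' (- t)) (at t)"
    if "\<And>t. (g has_real_derivative g' t) (at t)" for s t :: real and g g' :: "real \<Rightarrow> real"
    using DERIV_cmult[OF DERIV_chain2[where f = g and g = uminus, OF that DERIV_minus[OF DERIV_ident]], of s]
    by (simp add: algebra_simps)
  show ?thesis
    unfolding solves_def reflect_def
    using *[OF solvesD(1)[OF assms], of 1] *[OF solvesD(2)[OF assms], of "-1"]
      *[OF solvesD(3)[OF assms], of 1] *[OF solvesD(4)[OF assms], of "-1"]
    by (simp add: algebra_simps)
qed

locale monotone_nonlinearity =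
  fixes lam nu :: real and f :: "real \<Rightarrow> real"
  assumes lam_pos: "lam > 0" and nu_pos: "nu > 0" and f_mono: "mono f" and f_0: "f 0 = 0"
begin

lemma difference_cooperative:
  assumes "solves lam nu f x" "solves lam nu f y"
  shows "cooperative_system lam nu (\<lambda>t. x 0 t - y 0 t) (\<lambda>t. x 1 t - y 1 t)
     (\<lambda>t. (x 2 t - y 2 t) - lam * (x 0 t - y 0 t)) (\<lambda>t. (x 3 t - y 3 t) - lam * (x 1 t - y 1 t))
     (\<lambda>t. f (x 0 t) - f (y 0 t))"
proof
  note d = solvesD[OF assms(1)] solvesD[OF assms(2)]
  fix t
  show "((\<lambda>t. x 0 t - y 0 t) has_real_derivative x 1 t - y 1 t) (at t)"
    using d(1,5) by (intro DERIV_diff)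
  show "((\<lambda>t. x 1 t - y 1 t) has_real_derivative
      lam * (x 0 t - y 0 t) + ((x 2 t - y 2 t) - lam * (x 0 t - y 0 t))) (at t)"
    using DERIV_diff[OF d(2,6)] by simp
  show "((\<lambda>t. (x 2 t - y 2 t) - lam * (x 0 t - y 0 t)) has_real_derivative
      (x 3 t - y 3 t) - lam * (x 1 t - y 1 t)) (at t)"
    using d(1,3,5,7) by (intro DERIV_diff DERIV_cmult)
  show "((\<lambda>t. (x 3 t - y 3 t) - lam * (x 1 t - y 1 t)) has_real_derivative
      nu * ((x 2 t - y 2 t) - lam * (x 0 t - y 0 t)) + (f (x 0 t) - f (y 0 t))) (at t)"
    using DERIV_diff[OF DERIV_diff[OF d(4,8)] DERIV_cmult[OF DERIV_diff[OF d(2,6)], of lam]]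
    by (simp add: algebra_simps)
  show "0 \<le> x 0 t - y 0 t \<Longrightarrow> 0 \<le> f (x 0 t) - f (y 0 t)"
    using monoD[OF f_mono] by simp
qed (fact lam_pos nu_pos)+

lemma comparison:
  assumes xy: "solves lam nu f x" "solves lam nu f y"
    and init: "x 0 a = y 0 a" "x 1 a = y 1 a" "x 2 a \<ge> y 2 a" "x 3 a \<ge> y 3 a"
      "x 2 a \<noteq> y 2 a \<or> x 3 a \<noteq> y 3 a" and t: "a < t"
  shows "x 0 t > y 0 t"
proof -
  interpret cooperative_system lam nu "\<lambda>t. x 0 t - y 0 t" "\<lambda>t. x 1 t - y 1 t"
     "\<lambda>t. (x 2 t - y 2 t) - lam * (x 0 t - y 0 t)" "\<lambda>t. (x 3 t - y 3 t) - lam * (x 1 t - y 1 t)"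
     "\<lambda>t. f (x 0 t) - f (y 0 t)"
    by (rule difference_cooperative[OF xy])
  show ?thesis using cone_entry[of a t] init t by auto
qed

text \<open>The rigidity that carries the whole classification: two bounded solutions that touch to first
  order, with second and third derivatives ordered in the same direction, agree to third order.\<close>

lemma comparison_unbounded:
  assumes xy: "solves lam nu f x" "solves lam nu f y"
    and init: "x 0 a = y 0 a" "x 1 a = y 1 a" "x 2 a \<ge> y 2 a" "x 3 a \<ge> y 3 a"
      "x 2 a \<noteq> y 2 a \<or> x 3 a \<noteq> y 3 a"
  shows "\<exists>t. x 0 t - y 0 t > B"
proof -
  interpret cooperative_system lam nu "\<lambda>t. x 0 t - y 0 t" "\<lambda>t. x 1 t - y 1 t"
     "\<lambda>t. (x 2 t - y 2 t) - lam * (x 0 t - y 0 t)" "\<lambda>t. (x 3 t - y 3 t) - lam * (x 1 t - y 1 t)"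
     "\<lambda>t. f (x 0 t) - f (y 0 t)"
    by (rule difference_cooperative[OF xy])
  have "x 0 (a+1) - y 0 (a+1) > 0 \<and> x 1 (a+1) - y 1 (a+1) \<ge> 0 \<and>
    (x 2 (a+1) - y 2 (a+1)) - lam * (x 0 (a+1) - y 0 (a+1)) \<ge> 0 \<and>
    (x 3 (a+1) - y 3 (a+1)) - lam * (x 1 (a+1) - y 1 (a+1)) \<ge> 0"
    using cone_entry[of a "a + 1"] init by auto
  then show ?thesis using cone_unbounded[of "a + 1" B] by blast
qed

text \<open>The cone of the comparison with the zero solution. A solution that enters it grows without
  bound.\<close>

definition ascending :: "(nat \<Rightarrow> real \<Rightarrow> real) \<Rightarrow> real \<Rightarrow> bool" where
  "ascending y t \<longleftrightarrow> 0 < y 0 t \<and> 0 \<le> y 1 t \<and> lam * y 0 t \<le> y 2 t \<and> lam * y 1 t \<le> y 3 t"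

lemma zero_solves: "solves lam nu f (\<lambda>_ _. 0)"
  by (simp add: solves_def f_0)

lemma ascending_persists:
  assumes y: "solves lam nu f y" and "ascending y a" "a \<le> t"
  shows "ascending y t" "y 0 a \<le> y 0 t"
proof -
  interpret cooperative_system lam nu "\<lambda>t. y 0 t - 0" "\<lambda>t. y 1 t - 0"
     "\<lambda>t. (y 2 t - 0) - lam * (y 0 t - 0)" "\<lambda>t. (y 3 t - 0) - lam * (y 1 t - 0)"
     "\<lambda>t. f (y 0 t) - f 0"
    using difference_cooperative[OF y zero_solves] by simp
  show "ascending y t" "y 0 a \<le> y 0 t"
    using cone_invariant[of a t] assms by (auto simp: ascending_def)
qed

lemma ascending_unbounded:
  assumes y: "solves lam nu f y" and "ascending y a"
  shows "\<exists>t\<ge>a. y 0 t > B"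
proof -
  interpret cooperative_system lam nu "\<lambda>t. y 0 t - 0" "\<lambda>t. y 1 t - 0"
     "\<lambda>t. (y 2 t - 0) - lam * (y 0 t - 0)" "\<lambda>t. (y 3 t - 0) - lam * (y 1 t - 0)"
     "\<lambda>t. f (y 0 t) - f 0"
    using difference_cooperative[OF y zero_solves] by simp
  show ?thesis
    using cone_unbounded[of a B] assms by (auto simp: ascending_def)
qed

end

locale lipschitz_nonlinearity = monotone_nonlinearity +
  fixes L :: real
  assumes f_lip: "\<And>s r. \<bar>f s - f r\<bar> \<le> L * \<bar>s - r\<bar>"
begin

definition phase_field :: "real \<times> real \<times> real \<times> real \<Rightarrow> real \<times> real \<times> real \<times> real" where
  "phase_field = (\<lambda>(x0, x1, x2, x3). (x1, x2, x3, (lam + nu) * x2 - lam * nu * x0 + f x0))"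

definition rate :: real where
  "rate = 3 + (lam + nu) + lam * nu + L"

lemma L_nonneg: "L \<ge> 0"
  using order_trans[OF abs_ge_zero f_lip[of 1 0]] by simp

lemma rate_pos: "rate > 0"
  using lam_pos nu_pos L_nonneg by (simp add: rate_def add_pos_pos add_pos_nonneg)

lemma norm_quadruple:
  fixes a b c d :: real
  shows "\<bar>a\<bar> \<le> norm (a, b, c, d)" "\<bar>b\<bar> \<le> norm (a, b, c, d)" "\<bar>c\<bar> \<le> norm (a, b, c, d)"
    "\<bar>d\<bar> \<le> norm (a, b, c, d)" "norm (a, b, c, d) \<le> \<bar>a\<bar> + \<bar>b\<bar> + \<bar>c\<bar> + \<bar>d\<bar>"
proof -
  have 1: "\<bar>a\<bar> \<le> norm (a, b, c, d)" "norm (b, c, d) \<le> norm (a, b, c, d)"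
    using norm_fst_le[of a "(b, c, d)"] norm_snd_le[of "(b, c, d)" a] by auto
  have 2: "\<bar>b\<bar> \<le> norm (b, c, d)" "norm (c, d) \<le> norm (b, c, d)"
    using norm_fst_le[of b "(c, d)"] norm_snd_le[of "(c, d)" b] by auto
  have 3: "\<bar>c\<bar> \<le> norm (c, d)" "\<bar>d\<bar> \<le> norm (c, d)"
    using norm_fst_le[of c d] norm_snd_le[of d c] by auto
  show "\<bar>a\<bar> \<le> norm (a, b, c, d)" "\<bar>b\<bar> \<le> norm (a, b, c, d)" "\<bar>c\<bar> \<le> norm (a, b, c, d)"
    "\<bar>d\<bar> \<le> norm (a, b, c, d)" using 1 2 3 by auto
  show "norm (a, b, c, d) \<le> \<bar>a\<bar> + \<bar>b\<bar> + \<bar>c\<bar> + \<bar>d\<bar>"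
    using norm_Pair_le[of a "(b, c, d)"] norm_Pair_le[of b "(c, d)"] norm_Pair_le[of c d] by simp
qed

lemma phase_field_lipschitz: "norm (phase_field x - phase_field y) \<le> rate * norm (x - y)"
proof -
  obtain x0 x1 x2 x3 y0 y1 y2 y3 where xy: "x = (x0, x1, x2, x3)" "y = (y0, y1, y2, y3)"
    by (metis surj_pair)
  define N where "N = norm (x - y)"
  have N: "\<bar>x0 - y0\<bar> \<le> N" "\<bar>x1 - y1\<bar> \<le> N" "\<bar>x2 - y2\<bar> \<le> N" "\<bar>x3 - y3\<bar> \<le> N"
    by (simp_all add: N_def xy norm_quadruple)
  have "norm (phase_field x - phase_field y) \<le> \<bar>x1 - y1\<bar> + \<bar>x2 - y2\<bar> + \<bar>x3 - y3\<bar> +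
     \<bar>((lam + nu) * x2 - lam * nu * x0 + f x0) - ((lam + nu) * y2 - lam * nu * y0 + f y0)\<bar>"
    using norm_quadruple(5)[of "x1 - y1" "x2 - y2" "x3 - y3"] by (simp add: xy phase_field_def)
  also have "\<dots> \<le> \<bar>x1 - y1\<bar> + \<bar>x2 - y2\<bar> + \<bar>x3 - y3\<bar> +
     (\<bar>(lam + nu) * (x2 - y2)\<bar> + \<bar>lam * nu * (x0 - y0)\<bar> + \<bar>f x0 - f y0\<bar>)"
    by (intro add_left_mono) (auto simp: algebra_simps)
  also have "\<dots> = \<bar>x1 - y1\<bar> + \<bar>x2 - y2\<bar> + \<bar>x3 - y3\<bar> +
     ((lam + nu) * \<bar>x2 - y2\<bar> + lam * nu * \<bar>x0 - y0\<bar> + \<bar>f x0 - f y0\<bar>)"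
    using lam_pos nu_pos by (simp add: abs_mult)
  also have "\<dots> \<le> N + N + N + ((lam + nu) * N + lam * nu * N + L * N)"
    using N lam_pos nu_pos L_nonneg f_lip[of x0 y0] mult_left_mono[OF N(1), of L]
    by (intro add_mono mult_left_mono) auto
  also have "\<dots> = rate * N" by (simp add: rate_def algebra_simps)
  finally show ?thesis by (simp add: N_def)
qed

lemma solves_phase_field:
  assumes "solves lam nu f y"
  shows "((\<lambda>t. (y 0 t, y 1 t, y 2 t, y 3 t)) has_vector_derivative phase_field (y 0 t, y 1 t, y 2 t, y 3 t)) (at t)"
  using solvesD[OF assms] unfolding has_real_derivative_iff_has_vector_derivative
  by (auto simp: phase_field_def intro!: has_vector_derivative_Pair)

theorem solution_exists:
  "\<exists>y. solves lam nu f y \<and> y 0 0 = c0 \<and> y 1 0 = c1 \<and> y 2 0 = c2 \<and> y 3 0 = c3"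
proof -
  obtain Y where Y0: "Y 0 = (c0, c1, c2, c3)" and Y: "\<And>t. (Y has_vector_derivative phase_field (Y t)) (at t)"
    using lipschitz_ode_exists[OF phase_field_lipschitz rate_pos] by blast
  define y where "y = (\<lambda>k::nat. if k = 0 then (\<lambda>t. fst (Y t)) else if k = 1 then (\<lambda>t. fst (snd (Y t)))
     else if k = 2 then (\<lambda>t. fst (snd (snd (Y t)))) else (\<lambda>t. snd (snd (snd (Y t)))))"
  have y: "y 0 = (\<lambda>t. fst (Y t))" "y 1 = (\<lambda>t. fst (snd (Y t)))"
    "y 2 = (\<lambda>t. fst (snd (snd (Y t))))" "y 3 = (\<lambda>t. snd (snd (snd (Y t))))"
    by (simp_all add: y_def)
  note fst' = bounded_linear.has_vector_derivative[OF bounded_linear_fst]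
  note snd' = bounded_linear.has_vector_derivative[OF bounded_linear_snd]
  have "solves lam nu f y"
    unfolding solves_def has_real_derivative_iff_has_vector_derivative y
    using fst'[OF Y] fst'[OF snd'[OF Y]] fst'[OF snd'[OF snd'[OF Y]]] snd'[OF snd'[OF snd'[OF Y]]]
    by (simp add: phase_field_def case_prod_unfold)
  then show ?thesis using Y0 by (intro exI[of _ y]) (simp add: y del: One_nat_def)
qed

lemma dependence:
  assumes x: "solves lam nu f x" and y: "solves lam nu f y" and t: "t \<ge> 0" and k: "k \<le> 3"
  shows "\<bar>x k t - y k t\<bar> \<le> exp (rate * t) *
    (\<bar>x 0 0 - y 0 0\<bar> + \<bar>x 1 0 - y 1 0\<bar> + \<bar>x 2 0 - y 2 0\<bar> + \<bar>x 3 0 - y 3 0\<bar>)"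
proof -
  have "norm ((x 0 t, x 1 t, x 2 t, x 3 t) - (y 0 t, y 1 t, y 2 t, y 3 t))
    \<le> exp (rate * t) * norm ((x 0 0, x 1 0, x 2 0, x 3 0) - (y 0 0, y 1 0, y 2 0, y 3 0))"
    by (rule lipschitz_ode_dependence_forward[OF phase_field_lipschitz solves_phase_field[OF x] solves_phase_field[OF y] t])
  also have "\<dots> \<le> exp (rate * t) *
    (\<bar>x 0 0 - y 0 0\<bar> + \<bar>x 1 0 - y 1 0\<bar> + \<bar>x 2 0 - y 2 0\<bar> + \<bar>x 3 0 - y 3 0\<bar>)"
    using norm_quadruple(5) by (intro mult_left_mono) auto
  finally have *: "norm (x 0 t - y 0 t, x 1 t - y 1 t, x 2 t - y 2 t, x 3 t - y 3 t) \<le> exp (rate * t) *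
    (\<bar>x 0 0 - y 0 0\<bar> + \<bar>x 1 0 - y 1 0\<bar> + \<bar>x 2 0 - y 2 0\<bar> + \<bar>x 3 0 - y 3 0\<bar>)" by simp
  have "k = 0 \<or> k = 1 \<or> k = 2 \<or> k = 3" using k by auto
  then show ?thesis
    using order_trans[OF norm_quadruple(1) *] order_trans[OF norm_quadruple(2) *]
      order_trans[OF norm_quadruple(3) *] order_trans[OF norm_quadruple(4) *] by auto
qed

theorem solution_unique:
  assumes x: "solves lam nu f x" and y: "solves lam nu f y"
    and init: "x 0 a = y 0 a" "x 1 a = y 1 a" "x 2 a = y 2 a" "x 3 a = y 3 a"
  shows "x 0 t = y 0 t"
proof (cases "a \<le> t")
  case True
  have "\<bar>translate a x 0 (t - a) - translate a y 0 (t - a)\<bar> \<le> exp (rate * (t - a)) *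
    (\<bar>translate a x 0 0 - translate a y 0 0\<bar> + \<bar>translate a x 1 0 - translate a y 1 0\<bar> +
     \<bar>translate a x 2 0 - translate a y 2 0\<bar> + \<bar>translate a x 3 0 - translate a y 3 0\<bar>)"
    by (rule dependence[OF solves_translate[OF x] solves_translate[OF y]]) (use True in auto)
  then show ?thesis using init by simp
next
  case False
  let ?x = "reflect (translate a x)" and ?y = "reflect (translate a y)"
  have "\<bar>?x 0 (a - t) - ?y 0 (a - t)\<bar> \<le> exp (rate * (a - t)) *
    (\<bar>?x 0 0 - ?y 0 0\<bar> + \<bar>?x 1 0 - ?y 1 0\<bar> + \<bar>?x 2 0 - ?y 2 0\<bar> + \<bar>?x 3 0 - ?y 3 0\<bar>)"
    by (rule dependence[OF solves_reflect[OF solves_translate[OF x]] solves_reflect[OF solves_translate[OF y]]])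
       (use False in auto)
  then show ?thesis using init by simp
qed

end

section \<open>Bounded solutions: symmetry, periodicity and limits\<close>

text \<open>Here \<open>g3 - K g1\<close> is the derivative of \<open>q = g'' - K g\<close>. If it stays positive, \<open>q\<close> tends to
  infinity; while \<open>g\<close> is bounded this forces \<open>g'' \<ge> 1\<close> from some time on, which is impossible.\<close>

lemma drift_unbounded:
  fixes g :: "real \<Rightarrow> real"
  assumes d0: "\<And>t. (g has_real_derivative g1 t) (at t)"
    and d1: "\<And>t. (g1 has_real_derivative g2 t) (at t)"
    and d2: "\<And>t. (g2 has_real_derivative g3 t) (at t)"
    and K: "K \<ge> 0" and bd: "\<And>t. t \<ge> a \<Longrightarrow> \<bar>g t\<bar> \<le> M"
    and c: "c > 0" "\<And>t. t \<ge> a \<Longrightarrow> c \<le> g3 t - K * g1 t"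
  shows False
proof -
  have M: "M \<ge> 0" using order_trans[OF abs_ge_zero bd[of a]] by simp
  define q where "q = (\<lambda>t. g2 t - K * g t)"
  have dq: "(q has_real_derivative g3 t - K * g1 t) (at t)" for t
    unfolding q_def using d2 d0 by (intro DERIV_diff DERIV_cmult)
  define a1 where "a1 = a + (\<bar>q a\<bar> + K * M + 1) / c"
  have a1: "a \<le> a1" using c M K by (simp add: a1_def)
  have g2: "1 \<le> g2 t" if t: "a1 \<le> t" for t
  proof -
    have "q a + c * (t - a) \<le> q t"
      by (rule linear_lower_bound[OF _ dq]) (use t a1 c in auto)
    moreover have "c * (a1 - a) \<le> c * (t - a)" using c t by (intro mult_left_mono) auto
    moreover have "c * (a1 - a) = \<bar>q a\<bar> + K * M + 1" using c by (simp add: a1_def)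
    moreover have "K * (- M) \<le> K * g t" using K bd[of t] t a1 by (intro mult_left_mono) auto
    ultimately show ?thesis by (simp add: q_def)
  qed
  define a2 where "a2 = a1 + \<bar>g1 a1\<bar> + 1"
  have g1: "1 \<le> g1 t" if t: "a2 \<le> t" for t
  proof -
    have "g1 a1 + 1 * (t - a1) \<le> g1 t"
      by (rule linear_lower_bound[OF _ d1]) (use t g2 in \<open>auto simp: a2_def\<close>)
    then show ?thesis using t by (simp add: a2_def)
  qed
  have "g a2 + 1 * ((a2 + 2 * M + 1) - a2) \<le> g (a2 + 2 * M + 1)"
    by (rule linear_lower_bound[OF _ d0]) (use g1 M in auto)
  moreover have "a \<le> a2" using a1 by (simp add: a2_def)
  ultimately show False using bd[of a2] bd[of "a2 + 2 * M + 1"] M by simp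
qed

text \<open>The function \<open>q = g'' - K g\<close> is strictly convex, hence grows at least linearly in one of the two
  directions of time.\<close>

lemma no_bounded_convex:
  fixes g :: "real \<Rightarrow> real"
  assumes d0: "\<And>t. (g has_real_derivative g1 t) (at t)"
    and d1: "\<And>t. (g1 has_real_derivative g2 t) (at t)"
    and d2: "\<And>t. (g2 has_real_derivative g3 t) (at t)"
    and d3: "\<And>t. (g3 has_real_derivative K * g2 t + h t) (at t)"
    and K: "K \<ge> 0" and bd: "\<And>t. \<bar>g t\<bar> \<le> M" and h: "\<And>t. h t > 0"
  shows False
proof -
  define r where "r = (\<lambda>t. g3 t - K * g1 t)"
  have dr: "(r has_real_derivative h t) (at t)" for t
    unfolding r_def using DERIV_diff[OF d3 DERIV_cmult[OF d1, of K], of t] by simp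
  have mono: "r s \<le> r t" if "s \<le> t" for s t
    by (rule DERIV_nonneg_imp_nondecreasing[OF that]) (use dr h in \<open>blast intro: less_imp_le\<close>)
  have "r 0 < r 1"
    by (rule DERIV_pos_imp_increasing) (use dr h in auto)
  then consider "r 1 > 0" | "r 0 < 0" by linarith
  then show False
  proof cases
    case 1
    show False
      by (rule drift_unbounded[OF d0 d1 d2 K bd 1, of 1]) (use mono in \<open>simp add: r_def\<close>)
  next
    case 2
    have neg: "((\<lambda>t. G (- t)) has_real_derivative - G' (- t)) (at t)"
      if "\<And>t. (G has_real_derivative G' t) (at t)" for G G' :: "real \<Rightarrow> real" and t
      using DERIV_chain2[where f = G and g = uminus, OF that DERIV_minus[OF DERIV_ident], of t] by simp
    show False
    proof (rule drift_unbounded[where g = "\<lambda>t. g (- t)" and ?g1.0 = "\<lambda>t. - g1 (- t)"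
          and ?g2.0 = "\<lambda>t. g2 (- t)" and ?g3.0 = "\<lambda>t. - g3 (- t)" and a = 0 and c = "- r 0", OF _ _ _ K])
      show "((\<lambda>t. g (- t)) has_real_derivative - g1 (- t)) (at t)" for t by (rule neg[OF d0])
      show "((\<lambda>t. - g1 (- t)) has_real_derivative g2 (- t)) (at t)" for t
        using DERIV_minus[OF neg[OF d1]] by simp
      show "((\<lambda>t. g2 (- t)) has_real_derivative - g3 (- t)) (at t)" for t by (rule neg[OF d2])
      show "- r 0 \<le> - g3 (- t) - K * - g1 (- t)" if "0 \<le> t" for t
        using mono[of "- t" 0] that by (simp add: r_def)
    qed (use 2 bd in auto)
  qed
qed

lemma eventually_drift_unbounded:
  fixes g :: "real \<Rightarrow> real"
  assumes d0: "\<And>t. (g has_real_derivative g1 t) (at t)"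
    and d1: "\<And>t. (g1 has_real_derivative g2 t) (at t)"
    and d2: "\<And>t. (g2 has_real_derivative g3 t) (at t)"
    and d3: "\<And>t. (g3 has_real_derivative K * g2 t + h t) (at t)"
    and K: "K \<ge> 0" and bd: "\<And>t. \<bar>g t\<bar> \<le> M" and c: "c > 0"
    and h: "eventually (\<lambda>t. h t > c) at_top"
  shows False
proof -
  define r where "r = (\<lambda>t. g3 t - K * g1 t)"
  have dr: "(r has_real_derivative h t) (at t)" for t
    unfolding r_def using DERIV_diff[OF d3 DERIV_cmult[OF d1, of K], of t] by simp
  obtain a where a: "\<And>t. t \<ge> a \<Longrightarrow> h t > c" using h by (auto simp: eventually_at_top_linorder)
  show False
  proof (rule drift_unbounded[OF d0 d1 d2 K bd zero_less_one])
    fix t assume t: "t \<ge> a + (\<bar>r a\<bar> + 1) / c"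
    have "0 \<le> (\<bar>r a\<bar> + 1) / c" using c by simp
    then have "a \<le> t" using t by linarith
    then have "r a + c * (t - a) \<le> r t"
      by (rule linear_lower_bound[OF _ dr]) (use a in \<open>auto intro: less_imp_le\<close>)
    moreover have "c * ((\<bar>r a\<bar> + 1) / c) \<le> c * (t - a)" using c t by (intro mult_left_mono) auto
    ultimately show "1 \<le> g3 t - K * g1 t" using c by (simp add: r_def)
  qed
qed

lemma half_less: "(x::real) > 0 \<Longrightarrow> x / 2 < x" by simp

lemma nonzero_constant_sign:
  fixes g :: "real \<Rightarrow> real"
  assumes "connected S" "continuous_on S g" "\<And>t. t \<in> S \<Longrightarrow> g t \<noteq> 0"
  shows "(\<forall>t\<in>S. g t > 0) \<or> (\<forall>t\<in>S. g t < 0)"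
proof (rule ccontr)
  assume "\<not> ?thesis"
  then obtain s t where st: "s \<in> S" "t \<in> S" "g s < 0" "g t > 0"
    using assms(3) by (metis linorder_neqE_linordered_idom)
  have "connected (g ` S)" using assms by (intro connected_continuous_image)
  then have "0 \<in> g ` S"
    using connectedD_interval[of "g ` S" "g s" "g t" 0] st by auto
  then show False using assms(3) by auto
qed

lemma increasing_bounded_limit:
  fixes g :: "real \<Rightarrow> real"
  assumes der: "\<And>t. (g has_real_derivative g' t) (at t)"
    and pos: "\<And>t. t > a \<Longrightarrow> g' t > 0" and bd: "\<And>t. g t \<le> M"
  shows "\<exists>l. (g \<longlongrightarrow> l) at_top \<and> (\<forall>t\<ge>a. g t < l)"
proof -
  have mono: "g s < g t" if "a \<le> s" "s < t" for s t
  proof (rule DERIV_pos_imp_increasing_open[OF \<open>s < t\<close>])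
    show "\<exists>y. (g has_real_derivative y) (at x) \<and> 0 < y" if "s < x" "x < t" for x
      using der[of x] pos[of x] that \<open>a \<le> s\<close> by auto
    show "continuous_on {s..t} g"
      using der by (intro continuous_at_imp_continuous_on ballI) (auto intro: DERIV_isCont)
  qed
  define l where "l = Sup (g ` {a..})"
  have bdd: "bdd_above (g ` {a..})" using bd by (intro bdd_aboveI[of _ M]) auto
  have le: "g t \<le> l" if "t \<ge> a" for t
    unfolding l_def using that bdd by (intro cSup_upper) auto
  have lt: "g t < l" if "t \<ge> a" for t
    using le[of "t + 1"] mono[of t "t + 1"] that by auto
  moreover have "(g \<longlongrightarrow> l) at_top"
  proof (rule increasing_tendsto)
    show "\<forall>\<^sub>F t in at_top. g t \<le> l"
      using le by (auto simp: eventually_at_top_linorder)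
    fix x assume "x < l"
    then obtain s where s: "s \<ge> a" "x < g s"
      unfolding l_def using less_cSup_iff[OF _ bdd] by auto
    then have "x < g t" if "t \<ge> s" for t
      using mono[of s t] that by (cases "t = s") auto
    then show "\<forall>\<^sub>F t in at_top. x < g t" by (auto simp: eventually_at_top_linorder)
  qed
  ultimately show ?thesis by blast
qed

lemma decreasing_bounded_limit:
  fixes g :: "real \<Rightarrow> real"
  assumes der: "\<And>t. (g has_real_derivative g' t) (at t)"
    and neg: "\<And>t. t > a \<Longrightarrow> g' t < 0" and bd: "\<And>t. M \<le> g t"
  shows "\<exists>l. (g \<longlongrightarrow> l) at_top \<and> (\<forall>t\<ge>a. l < g t)"
proof -
  obtain l where l: "((\<lambda>t. - g t) \<longlongrightarrow> l) at_top" "\<forall>t\<ge>a. - g t < l"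
    using increasing_bounded_limit[of "\<lambda>t. - g t" "\<lambda>t. - g' t" a "- M"] assms
    by (auto intro: DERIV_minus)
  then show ?thesis
    using tendsto_minus[OF l(1)] by (intro exI[of _ "- l"]) (auto simp: minus_less_iff)
qed

context lipschitz_nonlinearity
begin

text \<open>At a critical point a solution and its reflection agree to second order. If their third
  derivatives differed, the difference of these two bounded solutions would be unbounded.\<close>

lemma third_derivative_critical:
  assumes y: "solves lam nu f y" and bd: "\<And>t. \<bar>y 0 t\<bar> \<le> M" and crit: "y 1 a = 0"
  shows "y 3 a = 0"
proof (rule ccontr)
  let ?x = "translate a y"
  let ?z = "reflect ?x"
  have x: "solves lam nu f ?x" and z: "solves lam nu f ?z"
    using y by (simp_all add: solves_translate solves_reflect)
  assume "y 3 a \<noteq> 0"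
  then consider "y 3 a > 0" | "y 3 a < 0" by linarith
  then show False
  proof cases
    case 1
    then have "\<exists>t. ?x 0 t - ?z 0 t > 2 * M"
      by (intro comparison_unbounded[OF x z, of 0]) (use crit in auto)
    then obtain t where "y 0 (t + a) - y 0 (- t + a) > 2 * M" by auto
    then show False using bd[of "t + a"] bd[of "- t + a"] by linarith
  next
    case 2
    then have "\<exists>t. ?z 0 t - ?x 0 t > 2 * M"
      by (intro comparison_unbounded[OF z x, of 0]) (use crit in auto)
    then obtain t where "y 0 (- t + a) - y 0 (t + a) > 2 * M" by auto
    then show False using bd[of "t + a"] bd[of "- t + a"] by linarith
  qed
qed

lemma symmetric_about_critical_point:
  assumes y: "solves lam nu f y" and bd: "\<And>t. \<bar>y 0 t\<bar> \<le> M" and crit: "y 1 a = 0"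
  shows "y 0 (a + t) = y 0 (a - t)"
proof -
  have "translate a y 0 t = reflect (translate a y) 0 t"
    using solution_unique[OF solves_translate[OF y] solves_reflect[OF solves_translate[OF y]], of a 0 a t]
      third_derivative_critical[OF assms] crit by simp
  then show ?thesis by (simp add: add.commute)
qed

text \<open>The composition of the reflections about the two points is a translation.\<close>

lemma two_critical_points_periodic:
  assumes y: "solves lam nu f y" and bd: "\<And>t. \<bar>y 0 t\<bar> \<le> M"
    and crit: "y 1 a = 0" "y 1 b = 0" "a < b"
  shows "periodic (y 0)"
  unfolding periodic_def
proof (intro exI conjI allI)
  show "2 * (b - a) > 0" using crit by simp
  fix t
  show "y 0 (t + 2 * (b - a)) = y 0 t"
    using symmetric_about_critical_point[OF y bd crit(2), of "t + b - 2 * a"]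
      symmetric_about_critical_point[OF y bd crit(1), of "a - t"]
    by (simp add: algebra_simps)
qed

lemma f_continuous: "isCont f s"
proof -
  have "L-lipschitz_on UNIV f"
    using f_lip L_nonneg by (intro lipschitz_onI) (auto simp: dist_real_def)
  then show ?thesis
    using lipschitz_on_continuous_on continuous_on_eq_continuous_at[OF open_UNIV] by blast
qed

end

text \<open>The equation has the equilibria \<open>0\<close> and \<open>l\<close>, and \<open>f s - lam * nu * s\<close>, the second derivative of
  \<open>y 2 - (lam + nu) * y 0\<close>, changes sign at \<open>l\<close>.\<close>

locale bistable_nonlinearity = lipschitz_nonlinearity +
  fixes l :: real
  assumes l_pos: "l > 0"
    and f_below: "\<And>s. 0 < s \<Longrightarrow> s < l \<Longrightarrow> f s < lam * nu * s"
    and f_above: "\<And>s. l < s \<Longrightarrow> lam * nu * s < f s"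
begin

lemma limit_is_equilibrium:
  assumes y: "solves lam nu f y" and bd: "\<And>t. \<bar>y 0 t\<bar> \<le> M" and lim: "(y 0 \<longlongrightarrow> c) at_top"
  shows "f c = lam * nu * c"
proof -
  note d = solvesD[OF y]
  define h where "h = (\<lambda>t. f (y 0 t) - lam * nu * y 0 t)"
  have K: "lam + nu \<ge> 0" using lam_pos nu_pos by simp
  have d3: "(y 3 has_real_derivative (lam + nu) * y 2 t + h t) (at t)" for t
    using d(4)[of t] by (simp add: h_def algebra_simps)
  have h: "(h \<longlongrightarrow> f c - lam * nu * c) at_top"
    unfolding h_def using lim by (intro tendsto_intros isCont_tendsto_compose[OF f_continuous])
  show ?thesis
  proof (rule ccontr)
    assume "f c \<noteq> lam * nu * c"
    then consider "f c - lam * nu * c > 0" | "f c - lam * nu * c < 0" by linarith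
    then show False
    proof cases
      case 1
      show False
        by (rule eventually_drift_unbounded[OF d(1) d(2) d(3) d3 K bd half_gt_zero[OF 1]
              order_tendstoD(1)[OF h]]) (rule half_less[OF 1])
    next
      case 2
      have "\<forall>\<^sub>F t in at_top. - h t > - (f c - lam * nu * c) / 2"
        by (rule order_tendstoD(1)[OF tendsto_minus[OF h]], rule half_less) (use 2 in simp)
      moreover have "((\<lambda>t. - y 3 t) has_real_derivative (lam + nu) * (- y 2 t) + (- h t)) (at t)" for t
        using DERIV_minus[OF d3[of t]] by simp
      ultimately show False
        by (intro eventually_drift_unbounded[where g = "\<lambda>t. - y 0 t" and M = M and K = "lam + nu" and
              c = "- (f c - lam * nu * c) / 2" and h = "\<lambda>t. - h t",
              OF DERIV_minus[OF d(1)] DERIV_minus[OF d(2)] DERIV_minus[OF d(3)] _ K])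
           (use bd 2 in auto)
    qed
  qed
qed

text \<open>On one side of \<open>l\<close> the function \<open>y 2 - (lam + nu) * y 0\<close> is strictly convex or strictly concave
  on the whole line. This excludes monotone convergence to \<open>l\<close>, which a local analysis could not
  do: for the power nonlinearity the linearised equation at \<open>l\<close> has solutions of this kind.\<close>

lemma meets_equilibrium:
  assumes y: "solves lam nu f y" and bd: "\<And>t. 0 < y 0 t" "\<And>t. y 0 t \<le> M"
  shows "\<not> (\<forall>t. y 0 t < l)" "\<not> (\<forall>t. y 0 t > l)"
proof -
  note d = solvesD[OF y]
  define h where "h = (\<lambda>t. f (y 0 t) - lam * nu * y 0 t)"
  have K: "lam + nu \<ge> 0" using lam_pos nu_pos by simp
  have d3: "(y 3 has_real_derivative (lam + nu) * y 2 t + h t) (at t)" for t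
    using d(4)[of t] by (simp add: h_def algebra_simps)
  have abs: "\<bar>y 0 t\<bar> \<le> M" for t using bd[of t] by simp
  show "\<not> (\<forall>t. y 0 t > l)"
  proof
    assume "\<forall>t. y 0 t > l"
    then have "h t > 0" for t using f_above by (simp add: h_def)
    then show False by (rule no_bounded_convex[OF d(1) d(2) d(3) d3 K abs])
  qed
  show "\<not> (\<forall>t. y 0 t < l)"
  proof
    assume "\<forall>t. y 0 t < l"
    then have "- h t > 0" for t using f_below bd by (simp add: h_def)
    moreover have "((\<lambda>t. - y 3 t) has_real_derivative (lam + nu) * (- y 2 t) + (- h t)) (at t)" for t
      using DERIV_minus[OF d3[of t]] by simp
    ultimately show False
      by (intro no_bounded_convex[where g = "\<lambda>t. - y 0 t" and M = M and K = "lam + nu" and h = "\<lambda>t. - h t",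
              OF DERIV_minus[OF d(1)] DERIV_minus[OF d(2)] DERIV_minus[OF d(3)] _ K])
         (use abs in auto)
  qed
qed

text \<open>Without two critical points the solution is monotone at infinity and, by the symmetry about its
  critical point if there is one, lies strictly on one side of its limit. Since it cannot
  stay on one side of \<open>l\<close>, the limit is the other equilibrium.\<close>

theorem periodic_or_vanishing:
  assumes y: "solves lam nu f y" and bd: "\<And>t. 0 < y 0 t" "\<And>t. y 0 t \<le> M"
    and np: "\<not> periodic (y 0)"
  shows "(y 0 \<longlongrightarrow> 0) at_top"
proof -
  note d = solvesD[OF y]
  have abs: "\<bar>y 0 t\<bar> \<le> M" for t using bd[of t] by simp
  have cont: "continuous_on S (y 1)" for S
    using d(2) by (intro continuous_at_imp_continuous_on ballI) (auto intro: DERIV_isCont)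
  have one: "s = t" if "y 1 s = 0" "y 1 t = 0" for s t
    using two_critical_points_periodic[OF y abs] np that by (metis linorder_neqE_linordered_idom)
  have "\<exists>a. (\<forall>t>a. y 1 t \<noteq> 0) \<and> (y 1 a = 0 \<or> (\<forall>t. y 1 t \<noteq> 0))"
  proof (cases "\<exists>a. y 1 a = 0")
    case True
    then obtain a where "y 1 a = 0" by blast
    moreover have "y 1 t \<noteq> 0" if "t > a" for t using one[OF _ \<open>y 1 a = 0\<close>, of t] that by auto
    ultimately show ?thesis by blast
  qed auto
  then obtain a where nz: "\<And>t. t > a \<Longrightarrow> y 1 t \<noteq> 0" and a: "y 1 a = 0 \<or> (\<forall>t. y 1 t \<noteq> 0)"
    by blast
  have up: "\<exists>c. (y 0 \<longlongrightarrow> c) at_top \<and> (\<forall>t. y 0 t < c)" if pos: "\<forall>t\<in>{a<..}. y 1 t > 0"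
  proof -
    obtain c where c: "(y 0 \<longlongrightarrow> c) at_top" "\<forall>t\<ge>a. y 0 t < c"
      using increasing_bounded_limit[OF d(1), of a M] pos bd by auto
    have "y 0 t < c" for t
    proof (cases "t \<ge> a")
      case False
      show ?thesis
      proof (cases "y 1 a = 0")
        case True
        have "y 0 t = y 0 (2 * a - t)"
          using symmetric_about_critical_point[OF y abs True, of "a - t"] by (simp add: algebra_simps)
        then show ?thesis using c False by simp
      next
        assume "y 1 a \<noteq> 0"
        then have "(\<forall>t\<in>UNIV. y 1 t > 0) \<or> (\<forall>t\<in>UNIV. y 1 t < 0)"
          using a by (intro nonzero_constant_sign cont) auto
        moreover have "y 1 (a + 1) > 0" using pos by simp
        ultimately have "\<forall>t. y 1 t > 0" by (metis UNIV_I order_less_asym)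
        then have "y 0 t < y 0 a"
          using False d(1) by (intro DERIV_pos_imp_increasing[of t a "y 0"]) auto
        then show ?thesis using c(2) by force
      qed
    qed (use c in auto)
    then show ?thesis using c by blast
  qed
  have down: "\<exists>c. (y 0 \<longlongrightarrow> c) at_top \<and> (\<forall>t. y 0 t > c)" if neg: "\<forall>t\<in>{a<..}. y 1 t < 0"
  proof -
    obtain c where c: "(y 0 \<longlongrightarrow> c) at_top" "\<forall>t\<ge>a. y 0 t > c"
      using decreasing_bounded_limit[OF d(1), of a 0] neg bd by (auto intro: less_imp_le)
    have "y 0 t > c" for t
    proof (cases "t \<ge> a")
      case False
      show ?thesis
      proof (cases "y 1 a = 0")
        case True
        have "y 0 t = y 0 (2 * a - t)"
          using symmetric_about_critical_point[OF y abs True, of "a - t"] by (simp add: algebra_simps)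
        then show ?thesis using c False by simp
      next
        assume "y 1 a \<noteq> 0"
        then have "(\<forall>t\<in>UNIV. y 1 t > 0) \<or> (\<forall>t\<in>UNIV. y 1 t < 0)"
          using a by (intro nonzero_constant_sign cont) auto
        moreover have "y 1 (a + 1) < 0" using neg by simp
        ultimately have "\<forall>t. y 1 t < 0" by (metis UNIV_I order_less_asym)
        then have "y 0 t > y 0 a"
          using False d(1) by (intro DERIV_neg_imp_decreasing[of t a "y 0"]) auto
        then show ?thesis using c(2) by force
      qed
    qed (use c in auto)
    then show ?thesis using c by blast
  qed
  have "(\<forall>t\<in>{a<..}. y 1 t > 0) \<or> (\<forall>t\<in>{a<..}. y 1 t < 0)"
    using nz by (intro nonzero_constant_sign cont) auto
  then obtain c where c: "(y 0 \<longlongrightarrow> c) at_top" and side: "(\<forall>t. y 0 t < c) \<or> (\<forall>t. y 0 t > c)"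
    using up down by blast
  have "c \<noteq> l" using side meets_equilibrium[OF y bd] by blast
  moreover have "c \<ge> 0" by (rule tendsto_lowerbound[OF c]) (use bd in \<open>auto intro!: always_eventually less_imp_le\<close>)
  moreover have "f c = lam * nu * c" by (rule limit_is_equilibrium[OF y abs c])
  ultimately have "c = 0" using f_below[of c] f_above[of c] by force
  then show ?thesis using c by simp
qed

end

section \<open>Energy, blow-up and boundedness of positive solutions\<close>

context monotone_nonlinearity
begin

text \<open>The first integral of the equation; \<open>F\<close> stands for an antiderivative of \<open>f\<close>. At critical points
  of \<open>y 0\<close> it controls the value of \<open>y 0\<close>.\<close>

definition energy :: "(real \<Rightarrow> real) \<Rightarrow> (nat \<Rightarrow> real \<Rightarrow> real) \<Rightarrow> real \<Rightarrow> real" where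
  "energy F y t = y 1 t * y 3 t - (y 2 t)\<^sup>2 / 2 - (lam + nu) * (y 1 t)\<^sup>2 / 2
     + lam * nu * (y 0 t)\<^sup>2 / 2 - F (y 0 t)"

lemma energy_conserved:
  assumes y: "solves lam nu f y" and F: "\<And>t. (F has_real_derivative f (y 0 t)) (at (y 0 t))"
  shows "energy F y s = energy F y t"
proof -
  note d = solvesD[OF y, unfolded One_nat_def]
  have "(energy F y has_real_derivative 0) (at t)" for t
  proof -
    have "((\<lambda>t. F (y 0 t)) has_real_derivative f (y 0 t) * y (Suc 0) t) (at t)"
      by (rule DERIV_chain2[OF F d(1)])
    then show ?thesis unfolding energy_def One_nat_def
      by (auto intro!: derivative_eq_intros d simp: algebra_simps power2_eq_square)
  qed
  then show ?thesis by (intro DERIV_isconst_all allI)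
qed

text \<open>An increasing solution above all critical values keeps increasing. There the right-hand side of
  \<open>q'' = f v - lam nu v\<close>, with \<open>q = v'' - (lam + nu) v\<close>, is bounded below, so \<open>q\<close> and \<open>q'\<close> become
  positive, and \<open>v'' - lam v = q + nu v\<close> and its derivative do as well.\<close>

lemma ascending_beyond_critical_values:
  assumes y: "solves lam nu f y" and M: "M \<ge> 0" and crit: "\<And>t. y 1 t = 0 \<Longrightarrow> y 0 t \<le> M"
    and above: "\<And>s. s \<ge> M \<Longrightarrow> lam * nu * s + \<delta> \<le> f s" and \<delta>: "\<delta> > 0"
    and a: "y 0 a > M" "y 1 a > 0"
  shows "\<exists>t\<ge>a. ascending y t"
proof -
  note d = solvesD[OF y]
  have cont: "continuous_on S (y 1)" for S
    using d(2) by (intro continuous_at_imp_continuous_on ballI) (auto intro: DERIV_isCont)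
  have y1: "y 1 t > 0" if t: "t \<ge> a" for t
  proof (rule ccontr)
    assume "\<not> y 1 t > 0"
    then have "y 1 t \<le> 0" by simp
    then obtain s where s: "a < s" "s \<le> t" "y 1 s = 0" "\<And>r. a \<le> r \<Longrightarrow> r < s \<Longrightarrow> y 1 r > 0"
      using first_zero[OF cont t a(2)] by blast
    have "y 0 a + 0 * (s - a) \<le> y 0 s"
      by (rule linear_lower_bound[OF _ d(1)]) (use s in \<open>auto simp: le_less\<close>)
    then show False using crit[OF s(3)] a by simp
  qed
  have y0: "y 0 t > M" if t: "t \<ge> a" for t
  proof -
    have "y 0 a + 0 * (t - a) \<le> y 0 t"
      by (rule linear_lower_bound[OF t d(1)]) (use y1 in \<open>auto intro: less_imp_le\<close>)
    then show ?thesis using a by simp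
  qed
  define q where "q = (\<lambda>t. y 2 t - (lam + nu) * y 0 t)"
  define r where "r = (\<lambda>t. y 3 t - (lam + nu) * y 1 t)"
  have dq: "(q has_real_derivative r t) (at t)" for t
    unfolding q_def r_def using d by (intro DERIV_diff DERIV_cmult)
  have dr: "(r has_real_derivative f (y 0 t) - lam * nu * y 0 t) (at t)" for t
    unfolding r_def using DERIV_diff[OF d(4)[of t] DERIV_cmult[OF d(2)[of t], of "lam + nu"]] by simp
  define b where "b = a + (\<bar>r a\<bar> + 1) / \<delta>"
  have b: "a \<le> b" using \<delta> by (simp add: b_def)
  have r: "r t \<ge> 1" if t: "t \<ge> b" for t
  proof -
    have "r a + \<delta> * (t - a) \<le> r t"
    proof (rule linear_lower_bound[OF _ dr])
      show "\<delta> \<le> f (y 0 s) - lam * nu * y 0 s" if "a \<le> s" for s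
        using above[of "y 0 s"] y0[OF that] by simp
    qed (use t b in auto)
    moreover have "\<delta> * (b - a) \<le> \<delta> * (t - a)" using \<delta> t by (intro mult_left_mono) auto
    moreover have "\<delta> * (b - a) = \<bar>r a\<bar> + 1" using \<delta> by (simp add: b_def)
    ultimately show ?thesis by linarith
  qed
  define t where "t = b + \<bar>q b\<bar>"
  have t: "b \<le> t" by (simp add: t_def)
  have "q b + 1 * (t - b) \<le> q t"
    by (rule linear_lower_bound[OF t dq]) (use r in auto)
  then have q: "q t \<ge> 0" by (simp add: t_def)
  have pos: "y 0 t > 0" "y 1 t > 0" using y0[of t] y1[of t] t b M by auto
  have "nu * y 0 t > 0" "nu * y 1 t > 0" using pos nu_pos by auto
  moreover have "r t \<ge> 1" using r t by simp
  ultimately have "ascending y t"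
    using pos q by (simp add: ascending_def q_def r_def algebra_simps)
  then show ?thesis using t b by (intro exI[of _ t]) auto
qed

lemma bounded_unless_ascending:
  assumes y: "solves lam nu f y" and M: "M \<ge> 0" and crit: "\<And>t. y 1 t = 0 \<Longrightarrow> y 0 t \<le> M"
    and above: "\<And>s. s \<ge> M \<Longrightarrow> lam * nu * s + \<delta> \<le> f s" and \<delta>: "\<delta> > 0"
    and no: "\<And>t. \<not> ascending y t" "\<And>t. \<not> ascending (reflect y) t"
  shows "y 0 t \<le> M"
proof (rule ccontr)
  assume "\<not> y 0 t \<le> M"
  then have big: "y 0 t > M" by simp
  then consider "y 1 t > 0" | "y 1 t < 0" using crit[of t] by fastforce
  then show False
  proof cases
    case 1
    then show False
      using ascending_beyond_critical_values[OF y M crit above \<delta> big] no by blast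
  next
    case 2
    have "\<exists>s\<ge>- t. ascending (reflect y) s"
      by (rule ascending_beyond_critical_values[OF solves_reflect[OF y] M _ above \<delta>])
         (use crit big 2 in auto)
    then show False using no by blast
  qed
qed

end

text \<open>One step of the bootstrap that lowers the order of a superlinear differential inequality. For a
  small constant \<open>c\<close> the difference \<open>P - c g^(m+1)\<close> starts nonnegative and increases.\<close>

lemma growth_step:
  fixes g :: "real \<Rightarrow> real"
  assumes dg: "\<And>t. t \<ge> a \<Longrightarrow> (g has_real_derivative g1 t) (at t)"
    and dP: "\<And>t. t \<ge> a \<Longrightarrow> (P has_real_derivative P1 t) (at t)"
    and pos: "\<And>t. t \<ge> a \<Longrightarrow> g t > 0" "\<And>t. t \<ge> a \<Longrightarrow> g1 t > 0" "P a > 0"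
    and ge: "\<And>t. t \<ge> a \<Longrightarrow> \<kappa> * (g t powr m * g1 t) \<le> P1 t"
    and \<kappa>: "\<kappa> > 0" and m: "m > 0"
  shows "\<exists>c>0. \<forall>t\<ge>a. c * g t powr (m + 1) \<le> P t"
proof -
  define c where "c = min (\<kappa> / (m + 1)) (P a / g a powr (m + 1))"
  have ga: "g a powr (m + 1) > 0" using pos(1)[of a] by simp
  have c: "c > 0" using \<kappa> m pos ga by (simp add: c_def)
  have "c \<le> \<kappa> / (m + 1)" by (simp add: c_def)
  then have c1: "c * (m + 1) \<le> \<kappa>" using m by (simp add: pos_le_divide_eq)
  have "c \<le> P a / g a powr (m + 1)" by (simp add: c_def)
  then have c2: "c * g a powr (m + 1) \<le> P a" using ga by (simp add: pos_le_divide_eq)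
  have "c * g t powr (m + 1) \<le> P t" if t: "t \<ge> a" for t
  proof -
    have "P a - c * g a powr (m + 1) \<le> P t - c * g t powr (m + 1)"
    proof (rule DERIV_nonneg_imp_nondecreasing[OF t])
      fix s assume s: "a \<le> s"
      have "((\<lambda>s. g s powr (m + 1)) has_real_derivative (m + 1) * g s powr m * g1 s) (at s)"
        using DERIV_fun_powr[OF dg[OF s] pos(1)[OF s], of "m + 1"] by (simp add: mult.assoc)
      then have "((\<lambda>s. P s - c * g s powr (m + 1)) has_real_derivative
          P1 s - c * ((m + 1) * g s powr m * g1 s)) (at s)"
        by (intro DERIV_diff DERIV_cmult dP s)
      moreover have "c * (m + 1) * (g s powr m * g1 s) \<le> \<kappa> * (g s powr m * g1 s)"
        using c1 pos(1,2)[OF s] by (intro mult_right_mono) auto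
      then have "0 \<le> P1 s - c * ((m + 1) * g s powr m * g1 s)"
        using ge[OF s] by (simp add: mult.assoc)
      ultimately show "\<exists>d. ((\<lambda>s. P s - c * g s powr (m + 1)) has_real_derivative d) (at s) \<and> 0 \<le> d"
        by blast
    qed
    then show ?thesis using c2 by simp
  qed
  then show ?thesis using c by blast
qed

text \<open>The function \<open>g^(1 - r)\<close> decreases at a uniform rate but stays positive.\<close>

lemma superlinear_first_order_blowup:
  fixes g :: "real \<Rightarrow> real"
  assumes dg: "\<And>t. t \<ge> a \<Longrightarrow> (g has_real_derivative g1 t) (at t)"
    and pos: "\<And>t. t \<ge> a \<Longrightarrow> g t > 0" and r: "r > 1" and c: "c > 0"
    and ge: "\<And>t. t \<ge> a \<Longrightarrow> c * g t powr r \<le> g1 t"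
  shows False
proof -
  define \<phi> where "\<phi> = (\<lambda>t. g t powr (1 - r))"
  define b where "b = a + \<phi> a / ((r - 1) * c)"
  have k: "(r - 1) * c > 0" using r c by simp
  have b: "a \<le> b" using k by (simp add: b_def \<phi>_def)
  have "- \<phi> a + ((r - 1) * c) * (b - a) \<le> - \<phi> b"
  proof (rule linear_lower_bound[OF b])
    fix s assume s: "a \<le> s"
    have "(\<phi> has_real_derivative (1 - r) * g s powr (- r) * g1 s) (at s)"
      unfolding \<phi>_def using DERIV_fun_powr[OF dg[OF s] pos[OF s], of "1 - r"] by (simp add: mult.assoc)
    then show "((\<lambda>s. - \<phi> s) has_real_derivative (r - 1) * (g s powr (- r) * g1 s)) (at s)"
      using DERIV_minus by (fastforce simp: algebra_simps)
    have "c = g s powr (- r) * (c * g s powr r)"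
      using pos[OF s] by (simp add: powr_minus field_simps)
    also have "\<dots> \<le> g s powr (- r) * g1 s" using ge[OF s] by (intro mult_left_mono) auto
    finally show "(r - 1) * c \<le> (r - 1) * (g s powr (- r) * g1 s)" using r by (intro mult_left_mono) auto
  qed
  moreover have "(r - 1) * c * (b - a) = \<phi> a" using r c by (simp add: b_def)
  ultimately have "\<phi> b \<le> 0" by simp
  then show False using pos[OF b] by (simp add: \<phi>_def)
qed

text \<open>Multiplying by \<open>g'\<close> and integrating three times turns \<open>g'''' \<ge> \<kappa> g^p\<close> successively into lower
  bounds for \<open>g''' g'\<close>, \<open>g'' g'^2\<close> and \<open>g'^4\<close> by multiples of \<open>g^(p+1)\<close>, \<open>g^(p+2)\<close> and \<open>g^(p+3)\<close>. The last one
  is a first order inequality with the exponent \<open>(p + 3) / 4 > 1\<close>.\<close>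

lemma fourth_order_blowup:
  fixes g :: "real \<Rightarrow> real"
  assumes d: "\<And>t. t \<ge> a \<Longrightarrow> (g has_real_derivative g1 t) (at t)"
    "\<And>t. t \<ge> a \<Longrightarrow> (g1 has_real_derivative g2 t) (at t)"
    "\<And>t. t \<ge> a \<Longrightarrow> (g2 has_real_derivative g3 t) (at t)"
    "\<And>t. t \<ge> a \<Longrightarrow> (g3 has_real_derivative g4 t) (at t)"
    and pos: "\<And>t. t \<ge> a \<Longrightarrow> g t > 0" "\<And>t. t \<ge> a \<Longrightarrow> g1 t > 0"
      "\<And>t. t \<ge> a \<Longrightarrow> g2 t > 0" "\<And>t. t \<ge> a \<Longrightarrow> g3 t > 0"
    and \<kappa>: "\<kappa> > 0" and p: "p > 1" and ge: "\<And>t. t \<ge> a \<Longrightarrow> \<kappa> * g t powr p \<le> g4 t"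
  shows False
proof -
  have "\<exists>c>0. \<forall>t\<ge>a. c * g t powr (p + 1) \<le> g3 t * g1 t"
  proof (rule growth_step[OF d(1) _ pos(1,2) _ _ \<kappa>])
    fix t assume t: "t \<ge> a"
    show "((\<lambda>t. g3 t * g1 t) has_real_derivative g4 t * g1 t + g2 t * g3 t) (at t)"
      by (rule DERIV_mult[OF d(4)[OF t] d(2)[OF t]])
    have "\<kappa> * g t powr p * g1 t \<le> g4 t * g1 t"
      using ge[OF t] pos(2)[OF t] by (intro mult_right_mono) auto
    moreover have "0 \<le> g2 t * g3 t" using pos(3,4)[OF t] by simp
    ultimately show "\<kappa> * (g t powr p * g1 t) \<le> g4 t * g1 t + g2 t * g3 t" by (simp add: mult.assoc)
  qed (use pos p in auto)
  then obtain c1 where c1: "c1 > 0" "\<And>t. t \<ge> a \<Longrightarrow> c1 * g t powr (p + 1) \<le> g3 t * g1 t" by blast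
  have "\<exists>c>0. \<forall>t\<ge>a. c * g t powr ((p + 1) + 1) \<le> g2 t * (g1 t)\<^sup>2"
  proof (rule growth_step[OF d(1) _ pos(1,2) _ _ c1(1)])
    fix t assume t: "t \<ge> a"
    show "((\<lambda>t. g2 t * (g1 t)\<^sup>2) has_real_derivative (g3 t * g1 t) * g1 t + 2 * (g2 t)\<^sup>2 * g1 t) (at t)"
      by (auto intro!: derivative_eq_intros d t simp: power2_eq_square algebra_simps)
    have "(c1 * g t powr (p + 1)) * g1 t \<le> (g3 t * g1 t) * g1 t"
      using c1(2)[OF t] pos(2)[OF t] by (intro mult_right_mono) auto
    moreover have "0 \<le> 2 * (g2 t)\<^sup>2 * g1 t" using pos(2)[OF t] by simp
    ultimately show "c1 * (g t powr (p + 1) * g1 t) \<le> (g3 t * g1 t) * g1 t + 2 * (g2 t)\<^sup>2 * g1 t"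
      unfolding mult.assoc[symmetric] by linarith
  next
    show "0 < g2 a * (g1 a)\<^sup>2" using pos(2,3)[of a] by simp
  qed (use pos p in auto)
  then obtain c2 where c2: "c2 > 0" "\<And>t. t \<ge> a \<Longrightarrow> c2 * g t powr ((p + 1) + 1) \<le> g2 t * (g1 t)\<^sup>2" by blast
  have "\<exists>c>0. \<forall>t\<ge>a. c * g t powr (((p + 1) + 1) + 1) \<le> (g1 t) ^ 4"
  proof (rule growth_step[OF d(1) _ pos(1,2) _ _ c2(1)])
    fix t assume t: "t \<ge> a"
    show "((\<lambda>t. (g1 t) ^ 4) has_real_derivative 4 * ((g2 t * (g1 t)\<^sup>2) * g1 t)) (at t)"
      by (auto intro!: derivative_eq_intros d t simp: eval_nat_numeral)
    have "(c2 * g t powr ((p + 1) + 1)) * g1 t \<le> (g2 t * (g1 t)\<^sup>2) * g1 t"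
      using c2(2)[OF t] pos(2)[OF t] by (intro mult_right_mono) auto
    moreover have "0 \<le> (g2 t * (g1 t)\<^sup>2) * g1 t" using pos(2,3)[OF t] by simp
    ultimately show "c2 * (g t powr ((p + 1) + 1) * g1 t) \<le> 4 * ((g2 t * (g1 t)\<^sup>2) * g1 t)"
      by (simp add: mult.assoc)
  qed (use pos[of a] p in auto)
  then obtain c3 where c3: "c3 > 0" "\<And>t. t \<ge> a \<Longrightarrow> c3 * g t powr (((p + 1) + 1) + 1) \<le> (g1 t) ^ 4" by blast
  define r where "r = (p + 3) / 4"
  have first_order: "root 4 c3 * g t powr r \<le> g1 t" if t: "t \<ge> a" for t
  proof (rule power_le_imp_le_base)
    have "(g t powr r) ^ Suc 3 = g t powr (of_nat (Suc 3) * r)"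
      using pos(1)[OF t] by (intro powr_power) simp
    also have "of_nat (Suc 3) * r = ((p + 1) + 1) + 1" by (simp add: r_def)
    finally have "(g t powr r) ^ Suc 3 = g t powr (((p + 1) + 1) + 1)" .
    moreover have "root 4 c3 ^ Suc 3 = c3" using c3(1) real_root_pow_pos2[of 4 c3] by simp
    ultimately have "(root 4 c3 * g t powr r) ^ Suc 3 = c3 * g t powr (((p + 1) + 1) + 1)"
      by (simp only: power_mult_distrib)
    then show "(root 4 c3 * g t powr r) ^ Suc 3 \<le> g1 t ^ Suc 3" using c3(2)[OF t] by simp
  qed (use pos(2)[OF t] in simp)
  show False
    by (rule superlinear_first_order_blowup[OF d(1) pos(1) _ _ first_order]) (use p c3 in \<open>auto simp: r_def\<close>)
qed

lemma powr_eventually_superlinear: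
  fixes p :: real
  assumes "p > 1"
  shows "\<exists>B\<ge>1. \<forall>s\<ge>B. A * s \<le> s powr p"
proof (intro exI conjI allI impI)
  let ?B = "(\<bar>A\<bar> + 1) powr (1 / (p - 1))"
  show "1 \<le> ?B" using assms by (intro ge_one_powr_ge_zero) auto
  fix s assume s: "?B \<le> s"
  have "?B > 0" by simp
  then have s0: "s > 0" using s by linarith
  have "A \<le> \<bar>A\<bar> + 1" by simp
  also have "\<dots> = ?B powr (p - 1)" using assms by (simp add: powr_powr)
  also have "\<dots> \<le> s powr (p - 1)" using s assms by (intro powr_mono2) auto
  finally have "A * s \<le> s powr (p - 1) * s" using s0 by (intro mult_right_mono) auto
  also have "\<dots> = s powr p" using s0 powr_mult_base[of s "p - 1"] by (simp add: mult.commute)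
  finally show "A * s \<le> s powr p" .
qed

text \<open>The power is extended by \<open>0\<close> to negative arguments, so that it is non-decreasing on the whole
  line.\<close>

definition power_nonlinearity :: "real \<Rightarrow> real \<Rightarrow> real" where
  "power_nonlinearity p s = max 0 s powr p"

lemma monotone_power_nonlinearity:
  assumes "lam > 0" "nu > 0" "p > 0"
  shows "monotone_nonlinearity lam nu (power_nonlinearity p)"
  by unfold_locales
     (use assms in \<open>auto simp: power_nonlinearity_def mono_def intro!: powr_mono2\<close>)

lemma power_never_ascending:
  assumes pos: "lam > 0" "nu > 0" and p: "p > 1" and y: "solves lam nu (power_nonlinearity p) y"
  shows "\<not> monotone_nonlinearity.ascending lam y a"
proof
  interpret monotone_nonlinearity lam nu "power_nonlinearity p"
    using monotone_power_nonlinearity pos p by simp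
  note d = solvesD[OF y]
  assume asc: "ascending y a"
  obtain B where B: "B \<ge> 1" "\<And>s. s \<ge> B \<Longrightarrow> (2 * (lam * nu)) * s \<le> s powr p"
    using powr_eventually_superlinear[OF p] by blast
  obtain b where b: "b \<ge> a" "y 0 b > B" using ascending_unbounded[OF y asc] by blast
  have asc_b: "ascending y b" using ascending_persists[OF y asc b(1)] by simp
  have y0: "y 0 t > B" and asc_t: "ascending y t" if "t \<ge> b" for t
    using ascending_persists[OF y asc_b that] b by auto
  have y2: "lam * B \<le> y 2 t" if "t \<ge> b" for t
  proof -
    have "lam * B \<le> lam * y 0 t" using y0[OF that] pos by simp
    then show ?thesis using asc_t[OF that] by (simp add: ascending_def)
  qed
  have lB: "lam * B > 0" using pos B by simp
  have y1: "y 1 t > 0" if t: "t \<ge> b + 1" for t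
  proof -
    have "y 1 b + lam * B * (t - b) \<le> y 1 t"
      by (rule linear_lower_bound[OF _ d(2)]) (use t y2 in auto)
    moreover have "lam * B * 1 \<le> lam * B * (t - b)" using lB t by (intro mult_left_mono) auto
    ultimately show ?thesis using asc_b lB by (simp add: ascending_def)
  qed
  show False
  proof (rule fourth_order_blowup[OF d(1-4), where a = "b + 1" and \<kappa> = "1 / 2" and p = p])
    fix t assume t: "t \<ge> b + 1"
    show "y 0 t > 0" using y0[of t] t B by simp
    show "y 1 t > 0" by (rule y1[OF t])
    show "y 2 t > 0" using y2[of t] lB t by simp
    have "lam * y 1 t > 0" using y1[OF t] pos by simp
    then show "y 3 t > 0" using asc_t[of t] t by (simp add: ascending_def)
    have "(lam + nu) * y 2 t \<ge> 0" using \<open>y 2 t > 0\<close> pos by simp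
    then show "1 / 2 * y 0 t powr p \<le> (lam + nu) * y 2 t - lam * nu * y 0 t + power_nonlinearity p (y 0 t)"
      using B(2)[of "y 0 t"] y0[of t] t \<open>y 0 t > 0\<close> by (simp add: power_nonlinearity_def max_def)
  qed (use p in auto)
qed

text \<open>The energy bounds the critical values, because the power term dominates the quadratic one. A
  solution that exceeds this bound would enter the cone, forwards or backwards in time, and blow
  up.\<close>

theorem positive_solution_bounded:
  assumes pos: "lam > 0" "nu > 0" and p: "p > 1" and y: "solves lam nu (power_nonlinearity p) y"
    and y0: "\<And>t. y 0 t > 0"
  shows "\<exists>M. \<forall>t. y 0 t \<le> M"
proof -
  interpret monotone_nonlinearity lam nu "power_nonlinearity p"
    using monotone_power_nonlinearity pos p by simp
  define K0 where "K0 = lam * nu"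
  have K0: "K0 > 0" using pos by (simp add: K0_def)
  define F where "F = (\<lambda>s. s powr (p + 1) / (p + 1))"
  have F: "(F has_real_derivative power_nonlinearity p (y 0 t)) (at (y 0 t))" for t
    unfolding F_def power_nonlinearity_def
    using y0[of t] p has_real_derivative_powr[OF y0[of t], of "p + 1"]
    by (auto intro!: derivative_eq_intros)
  \<comment> \<open>Where \<open>A s \<le> s^p\<close>, the energy density \<open>F s - K0 s\<^sup>2 / 2\<close> is at least \<open>s\<^sup>2\<close>.\<close>
  define A where "A = (p + 1) * (K0 / 2 + 1)"
  have A: "A \<ge> K0 + 1"
  proof -
    have "2 * (K0 / 2 + 1) \<le> A" unfolding A_def using p K0 by (intro mult_right_mono) auto
    then show ?thesis by simp
  qed
  obtain B where B: "B \<ge> 1" "\<And>s. s \<ge> B \<Longrightarrow> A * s \<le> s powr p"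
    using powr_eventually_superlinear[OF p] by blast
  define H where "H = energy F y 0"
  define M where "M = max B \<bar>H\<bar>"
  have M: "M \<ge> B" "M \<ge> 1" "M \<ge> \<bar>H\<bar>" using B by (auto simp: M_def)
  have "y 0 t \<le> M" for t
  proof (rule bounded_unless_ascending[OF y, of M 1])
    show "0 \<le> M" using M by simp
    show "\<not> ascending y t" "\<not> ascending (reflect y) t" for t
      using power_never_ascending[OF pos p] y solves_reflect by blast+
    fix s assume s: "M \<le> s"
    then have "s \<ge> 1" using M by simp
    have "K0 * s + 1 \<le> (K0 + 1) * s" using \<open>s \<ge> 1\<close> by (simp add: algebra_simps)
    also have "\<dots> \<le> A * s" using A \<open>s \<ge> 1\<close> by (intro mult_right_mono) auto
    also have "\<dots> \<le> s powr p" using B M s by simp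
    finally show "lam * nu * s + 1 \<le> power_nonlinearity p s"
      using \<open>s \<ge> 1\<close> by (simp add: power_nonlinearity_def K0_def)
  next
    fix t assume crit: "y 1 t = 0"
    show "y 0 t \<le> M"
    proof (rule ccontr)
      assume "\<not> y 0 t \<le> M"
      then have big: "y 0 t > M" by simp
      define s where "s = y 0 t"
      have s: "s > M" "s > 1" "s > \<bar>H\<bar>" using big M by (auto simp: s_def)
      have "H = energy F y t" unfolding H_def by (rule energy_conserved[OF y F])
      then have "H \<le> K0 * s\<^sup>2 / 2 - F s"
        by (simp add: energy_def crit[unfolded One_nat_def] K0_def s_def)
      moreover have "F s \<ge> (K0 / 2 + 1) * s\<^sup>2"
      proof -
        have "(K0 / 2 + 1) * s\<^sup>2 = (A * s) * s / (p + 1)"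
          using p by (simp add: A_def power2_eq_square)
        also have "\<dots> \<le> s powr p * s / (p + 1)"
          using B(2)[of s] s M p by (intro divide_right_mono mult_right_mono) auto
        also have "\<dots> = F s" using s powr_mult_base[of s p] by (simp add: F_def mult.commute add.commute)
        finally show ?thesis .
      qed
      ultimately have "s\<^sup>2 \<le> - H" by (simp add: algebra_simps)
      moreover have "s \<le> s\<^sup>2" using s by (simp add: power2_eq_square)
      ultimately show False using s by linarith
    qed
  qed simp
  then show ?thesis by blast
qed

section \<open>Exponential decay of vanishing solutions\<close>

text \<open>A form of the maximum principle for \<open>g'' \<ge> \<kappa> g\<close> on a half-line: if \<open>g\<close> is nonpositive at the
  starting point and positive somewhere, it must be growing there, for otherwise it would stay
  positive backwards in time down to the starting point.\<close>

lemma positive_then_increasing: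
  fixes g :: "real \<Rightarrow> real"
  assumes d0: "\<And>t. (g has_real_derivative g1 t) (at t)"
    and d1: "\<And>t. (g1 has_real_derivative g2 t) (at t)"
    and \<kappa>: "\<kappa> \<ge> 0" and ge: "\<And>t. t \<ge> a \<Longrightarrow> \<kappa> * g t \<le> g2 t"
    and a: "g a \<le> 0" and b: "a \<le> b" "g b > 0" and t: "b \<le> t"
  shows "0 < g1 b" "g1 b \<le> g1 t"
proof -
  show *: "0 < g1 b"
  proof (rule ccontr)
    assume "\<not> 0 < g1 b"
    have neg: "((\<lambda>s. G (b - s)) has_real_derivative - G' (b - s)) (at s)"
      if "\<And>t. (G has_real_derivative G' t) (at t)" for G G' :: "real \<Rightarrow> real" and s
      using DERIV_chain2[OF that DERIV_diff[OF DERIV_const DERIV_ident], of b s] by simp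
    have "0 \<le> - g1 (b - s)" if "0 \<le> s" "s \<le> b - a" for s
    proof -
      have "0 \<le> g (b - s) \<and> 0 \<le> - g1 (b - s)"
      proof (rule second_order_nonneg[OF \<kappa> \<open>0 \<le> s\<close>, where g = "\<lambda>s. g (b - s)"
            and g' = "\<lambda>s. - g1 (b - s)" and g'' = "\<lambda>s. g2 (b - s)"])
        show "((\<lambda>s. - g1 (b - s)) has_real_derivative g2 (b - r)) (at r)" for r
          using DERIV_minus[OF neg[OF d1]] by simp
      qed (use neg[OF d0] ge that b \<open>\<not> 0 < g1 b\<close> in auto)
      then show ?thesis by simp
    qed
    then have "g (b - 0) + 0 * (b - a - 0) \<le> g (b - (b - a))"
      using b by (intro linear_lower_bound[OF _ neg[OF d0]]) auto
    then show False using a b by simp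
  qed
  have "0 \<le> g s" if "b \<le> s" for s
    using second_order_nonneg[OF \<kappa> that d0 d1] ge b * by auto
  then have "0 \<le> g2 s" if "b \<le> s" for s
    using ge[of s] that b \<kappa> by (meson mult_nonneg_nonneg order_trans)
  then have "g1 b + 0 * (t - b) \<le> g1 t"
    by (intro linear_lower_bound[OF t d1]) auto
  then show "g1 b \<le> g1 t" by simp
qed

text \<open>The hypotheses say that the polynomial \<open>x\<^sup>2 - s x + q\<close> has a nonnegative discriminant and that
  \<open>c\<close> lies to the left of both of its roots.\<close>

lemma characteristic_roots:
  fixes s q c :: real
  assumes "4 * q \<le> s\<^sup>2" "c < s / 2" "0 < c\<^sup>2 - s * c + q"
  obtains lam nu where "lam + nu = s" "lam * nu = q" "c < lam" "c < nu"
proof -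
  define R where "R = sqrt (s\<^sup>2 - 4 * q)"
  have R: "R\<^sup>2 = s\<^sup>2 - 4 * q" "R \<ge> 0" using assms(1) by (auto simp: R_def)
  have "R < s - 2 * c"
  proof (rule power2_less_imp_less)
    show "R\<^sup>2 < (s - 2 * c)\<^sup>2"
      using assms(3) R(1) by (simp add: power2_eq_square algebra_simps)
  qed (use assms(2) in simp)
  moreover have "(s + R) / 2 * ((s - R) / 2) = q"
    using R(1) by (simp add: power2_eq_square field_simps)
  ultimately show thesis
    using R(2) assms(2) by (intro that[of "(s + R) / 2" "(s - R) / 2"]) (auto simp: field_simps)
qed

text \<open>Once \<open>y 0\<close> is small, the nonlinear term is at most \<open>\<epsilon> * y 0\<close>, so that \<open>y 0\<close> is a subsolution of
  the linear equation with \<open>lam * nu\<close> replaced by \<open>lam * nu - \<epsilon>\<close>, for which \<open>exp (- \<gamma> * t)\<close> is a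
  supersolution. The perturbed operator still factors over the reals, and the maximum principle
  for the two second order factors, applied one after the other, yields the comparison.\<close>

theorem exponential_decay:
  assumes y: "solves lam nu (power_nonlinearity p) y" and p: "p > 1"
    and pos: "\<And>t. y 0 t > 0" and lim: "(y 0 \<longlongrightarrow> 0) at_top"
    and \<gamma>: "\<gamma> > 0" "\<gamma>\<^sup>2 < lam" "\<gamma>\<^sup>2 < nu"
  shows "\<exists>C T. \<forall>t\<ge>T. y 0 t \<le> C * exp (- \<gamma> * t)"
proof -
  note d = solvesD[OF y]
  define \<mu> where "\<mu> = (lam - \<gamma>\<^sup>2) * (nu - \<gamma>\<^sup>2)"
  define \<epsilon> where "\<epsilon> = \<mu> / 2"
  have \<mu>: "\<mu> > 0" and \<epsilon>: "0 < \<epsilon>" "\<epsilon> < \<mu>" using \<gamma> by (simp_all add: \<mu>_def \<epsilon>_def)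
  obtain lam' nu' where roots: "lam' + nu' = lam + nu" "lam' * nu' = lam * nu - \<epsilon>" "\<gamma>\<^sup>2 < lam'" "\<gamma>\<^sup>2 < nu'"
  proof (rule characteristic_roots)
    show "4 * (lam * nu - \<epsilon>) \<le> (lam + nu)\<^sup>2"
      using \<epsilon>(1) zero_le_power2[of "lam - nu"] by (simp add: power2_eq_square algebra_simps)
    show "\<gamma>\<^sup>2 < (lam + nu) / 2" using \<gamma>(2,3) by simp
    show "0 < (\<gamma>\<^sup>2)\<^sup>2 - (lam + nu) * \<gamma>\<^sup>2 + (lam * nu - \<epsilon>)"
      using \<epsilon>(2) by (simp add: \<mu>_def power2_eq_square algebra_simps)
  qed
  have root_pos: "lam' > 0" "nu' > 0" using roots(3,4) zero_le_power2[of \<gamma>] by linarith+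
  have "\<forall>\<^sub>F t in at_top. y 0 t < \<epsilon> powr (1 / (p - 1))"
    using order_tendstoD(2)[OF lim] \<epsilon> by simp
  then obtain T where T: "\<And>t. t \<ge> T \<Longrightarrow> y 0 t < \<epsilon> powr (1 / (p - 1))"
    by (auto simp: eventually_at_top_linorder)
  have f: "power_nonlinearity p (y 0 t) \<le> \<epsilon> * y 0 t" if "t \<ge> T" for t
  proof -
    have "y 0 t powr (p - 1) \<le> (\<epsilon> powr (1 / (p - 1))) powr (p - 1)"
      using T[OF that] pos[of t] p by (intro powr_mono2) auto
    also have "\<dots> = \<epsilon>" using p \<epsilon> by (simp add: powr_powr)
    finally have "y 0 t * y 0 t powr (p - 1) \<le> y 0 t * \<epsilon>"
      using pos[of t] by (intro mult_left_mono) auto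
    then show ?thesis using pos[of t] powr_mult_base[of "y 0 t" "p - 1"]
      by (simp add: power_nonlinearity_def mult.commute)
  qed
  \<comment> \<open>The two entries are the conditions \<open>h0 T \<ge> 0\<close> and \<open>w T \<le> 0\<close> at the left end point.\<close>
  define B where "B = max (y 0 T) ((nu' * y 0 T - y 2 T) / (nu' - \<gamma>\<^sup>2))"
  define C where "C = B * exp (\<gamma> * T)"
  define e where "e = (\<lambda>t. C * exp (- \<gamma> * t))"
  have eT: "e T = B" by (simp add: e_def C_def mult.assoc exp_add[symmetric])
  have B: "B \<ge> y 0 T" "B > 0" "(nu' - \<gamma>\<^sup>2) * B \<ge> nu' * y 0 T - y 2 T"
  proof -
    show "B \<ge> y 0 T" by (simp add: B_def)
    then show "B > 0" using pos[of T] by linarith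
    have "(nu' * y 0 T - y 2 T) / (nu' - \<gamma>\<^sup>2) \<le> B" by (simp add: B_def)
    then show "(nu' - \<gamma>\<^sup>2) * B \<ge> nu' * y 0 T - y 2 T"
      using roots(4) by (simp add: pos_divide_le_eq mult.commute)
  qed
  have C: "C > 0" using B by (simp add: C_def)
  have de: "((\<lambda>t. k * e t) has_real_derivative (- \<gamma> * k) * e t) (at t)" for k t
    unfolding e_def by (auto intro!: derivative_eq_intros)
  define h0 where "h0 = (\<lambda>t. e t - y 0 t)"
  define h1 where "h1 = (\<lambda>t. (- \<gamma>) * e t - y 1 t)"
  define h2 where "h2 = (\<lambda>t. \<gamma>\<^sup>2 * e t - y 2 t)"
  define h3 where "h3 = (\<lambda>t. (- (\<gamma> ^ 3)) * e t - y 3 t)"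
  define h4 where "h4 = (\<lambda>t. \<gamma> ^ 4 * e t - ((lam + nu) * y 2 t - lam * nu * y 0 t + power_nonlinearity p (y 0 t)))"
  have dh: "(h0 has_real_derivative h1 t) (at t)" "(h1 has_real_derivative h2 t) (at t)"
    "(h2 has_real_derivative h3 t) (at t)" "(h3 has_real_derivative h4 t) (at t)" for t
    unfolding h0_def h1_def h2_def h3_def h4_def
    using DERIV_diff[OF de[of 1 t] d(1)[of t]] DERIV_diff[OF de[of "- \<gamma>" t] d(2)[of t]]
      DERIV_diff[OF de[of "\<gamma>\<^sup>2" t] d(3)[of t]] DERIV_diff[OF de[of "- (\<gamma> ^ 3)" t] d(4)[of t]]
    by (simp_all add: eval_nat_numeral algebra_simps)
  define w where "w = (\<lambda>t. h2 t - nu' * h0 t)"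
  define w1 where "w1 = (\<lambda>t. h3 t - nu' * h1 t)"
  define w2 where "w2 = (\<lambda>t. h4 t - nu' * h2 t)"
  have dw: "(w has_real_derivative w1 t) (at t)" "(w1 has_real_derivative w2 t) (at t)" for t
    unfolding w_def w1_def w2_def by (auto intro!: DERIV_diff DERIV_cmult dh)
  \<comment> \<open>\<open>w\<close> is the first factor \<open>d\<^sup>2/dt\<^sup>2 - nu'\<close> applied to the gap \<open>h0\<close> between barrier and solution.\<close>
  have super: "lam' * w t \<le> w2 t" if t: "t \<ge> T" for t
  proof -
    have "w2 t - lam' * w t = h4 t - (lam' + nu') * h2 t + (lam' * nu') * h0 t"
      by (simp add: w_def w2_def algebra_simps)
    also have "\<dots> = (\<mu> - \<epsilon>) * e t + (\<epsilon> * y 0 t - power_nonlinearity p (y 0 t))"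
      unfolding roots(1,2) h4_def h2_def h0_def \<mu>_def
      by (simp add: algebra_simps eval_nat_numeral)
    also have "\<dots> \<ge> 0"
      using f[OF t] \<epsilon> C by (simp add: e_def)
    finally show ?thesis by simp
  qed
  have lim_h: "(h0 \<longlongrightarrow> 0) at_top"
  proof -
    have "((\<lambda>t. C * exp (- (\<gamma> * t))) \<longlongrightarrow> C * 0) at_top"
      using \<gamma> by (intro tendsto_mult tendsto_const filterlim_compose[OF exp_at_bot])
        (auto simp: filterlim_uminus_at_bot intro!: filterlim_tendsto_pos_mult_at_top[OF tendsto_const] filterlim_ident)
    then have "(e \<longlongrightarrow> 0) at_top" by (simp add: e_def)
    from tendsto_diff[OF this lim] show ?thesis by (simp add: h0_def)
  qed
  have ev: "\<forall>\<^sub>F t in at_top. \<bar>h0 t\<bar> < 1"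
    using order_tendstoD(2)[OF tendsto_rabs[OF lim_h], of 1] by simp
  then obtain T1 where T1: "\<And>t. t \<ge> T1 \<Longrightarrow> \<bar>h0 t\<bar> \<le> 1"
    unfolding eventually_at_top_linorder by (meson less_imp_le)
  have w_nonpos: "w t \<le> 0" if t: "t \<ge> T" for t
  proof (rule ccontr)
    assume "\<not> w t \<le> 0"
    then have "w t > 0" by simp
    have wT: "w T \<le> 0" using B(3) by (simp add: w_def h2_def h0_def eT algebra_simps)
    note inc = positive_then_increasing[OF dw less_imp_le[OF root_pos(1)] super wT t \<open>w t > 0\<close>]
    show False
    proof (rule drift_unbounded[OF dh(1-3) less_imp_le[OF root_pos(2)], where a = "max t T1" and c = "w1 t"])
      show "0 < w1 t" using inc(1) by blast
      show "w1 t \<le> h3 s - nu' * h1 s" if "max t T1 \<le> s" for s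
        using inc(2)[of s] that by (simp add: w1_def)
    qed (use T1 in auto)
  qed
  have "h0 t \<ge> 0" if t: "t \<ge> T" for t
  proof (rule ccontr)
    assume "\<not> h0 t \<ge> 0"
    then have "- h0 t > 0" by simp
    have ge: "nu' * - h0 s \<le> - h2 s" if "s \<ge> T" for s using w_nonpos[OF that] by (simp add: w_def)
    have hT: "- h0 T \<le> 0" using B(1) by (simp add: h0_def eT)
    note inc = positive_then_increasing[OF DERIV_minus[OF dh(1)] DERIV_minus[OF dh(2)]
        less_imp_le[OF root_pos(2)] ge hT t \<open>- h0 t > 0\<close>]
    have c: "- h1 t > 0" using inc(1) by blast
    define s where "s = max t T1"
    define q where "q = 3 / (- h1 t)"
    define r where "r = s + q"
    have "q > 0" unfolding q_def using c by (intro divide_pos_pos) auto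
    then have sr: "t \<le> s" "T1 \<le> s" "s \<le> r" by (auto simp: s_def r_def)
    have "- h0 s + (- h1 t) * (r - s) \<le> - h0 r"
      by (rule linear_lower_bound[OF sr(3) DERIV_minus[OF dh(1)]]) (use inc(2) sr in auto)
    moreover have "(- h1 t) * (r - s) = 3" using c by (simp add: r_def q_def)
    ultimately show False using T1[of s] T1[of r] sr by linarith
  qed
  then show ?thesis by (intro exI[of _ C] exI[of _ T]) (auto simp: h0_def e_def)
qed

section \<open>Shooting for a solution with given minimum\<close>

lemma solves_cong:
  assumes "\<And>t. f (y 0 t) = g (y 0 t)"
  shows "solves lam nu f y \<longleftrightarrow> solves lam nu g y"
  using assms by (simp add: solves_def)

lemma minimum_critical:
  assumes "solves lam nu f y" "\<And>t. y 0 a \<le> y 0 t"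
  shows "y 1 a = 0" "y 2 a \<ge> 0"
proof -
  note d = solvesD[OF assms(1)]
  show *: "y 1 a = 0"
    by (rule DERIV_local_min[OF d(1) zero_less_one]) (use assms(2) in auto)
  show "y 2 a \<ge> 0"
  proof (rule ccontr)
    assume "\<not> y 2 a \<ge> 0"
    then have "\<forall>\<^sub>F t in at_right a. - y 1 t > 0"
      using * by (intro eventually_pos_right[OF DERIV_minus[OF d(2)]]) auto
    then obtain b where b: "b > a" "\<And>t. a < t \<Longrightarrow> t < b \<Longrightarrow> y 1 t < 0"
      unfolding eventually_at_right_field by auto
    define c where "c = (a + b) / 2"
    have c: "a < c" "c < b" using b by (auto simp: c_def)
    obtain r where r: "a < r" "r < c" "y 0 c - y 0 a = (c - a) * y 1 r"
      using MVT2[OF c(1) d(1)] by blast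
    then have "(c - a) * y 1 r < 0" using b(2)[of r] c by (simp add: mult_less_0_iff)
    then show False using r(3) assms(2)[of c] by linarith
  qed
qed

context lipschitz_nonlinearity
begin

text \<open>Translated to a common minimum point the two solutions have equal value, vanishing first and, by
  symmetry, vanishing third derivative. Then one of the second derivatives dominates, and by rigidity
  they are equal.\<close>

theorem determined_by_minimum:
  assumes x: "solves lam nu f x" and y: "solves lam nu f y"
    and bd: "\<And>t. \<bar>x 0 t\<bar> \<le> M" "\<And>t. \<bar>y 0 t\<bar> \<le> M"
    and min: "minimal_value c (x 0)" "minimal_value c (y 0)"
  shows "\<exists>\<tau>. \<forall>t. y 0 t = x 0 (t + \<tau>)"
proof -
  obtain s r where s: "x 0 s = c" "\<And>t. c \<le> x 0 t" and r: "y 0 r = c" "\<And>t. c \<le> y 0 t"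
    using min by (auto simp: minimal_value_def)
  have x1: "x 1 s = 0" using minimum_critical(1)[OF x] s by simp
  have y1: "y 1 r = 0" using minimum_critical(1)[OF y] r by simp
  have x3: "x 3 s = 0" by (rule third_derivative_critical[OF x bd(1) x1])
  have y3: "y 3 r = 0" by (rule third_derivative_critical[OF y bd(2) y1])
  let ?x = "translate s x" and ?y = "translate r y"
  have sol: "solves lam nu f ?x" "solves lam nu f ?y" using x y by (simp_all add: solves_translate)
  have close: "\<not> \<bar>?x 0 t - ?y 0 t\<bar> > 2 * M" for t
    using bd(1)[of "t + s"] bd(2)[of "t + r"] by simp
  have "x 2 s = y 2 r"
  proof (rule ccontr)
    assume ne: "x 2 s \<noteq> y 2 r"
    show False
    proof (cases "x 2 s > y 2 r")
      case True
      then have "\<exists>t. ?x 0 t - ?y 0 t > 2 * M"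
        using x1 y1 x3 y3 s r by (intro comparison_unbounded[OF sol, of 0]) auto
      then obtain t where "2 * M < ?x 0 t - ?y 0 t" by blast
      then show False using close[of t] by simp
    next
      case False
      then have "\<exists>t. ?y 0 t - ?x 0 t > 2 * M"
        using x1 y1 x3 y3 s r ne by (intro comparison_unbounded[OF sol(2,1), of 0]) auto
      then obtain t where "2 * M < ?y 0 t - ?x 0 t" by blast
      then show False using close[of t] by simp
    qed
  qed
  then have eq: "?x 0 t = ?y 0 t" for t
    using solution_unique[OF sol, of 0 t] x1 y1 x3 y3 s r by simp
  have "y 0 t = x 0 (t + (s - r))" for t
    using eq[of "t - r"] by (simp add: algebra_simps)
  then show ?thesis by blast
qed

end

context bistable_nonlinearity
begin

text \<open>Strict inequalities are needed in order to pass membership in the cone on to nearby solutions.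
  They hold as soon as the solution has exceeded \<open>l\<close>, where \<open>f\<close> is positive.\<close>

lemma ascending_strictly_later:
  assumes y: "solves lam nu f y" and asc: "ascending y a"
  shows "\<exists>t>a. y 0 t > B \<and> y 1 t > 0 \<and> y 2 t > lam * y 0 t \<and> y 3 t > lam * y 1 t"
proof -
  note d = solvesD[OF y]
  obtain b where b: "b \<ge> a" "y 0 b > max l B" using ascending_unbounded[OF y asc] by blast
  have asc_b: "ascending y b" using ascending_persists[OF y asc b(1)] by simp
  have asc_t: "ascending y t" and y0: "y 0 t > max l B" if "t \<ge> b" for t
    using ascending_persists[OF y asc_b that] b by auto
  define z where "z = (\<lambda>t. y 2 t - lam * y 0 t)"
  define z1 where "z1 = (\<lambda>t. y 3 t - lam * y 1 t)"
  have dz: "(z has_real_derivative z1 t) (at t)" for t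
    unfolding z_def z1_def using d by (intro DERIV_diff DERIV_cmult)
  have dz1: "(z1 has_real_derivative nu * z t + f (y 0 t)) (at t)" for t
    unfolding z1_def z_def using DERIV_diff[OF d(4)[of t] DERIV_cmult[OF d(2)[of t], of lam]]
    by (simp add: algebra_simps)
  have nonneg: "z t \<ge> 0" "z1 t \<ge> 0" "y 1 t \<ge> 0" "y 0 t > 0" if "t \<ge> b" for t
    using asc_t[OF that] by (simp_all add: ascending_def z_def z1_def)
  have z1_pos: "z1 t > 0" if t: "t > b" for t
  proof -
    obtain r where r: "b < r" "r < t" "z1 t - z1 b = (t - b) * (nu * z r + f (y 0 r))"
      using MVT2[OF t dz1] by blast
    have "lam * nu * y 0 r > 0" using lam_pos nu_pos nonneg(4)[of r] r by simp
    then have "f (y 0 r) > 0" using f_above[of "y 0 r"] y0[of r] r by simp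
    moreover have "nu * z r \<ge> 0" using nu_pos nonneg(1)[of r] r by simp
    ultimately have "(t - b) * (nu * z r + f (y 0 r)) > 0" using t by simp
    then show ?thesis using r(3) nonneg(2)[of b] by simp
  qed
  have z_pos: "z t > 0" if t: "t > b" for t
  proof -
    obtain r where r: "b < r" "r < t" "z t - z b = (t - b) * z1 r"
      using MVT2[OF t dz] by blast
    have "(t - b) * z1 r > 0" using z1_pos[OF r(1)] t by simp
    then show ?thesis using r(3) nonneg(1)[of b] by simp
  qed
  have y1_pos: "y 1 t > 0" if t: "t > b" for t
  proof -
    obtain r where r: "b < r" "r < t" "y 1 t - y 1 b = (t - b) * y 2 r"
      using MVT2[OF t d(2)] by blast
    have "lam * y 0 r > 0" using lam_pos nonneg(4)[of r] r by simp
    then have "y 2 r > 0" using z_pos[OF r(1)] by (simp add: z_def)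
    then have "(t - b) * y 2 r > 0" using t by simp
    then show ?thesis using r(3) nonneg(3)[of b] by simp
  qed
  show ?thesis
    using b y0[of "b + 1"] y1_pos[of "b + 1"] z_pos[of "b + 1"] z1_pos[of "b + 1"]
    by (intro exI[of _ "b + 1"]) (auto simp: z_def z1_def)
qed

text \<open>The odd derivatives vanish at the origin, so these solutions are even.\<close>

definition shot :: "real \<Rightarrow> real \<Rightarrow> nat \<Rightarrow> real \<Rightarrow> real" where
  "shot a b = (SOME y. solves lam nu f y \<and> y 0 0 = a \<and> y 1 0 = 0 \<and> y 2 0 = b \<and> y 3 0 = 0)"

lemma shot:
  "solves lam nu f (shot a b)" "shot a b 0 0 = a" "shot a b 1 0 = 0" "shot a b 2 0 = b" "shot a b 3 0 = 0"
proof -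
  have "solves lam nu f (shot a b) \<and> shot a b 0 0 = a \<and> shot a b 1 0 = 0 \<and> shot a b 2 0 = b \<and> shot a b 3 0 = 0"
    unfolding shot_def using someI_ex[OF solution_exists[of a 0 b 0]] by blast
  then show "solves lam nu f (shot a b)" "shot a b 0 0 = a" "shot a b 1 0 = 0" "shot a b 2 0 = b" "shot a b 3 0 = 0"
    by blast+
qed

lemma shot_dependence:
  assumes "t \<ge> 0" "k \<le> 3"
  shows "\<bar>shot a b k t - shot a c k t\<bar> \<le> exp (rate * t) * \<bar>b - c\<bar>"
  using dependence[OF shot(1) shot(1) assms, of a b a c] by (simp add: shot[unfolded One_nat_def])

lemma shot_even: "shot a b 0 (- t) = shot a b 0 t"
  using solution_unique[OF solves_reflect[OF shot(1)] shot(1), of a b 0 a b t]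
  by (simp add: shot[unfolded One_nat_def])

definition dips :: "real \<Rightarrow> real set" where
  "dips a = {b. b \<ge> 0 \<and> (\<exists>t>0. shot a b 0 t < a)}"

lemma steep_shot_no_dip:
  assumes "a > 0" "b \<in> dips a" shows "b < lam * a"
proof (rule ccontr)
  assume "\<not> b < lam * a"
  then have "ascending (shot a b) 0"
    using assms by (simp add: ascending_def shot[unfolded One_nat_def])
  then have "a \<le> shot a b 0 t" if "t \<ge> 0" for t
    using ascending_persists(2)[OF shot(1) _ that] shot(2) by metis
  moreover obtain t where "t > 0" "shot a b 0 t < a" using assms(2) by (auto simp: dips_def)
  ultimately show False by (metis less_imp_le not_less)
qed

lemma flat_shot_dips:
  assumes "0 < a" "a < l" shows "0 \<in> dips a"
proof -
  let ?y = "shot a 0"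
  note d = solvesD[OF shot(1)[of a 0]]
  have "\<forall>\<^sub>F t in at_right 0. - ?y 3 t > 0"
    by (rule eventually_pos_right[OF DERIV_minus[OF d(4)]]) (use shot f_below assms in auto)
  then obtain b where b: "b > 0" "\<And>t. 0 < t \<Longrightarrow> t < b \<Longrightarrow> ?y 3 t < 0"
    unfolding eventually_at_right_field by auto
  have neg: "g t < g 0"
    if t: "0 < t" "t < b" and dg: "\<And>t. (g has_real_derivative g' t) (at t)"
      and g': "\<And>t. 0 < t \<Longrightarrow> t < b \<Longrightarrow> g' t < 0" for g g' :: "real \<Rightarrow> real" and t
  proof -
    obtain r where r: "0 < r" "r < t" "g t - g 0 = (t - 0) * g' r"
      using MVT2[OF t(1) dg] by blast
    then have "(t - 0) * g' r < 0" using g'[of r] t by (simp add: mult_less_0_iff)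
    then show ?thesis using r by linarith
  qed
  have y2: "?y 2 t < 0" if "0 < t" "t < b" for t
    using neg[OF that d(3) b(2)] shot by simp
  have y1: "?y 1 t < 0" if "0 < t" "t < b" for t
    using neg[OF that d(2) y2] shot by simp
  have "?y 0 (b / 2) < a"
    using neg[OF _ _ d(1) y1, of "b / 2"] b shot by simp
  then show ?thesis using b by (auto simp: dips_def intro!: exI[of _ "b / 2"])
qed

text \<open>Let \<open>b\<close> be the supremum of the initial curvatures \<open>v''(0)\<close> whose shot falls below \<open>a\<close>.
  Falling below \<open>a\<close> is an open condition, so the critical shot stays at or above \<open>a\<close>. It does not enter the cone either:
  nearby shots would follow it into the cone, and they would also stay above \<open>a\<close> before, since the
  critical shot does not touch the level \<open>a\<close> again. Hence the critical shot is bounded by the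
  energy argument. The hypothesis on \<open>F\<close> is uniform in the curvature, which is at most \<open>lam * a\<close>.\<close>

theorem bounded_shot_exists:
  assumes a: "0 < a" "a < l" "a < M"
    and F: "\<And>s. (F has_real_derivative f s) (at s)"
    and F_large: "\<And>s. s > M \<Longrightarrow> F s - lam * nu * s\<^sup>2 / 2 > F a - lam * nu * a\<^sup>2 / 2 + (lam * a)\<^sup>2 / 2"
    and above: "\<And>s. s \<ge> M \<Longrightarrow> lam * nu * s + \<delta> \<le> f s" and \<delta>: "\<delta> > 0"
  shows "\<exists>y. solves lam nu f y \<and> y 0 0 = a \<and> (\<forall>t. a \<le> y 0 t \<and> y 0 t \<le> M)"
proof -
  define b where "b = Sup (dips a)"
  have ne: "0 \<in> dips a" using flat_shot_dips a by simp
  have bdd: "bdd_above (dips a)"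
    using steep_shot_no_dip[OF a(1)] by (intro bdd_aboveI[of _ "lam * a"]) (auto intro: less_imp_le)
  have b0: "b \<ge> 0" unfolding b_def using ne bdd by (rule cSup_upper)
  have b_le: "b \<le> lam * a"
    unfolding b_def using ne steep_shot_no_dip[OF a(1)] by (intro cSup_least) (auto intro: less_imp_le)
  define y where "y = shot a b"
  have y: "solves lam nu f y" and init: "y 0 0 = a" "y 1 0 = 0" "y 2 0 = b" "y 3 0 = 0"
    using shot by (simp_all add: y_def)
  note d = solvesD[OF y]
  have near: "\<bar>shot a c k t - y k t\<bar> \<le> exp (rate * T) * \<bar>c - b\<bar>" if "0 \<le> t" "t \<le> T" "k \<le> 3" for c k t T
  proof -
    have "exp (rate * t) * \<bar>c - b\<bar> \<le> exp (rate * T) * \<bar>c - b\<bar>"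
      using that rate_pos by (intro mult_right_mono) auto
    then show ?thesis using shot_dependence[OF that(1,3), of a c b] by (simp add: y_def)
  qed
  have b_notin: "b \<notin> dips a"
  proof
    assume "b \<in> dips a"
    then obtain t where t: "t > 0" "y 0 t < a" by (auto simp: dips_def y_def)
    \<comment> \<open>A slightly larger initial curvature still falls below \<open>a\<close> at time \<open>t\<close>.\<close>
    define c where "c = b + (a - y 0 t) / (2 * exp (rate * t))"
    have "c > b" using t by (simp add: c_def)
    moreover have "exp (rate * t) * \<bar>c - b\<bar> = (a - y 0 t) / 2" using t by (simp add: c_def)
    then have "shot a c 0 t < a" using near[of t t 0 c] t by simp
    then have "c \<in> dips a" using t \<open>c > b\<close> b0 by (auto simp: dips_def)
    ultimately show False using cSup_upper[OF _ bdd] by (force simp: b_def)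
  qed
  have b_pos: "b > 0" using b0 b_notin ne by (cases "b = 0") auto
  have above_right: "a \<le> y 0 t" if "t > 0" for t
    using b_notin b0 that by (force simp: dips_def y_def)
  have ge_a: "a \<le> y 0 t" for t
    using above_right[of t] above_right[of "- t"] init shot_even[of a b t]
    by (cases t "0 :: real" rule: linorder_cases) (auto simp: y_def)
  have no_asc: "\<not> ascending y t" for t
  proof
    assume "ascending y t"
    then have asc0: "ascending y (max t 0)" using ascending_persists(1)[OF y] by simp
    obtain T where T: "T > max t 0" "y 0 T > a" "y 1 T > 0" "y 2 T > lam * y 0 T" "y 3 T > lam * y 1 T"
      using ascending_strictly_later[OF y asc0, of a] by blast
    have T0: "T > 0" using T by simp
    have ascT: "ascending y T" using T a by (auto simp: ascending_def)
    \<comment> \<open>By energy conservation a touching point has the same second derivative as the origin. Comparing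
      the solution read backwards from \<open>s\<close> with the solution itself on \<open>[0, s]\<close>, whose end points
      are both at level \<open>a\<close>, shows that the third derivative vanishes too. Then \<open>s\<close> is a period,
      which is incompatible with the growth beyond \<open>T\<close>.\<close>
    have no_touch: "y 0 s \<noteq> a" if s: "s > 0" for s
    proof
      assume touch: "y 0 s = a"
      have y1s: "y 1 s = 0" and y2s: "y 2 s \<ge> 0"
        using minimum_critical[OF y, of s] touch ge_a by auto
      have "energy F y s = energy F y 0" by (rule energy_conserved[OF y F])
      then have "(y 2 s)\<^sup>2 = b\<^sup>2"
        using y1s touch init by (simp add: energy_def)
      then have y2s': "y 2 s = b" using y2s b0 by (simp add: power2_eq_iff_nonneg)
      let ?x = "reflect (translate s y)"
      have x: "solves lam nu f ?x" using y by (simp add: solves_reflect solves_translate)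
      have "y 3 s = 0"
      proof (rule ccontr)
        assume "y 3 s \<noteq> 0"
        then consider "y 3 s < 0" | "y 3 s > 0" by linarith
        then show False
        proof cases
          case 1
          have "?x 0 s > y 0 s"
            by (rule comparison[OF x y, of 0]) (use 1 s y1s y2s' touch init in auto)
          then show False using touch init by simp
        next
          case 2
          have "y 0 s > ?x 0 s"
            by (rule comparison[OF y x, of 0]) (use 2 s y1s y2s' touch init in auto)
          then show False using touch init by simp
        qed
      qed
      then have per: "y 0 (r + s) = y 0 r" for r
        using solution_unique[OF solves_translate[OF y] y, of s 0 r] y1s y2s' touch init by simp
      have "y 0 (real n * s) = a" for n
      proof (induction n)
        case (Suc n)
        then show ?case using per[of "real n * s"] by (simp add: algebra_simps)
      qed (use init in simp)
      moreover obtain n where "T < real n * s" using ex_less_of_nat_mult[OF s] by blast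
      ultimately show False
        using ascending_persists(2)[OF y ascT, of "real n * s"] T by simp
    qed
    obtain e where e: "e > 0" "\<And>s. 0 \<le> s \<Longrightarrow> s \<le> e \<Longrightarrow> y 2 s > b / 2"
    proof -
      have "(y 2 \<longlongrightarrow> y 2 0) (at 0)" using DERIV_isCont[OF d(3)] by (simp add: isCont_def)
      then have "\<forall>\<^sub>F s in at 0. y 2 s > b / 2"
        using order_tendstoD(1) b_pos init(3) by (metis half_less)
      then obtain e where "e > 0" "\<And>s. s \<noteq> 0 \<Longrightarrow> dist s 0 < e \<Longrightarrow> y 2 s > b / 2"
        by (auto simp: eventually_at)
      then show thesis using b_pos init(3) by (intro that[of "e / 2"]) (auto simp: dist_real_def less_eq_real_def)
    qed
    define e' where "e' = min e T"
    have e': "0 < e'" "e' \<le> e" "e' \<le> T" using e(1) T0 by (auto simp: e'_def)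
    have "continuous_on {e'..T} (y 0)"
      using d(1) by (intro continuous_at_imp_continuous_on ballI) (auto intro: DERIV_isCont)
    then obtain s0 where s0: "s0 \<in> {e'..T}" "\<And>s. s \<in> {e'..T} \<Longrightarrow> y 0 s0 \<le> y 0 s"
      using continuous_attains_inf[of "{e'..T}" "y 0"] e' by auto
    define m where "m = y 0 s0 - a"
    have m: "m > 0" using no_touch[of s0] ge_a[of s0] s0(1) e' by (auto simp: m_def less_le)
    \<comment> \<open>A shot closer than \<open>g\<close> to the critical one up to time \<open>T\<close> stays convex on \<open>[0, e']\<close>, above \<open>a\<close> on
      \<open>[e', T]\<close> and is in the cone at \<open>T\<close>.\<close>
    define G where "G = {m, b / 2, y 1 T, (y 2 T - lam * y 0 T) / (1 + lam), (y 3 T - lam * y 1 T) / (1 + lam)}"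
    define g where "g = Min G"
    have G: "finite G" "G \<noteq> {}" by (simp_all add: G_def)
    have "\<forall>x\<in>G. x > 0" using m b_pos T lam_pos by (simp add: G_def)
    then have "g > 0" using G by (simp add: g_def)
    have g_le: "g \<le> x" if "x \<in> G" for x using G that by (simp add: g_def)
    have g: "g \<le> m" "g \<le> b / 2" "g \<le> y 1 T" "g \<le> (y 2 T - lam * y 0 T) / (1 + lam)"
      "g \<le> (y 3 T - lam * y 1 T) / (1 + lam)"
      by (rule g_le, simp add: G_def)+
    have g': "g * (1 + lam) \<le> y 2 T - lam * y 0 T" "g * (1 + lam) \<le> y 3 T - lam * y 1 T"
      using g(4,5) lam_pos by (simp_all add: pos_le_divide_eq)
    define \<eta> where "\<eta> = g / exp (rate * T)"
    have \<eta>: "\<eta> > 0" using \<open>g > 0\<close> by (simp add: \<eta>_def)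
    obtain c where c: "c \<in> dips a" "b - \<eta> < c"
      using less_cSup_iff[OF _ bdd, of "b - \<eta>"] ne \<eta> by (auto simp: b_def)
    have "c \<le> b" unfolding b_def using c(1) bdd by (rule cSup_upper)
    then have "exp (rate * T) * \<bar>c - b\<bar> < exp (rate * T) * \<eta>"
      using c(2) by (intro mult_strict_left_mono) auto
    then have small: "exp (rate * T) * \<bar>c - b\<bar> < g" by (simp add: \<eta>_def)
    have close: "\<bar>shot a c k s - y k s\<bar> < g" if "0 \<le> s" "s \<le> T" "k \<le> 3" for k s
      using near[OF that, of c] small by simp
    have c2: "shot a c 2 s \<ge> 0" if "0 \<le> s" "s \<le> e'" for s
      using close[of s 2] e(2)[of s] g(2) that e' by simp
    have "a \<le> shot a c 0 s" if s: "s > 0" for s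
    proof -
      consider "s \<le> e'" | "e' \<le> s" "s \<le> T" | "T \<le> s" by linarith
      then show ?thesis
      proof cases
        case 1
        have c1: "0 \<le> shot a c 1 r" if "0 \<le> r" "r \<le> s" for r
          using linear_lower_bound[OF that(1) solvesD(2)[OF shot(1)], of 0 a c] c2 that 1 shot(3)[of a c]
          by simp
        show ?thesis
          using linear_lower_bound[OF less_imp_le[OF s] solvesD(1)[OF shot(1)], of 0 a c] c1 shot(2)[of a c]
          by simp
      next
        case 2
        then show ?thesis using close[of s 0] s0(2)[of s] s g(1) by (simp add: m_def)
      next
        case 3
        have cl: "\<bar>shot a c k T - y k T\<bar> < g" if "k \<le> 3" for k
          using close[of T k] T0 that by simp
        have big: "shot a c 0 T \<ge> a" using cl[of 0] s0(2)[of T] e' g(1) by (simp add: m_def)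
        have l0: "lam * (shot a c 0 T - y 0 T) \<le> lam * g" "lam * (shot a c 1 T - y 1 T) \<le> lam * g"
          using cl[of 0] cl[of 1] lam_pos by (auto intro!: mult_left_mono)
        have "ascending (shot a c) T"
          unfolding ascending_def
        proof (intro conjI)
          show "0 < shot a c 0 T" using big a by simp
          show "0 \<le> shot a c 1 T" using cl[of 1] g(3) by simp
          show "lam * shot a c 0 T \<le> shot a c 2 T"
            using cl[of 2] l0(1) g'(1) by (simp add: algebra_simps)
          show "lam * shot a c 1 T \<le> shot a c 3 T"
            using cl[of 3] l0(2) g'(2) by (simp add: algebra_simps)
        qed
        then show ?thesis using ascending_persists(2)[OF shot(1) _ 3] big by force
      qed
    qed
    then show False using c(1) by (force simp: dips_def)
  qed
  have reflected: "reflect y k t = y k t" if "k \<le> 3" for k t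
  proof -
    have eq0: "reflect y 0 = y 0" using shot_even[of a b] by (auto simp: y_def)
    note dr = solvesD[OF solves_reflect[OF y]]
    have eq1: "reflect y 1 = y 1" using DERIV_unique dr(1) d(1) unfolding eq0 by blast
    have eq2: "reflect y 2 = y 2" using DERIV_unique dr(2) d(2) unfolding eq1 by blast
    have eq3: "reflect y 3 = y 3" using DERIV_unique dr(3) d(3) unfolding eq2 by blast
    have "k = 0 \<or> k = 1 \<or> k = 2 \<or> k = 3" using that by auto
    then show ?thesis using eq0 eq1 eq2 eq3 by auto
  qed
  have "y 0 t \<le> M" for t
  proof (rule bounded_unless_ascending[OF y _ _ above \<delta> no_asc])
    show "0 \<le> M" using a by simp
    show "\<not> ascending (reflect y) t" for t
      using no_asc[of t] by (simp add: ascending_def reflected del: reflect_simps)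
    fix t assume crit: "y 1 t = 0"
    show "y 0 t \<le> M"
    proof (rule ccontr)
      assume "\<not> y 0 t \<le> M"
      then have "F (y 0 t) - lam * nu * (y 0 t)\<^sup>2 / 2 > F a - lam * nu * a\<^sup>2 / 2 + (lam * a)\<^sup>2 / 2"
        by (intro F_large) simp
      moreover have "energy F y t = energy F y 0" by (rule energy_conserved[OF y F])
      then have "- (y 2 t)\<^sup>2 / 2 + lam * nu * (y 0 t)\<^sup>2 / 2 - F (y 0 t) = - b\<^sup>2 / 2 + lam * nu * a\<^sup>2 / 2 - F a"
        using crit init by (simp add: energy_def)
      moreover have "b\<^sup>2 \<le> (lam * a)\<^sup>2" using b0 b_le by (intro power_mono)
      moreover have "(y 2 t)\<^sup>2 \<ge> 0" by simp
      ultimately show False by linarith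
    qed
  qed
  then show ?thesis using y init(1) ge_a by blast
qed

end

section \<open>The power nonlinearity\<close>

text \<open>Up to \<open>M\<close> this is the power; beyond \<open>M\<close> it continues linearly with the slope \<open>M^(p-1)\<close>. It thus
  remains of the form \<open>s\<close> times a non-decreasing factor, which preserves the position of the
  equilibria and, for large \<open>M\<close>, lets the energy still bound the critical values.\<close>

definition truncated_power :: "real \<Rightarrow> real \<Rightarrow> real \<Rightarrow> real" where
  "truncated_power p M s = max 0 (min s M) powr p + M powr (p - 1) * max 0 (s - M)"

lemma truncated_power_eq: "s \<le> M \<Longrightarrow> truncated_power p M s = power_nonlinearity p s"
  by (simp add: truncated_power_def power_nonlinearity_def)

lemma truncated_power_factor:
  assumes "M > 0" "s > 0"
  shows "truncated_power p M s = min s M powr (p - 1) * s"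
proof (cases "s \<le> M")
  case True
  then show ?thesis using assms powr_mult_base[of s "p - 1"]
    by (simp add: truncated_power_def mult.commute)
next
  case False
  then show ?thesis using assms powr_mult_base[of M "p - 1"]
    by (simp add: truncated_power_def algebra_simps)
qed

lemma powr_lipschitz:
  fixes x z p M :: real
  assumes "p > 1" "0 \<le> z" "z \<le> x" "x \<le> M"
  shows "\<bar>x powr p - z powr p\<bar> \<le> p * M powr (p - 1) * (x - z)"
proof (cases "z = x")
  case False
  then have zx: "z < x" using assms by simp
  have cont: "continuous_on {z..x} (\<lambda>s. s powr p)"
    using assms by (intro continuous_on_powr' continuous_intros) auto
  have der: "((\<lambda>s. s powr p) has_real_derivative p * s powr (p - 1)) (at s)" if "z < s" for s
    using that assms by (intro has_real_derivative_powr) auto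
  obtain l s where s: "z < s" "s < x" "((\<lambda>s. s powr p) has_real_derivative l) (at s)"
      "x powr p - z powr p = (x - z) * l"
    using MVT[OF zx cont] der by (metis real_differentiable_def)
  then have l: "l = p * s powr (p - 1)" using DERIV_unique der by blast
  have "s powr (p - 1) \<le> M powr (p - 1)" using s assms by (intro powr_mono2) auto
  then have "l \<le> p * M powr (p - 1)" using l assms by simp
  moreover have "0 \<le> l" using l assms by simp
  ultimately show ?thesis using s(4) zx by (simp add: abs_mult mult.commute mult_left_mono)
qed simp

lemma truncated_power_lipschitz:
  assumes p: "p > 1" and M: "M > 0"
  shows "\<bar>truncated_power p M s - truncated_power p M r\<bar>
    \<le> (p * M powr (p - 1) + M powr (p - 1)) * \<bar>s - r\<bar>"
proof -
  define c where "c = (\<lambda>s. max 0 (min s M))"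
  define d where "d = (\<lambda>s. max 0 (s - M))"
  have c: "0 \<le> c x" "c x \<le> M" for x using M by (auto simp: c_def)
  have "\<bar>c s powr p - c r powr p\<bar> \<le> p * M powr (p - 1) * \<bar>c s - c r\<bar>"
  proof (cases "c r \<le> c s")
    case True
    then show ?thesis using powr_lipschitz[OF p c(1) True c(2)] by simp
  next
    case False
    then have "c s \<le> c r" by simp
    then show ?thesis using powr_lipschitz[OF p c(1) _ c(2), of s r] by (simp add: abs_minus_commute)
  qed
  also have "\<dots> \<le> p * M powr (p - 1) * \<bar>s - r\<bar>"
  proof (intro mult_left_mono)
    show "\<bar>c s - c r\<bar> \<le> \<bar>s - r\<bar>" using M by (auto simp: c_def max_def min_def)
  qed (use p in simp)
  finally have 1: "\<bar>c s powr p - c r powr p\<bar> \<le> p * M powr (p - 1) * \<bar>s - r\<bar>" .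
  have "\<bar>M powr (p - 1) * d s - M powr (p - 1) * d r\<bar> = M powr (p - 1) * \<bar>d s - d r\<bar>"
    by (simp add: abs_mult right_diff_distrib[symmetric])
  also have "\<dots> \<le> M powr (p - 1) * \<bar>s - r\<bar>"
    by (intro mult_left_mono) (auto simp: d_def)
  finally have 2: "\<bar>M powr (p - 1) * d s - M powr (p - 1) * d r\<bar> \<le> M powr (p - 1) * \<bar>s - r\<bar>" .
  have "truncated_power p M s - truncated_power p M r =
     (c s powr p - c r powr p) + (M powr (p - 1) * d s - M powr (p - 1) * d r)"
    by (simp add: truncated_power_def c_def d_def)
  then show ?thesis using 1 2 abs_triangle_ineq[of "c s powr p - c r powr p" "M powr (p - 1) * d s - M powr (p - 1) * d r"]
    by (simp add: distrib_right)
qed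

text \<open>The sign conditions compare the factor \<open>min s M powr (p - 1)\<close> with \<open>lam * nu\<close>, which is its value
  at \<open>s = l\<close>.\<close>

theorem bistable_truncated_power:
  assumes pos: "lam > 0" "nu > 0" and p: "p > 1" and M: "M > (lam * nu) powr (1 / (p - 1))"
  shows "bistable_nonlinearity lam nu (truncated_power p M) (p * M powr (p - 1) + M powr (p - 1))
    ((lam * nu) powr (1 / (p - 1)))"
proof
  define l where "l = (lam * nu) powr (1 / (p - 1))"
  have l: "l > 0" using pos by (simp add: l_def)
  have lp: "l powr (p - 1) = lam * nu" using p pos by (simp add: l_def powr_powr)
  have lM: "l < M" using M by (simp add: l_def)
  then have M0: "M > 0" using l by simp
  show "lam > 0" "nu > 0" by (fact pos)+
  show "mono (truncated_power p M)"
    unfolding truncated_power_def using p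
    by (intro monoI add_mono mult_left_mono powr_mono2) auto
  show "truncated_power p M 0 = 0" using M0 by (simp add: truncated_power_def)
  show "\<bar>truncated_power p M s - truncated_power p M r\<bar>
    \<le> (p * M powr (p - 1) + M powr (p - 1)) * \<bar>s - r\<bar>" for s r
    by (rule truncated_power_lipschitz[OF p M0])
  show "0 < (lam * nu) powr (1 / (p - 1))" using l by (simp add: l_def)
  fix s
  show "truncated_power p M s < lam * nu * s" if "0 < s" "s < (lam * nu) powr (1 / (p - 1))"
  proof -
    have "min s M powr (p - 1) < l powr (p - 1)"
      using that lM p by (intro powr_less_mono2) (auto simp: l_def)
    then show ?thesis using that M0 lp by (simp add: truncated_power_factor)
  qed
  show "lam * nu * s < truncated_power p M s" if "(lam * nu) powr (1 / (p - 1)) < s"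
  proof -
    have "l powr (p - 1) < min s M powr (p - 1)"
      using that lM l p by (intro powr_less_mono2) (auto simp: l_def)
    moreover have "s > 0" using that l unfolding l_def by linarith
    ultimately show ?thesis using that M0 lp by (simp add: truncated_power_factor)
  qed
qed

lemma solves_truncated_iff:
  assumes "\<And>t. y 0 t \<le> M"
  shows "solves lam nu (truncated_power p M) y \<longleftrightarrow> solves lam nu (power_nonlinearity p) y"
  using assms by (intro solves_cong truncated_power_eq)

text \<open>A positive solution is bounded, hence also solves a truncated equation, to which the classification
  for Lipschitz nonlinearities applies.\<close>

theorem positive_solution_periodic_or_vanishing:
  assumes pos: "lam > 0" "nu > 0" and p: "p > 1" and y: "solves lam nu (power_nonlinearity p) y"
    and y0: "\<And>t. y 0 t > 0"
  shows "periodic (y 0) \<or> (y 0 \<longlongrightarrow> 0) at_top"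
proof -
  obtain N where N: "\<And>t. y 0 t \<le> N" using positive_solution_bounded[OF pos p y y0] by blast
  define M where "M = max N ((lam * nu) powr (1 / (p - 1)) + 1)"
  have M: "y 0 t \<le> M" for t using N[of t] by (simp add: M_def)
  interpret bistable_nonlinearity lam nu "truncated_power p M" "p * M powr (p - 1) + M powr (p - 1)"
    "(lam * nu) powr (1 / (p - 1))"
    by (rule bistable_truncated_power[OF pos p]) (simp add: M_def)
  show ?thesis
    using periodic_or_vanishing[where y = y and M = M] y y0 M solves_truncated_iff[of y M] by blast
qed

theorem positive_solution_determined_by_minimum:
  assumes pos: "lam > 0" "nu > 0" and p: "p > 1" and a: "a > 0"
    and x: "solves lam nu (power_nonlinearity p) x" "minimal_value a (x 0)"
    and y: "solves lam nu (power_nonlinearity p) y" "minimal_value a (y 0)"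
  shows "\<exists>\<tau>. \<forall>t. y 0 t = x 0 (t + \<tau>)"
proof -
  have x0: "x 0 t > 0" and y0: "y 0 t > 0" for t
    using x(2) y(2) a by (auto simp: minimal_value_def intro: less_le_trans)
  obtain N1 where N1: "\<And>t. x 0 t \<le> N1" using positive_solution_bounded[OF pos p x(1) x0] by blast
  obtain N2 where N2: "\<And>t. y 0 t \<le> N2" using positive_solution_bounded[OF pos p y(1) y0] by blast
  define M where "M = max (max N1 N2) ((lam * nu) powr (1 / (p - 1)) + 1)"
  have Mx: "x 0 t \<le> M" and My: "y 0 t \<le> M" for t
    using N1[of t] N2[of t] by (auto simp: M_def)
  interpret bistable_nonlinearity lam nu "truncated_power p M" "p * M powr (p - 1) + M powr (p - 1)"
    "(lam * nu) powr (1 / (p - 1))"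
    by (rule bistable_truncated_power[OF pos p]) (simp add: M_def)
  have "\<bar>x 0 t\<bar> \<le> M" "\<bar>y 0 t\<bar> \<le> M" for t
    using Mx[of t] My[of t] x0[of t] y0[of t] by auto
  then show ?thesis
    using determined_by_minimum[of x y M a] x y Mx My solves_truncated_iff[of x M] solves_truncated_iff[of y M]
    by blast
qed

text \<open>The truncation level \<open>M\<close> is taken so large that the truncated energy density already exceeds at \<open>M\<close>
  all energy levels of the shots. The shot then stays below \<open>M\<close> and does not see the truncation.\<close>

theorem periodic_solution_exists:
  assumes pos: "lam > 0" "nu > 0" and p: "p > 1" and a: "0 < a" "a < (lam * nu) powr (1 / (p - 1))"
  shows "\<exists>y. solves lam nu (power_nonlinearity p) y \<and> periodic (y 0) \<and> minimal_value a (y 0)"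
proof -
  define K0 where "K0 = lam * nu"
  have K0: "K0 > 0" using pos by (simp add: K0_def)
  define l where "l = K0 powr (1 / (p - 1))"
  define A where "A = (p + 1) * (K0 / 2 + 1)"
  have A: "A \<ge> K0 + 1"
  proof -
    have "2 * (K0 / 2 + 1) \<le> A" unfolding A_def using p K0 by (intro mult_right_mono) auto
    then show ?thesis by simp
  qed
  obtain B where B: "B \<ge> 1" "\<And>s. s \<ge> B \<Longrightarrow> A * s \<le> s powr p"
    using powr_eventually_superlinear[OF p] by blast
  \<comment> \<open>Since \<open>F\<close> is only determined up to a constant, the energy condition is expressed by the explicit
  potential \<open>s^(p+1) / (p+1) - K0 s\<^sup>2 / 2\<close>: at \<open>M\<close> it has to exceed \<open>R\<close>.\<close>
  define R where "R = (lam * a)\<^sup>2 / 2 + a powr (p + 1) / (p + 1)"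
  define M where "M = max B (max (R + 1) (l + 1))"
  have M: "M \<ge> B" "M \<ge> 1" "M > R" "M > l" using B by (auto simp: M_def)
  have aM: "a < M" using a M by (simp add: l_def K0_def)
  have AM: "A * M \<le> M powr p" using B M by simp
  interpret bistable_nonlinearity lam nu "truncated_power p M" "p * M powr (p - 1) + M powr (p - 1)"
    "(lam * nu) powr (1 / (p - 1))"
    by (rule bistable_truncated_power[OF pos p]) (use M in \<open>simp add: l_def K0_def\<close>)
  have above: "lam * nu * s + 1 \<le> truncated_power p M s" if s: "s \<ge> M" for s
  proof -
    have "A * M \<le> M powr (p - 1) * M"
      using AM powr_mult_base[of M "p - 1"] M by (simp add: mult.commute)
    then have "A \<le> M powr (p - 1)" using M by simp
    then have "A * s \<le> truncated_power p M s"
      using s M by (simp add: truncated_power_factor)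
    moreover have "(K0 + 1) * s \<le> A * s" using A s M by (intro mult_right_mono) auto
    ultimately show ?thesis using s M by (simp add: K0_def algebra_simps)
  qed
  have "continuous_on UNIV (truncated_power p M)"
    using f_continuous by (simp add: continuous_at_imp_continuous_on)
  then obtain F where F: "\<And>s. (F has_real_derivative truncated_power p M s) (at s)"
    using antiderivative_exists[of "truncated_power p M" 0]
    by (auto simp: has_real_derivative_iff_has_vector_derivative)
  have F_near: "F M - F a = (M powr (p + 1) - a powr (p + 1)) / (p + 1)"
  proof -
    have "F M - M powr (p + 1) / (p + 1) = F a - a powr (p + 1) / (p + 1)"
    proof (rule DERIV_isconst_end[OF aM])
      have der: "((\<lambda>s. F s - s powr (p + 1) / (p + 1)) has_real_derivative
          truncated_power p M s - s powr p) (at s)" if "s > 0" for s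
        using that p has_real_derivative_powr[OF that, of "p + 1"]
        by (auto intro!: derivative_eq_intros F)
      show "continuous_on {a..M} (\<lambda>s. F s - s powr (p + 1) / (p + 1))"
        by (intro continuous_at_imp_continuous_on ballI, rule DERIV_isCont, rule der) (use a in auto)
      show "((\<lambda>s. F s - s powr (p + 1) / (p + 1)) has_real_derivative 0) (at s)" if "a < s" "s < M" for s
        using der[of s] that a by (simp add: truncated_power_def)
    qed
    then show ?thesis using p by (simp add: diff_divide_distrib)
  qed
  have F_large: "F s - lam * nu * s\<^sup>2 / 2 > F a - lam * nu * a\<^sup>2 / 2 + (lam * a)\<^sup>2 / 2" if s: "s > M" for s
  proof -
    have "F M - K0 * M\<^sup>2 / 2 + 0 * (s - M) \<le> F s - K0 * s\<^sup>2 / 2"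
    proof (rule linear_lower_bound[where g = "\<lambda>s. F s - K0 * s\<^sup>2 / 2" and g' = "\<lambda>s. truncated_power p M s - K0 * s"])
      show "((\<lambda>s. F s - K0 * s\<^sup>2 / 2) has_real_derivative truncated_power p M r - K0 * r) (at r)" for r
        by (auto intro!: derivative_eq_intros F)
      show "0 \<le> truncated_power p M r - K0 * r" if "M \<le> r" for r
        using above[OF that] by (simp add: K0_def)
    qed (use s in simp)
    moreover have "(K0 / 2 + 1) * M\<^sup>2 \<le> M powr (p + 1) / (p + 1)"
    proof -
      have "(K0 / 2 + 1) * M\<^sup>2 = (A * M) * M / (p + 1)"
        using p by (simp add: A_def power2_eq_square)
      also have "\<dots> \<le> M powr p * M / (p + 1)"
        using AM M p by (intro divide_right_mono mult_right_mono) auto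
      also have "\<dots> = M powr (p + 1) / (p + 1)"
        using M powr_mult_base[of M p] by (simp add: mult.commute add.commute)
      finally show ?thesis .
    qed
    moreover have "M\<^sup>2 \<ge> M" using M by (simp add: power2_eq_square)
    moreover have "K0 * a\<^sup>2 / 2 \<ge> 0" using K0 by simp
    ultimately show ?thesis
      using F_near M(3) by (simp add: K0_def R_def diff_divide_distrib algebra_simps)
  qed
  obtain y where y: "solves lam nu (truncated_power p M) y" "y 0 0 = a" "\<And>t. a \<le> y 0 t" "\<And>t. y 0 t \<le> M"
    using bounded_shot_exists[OF a(1) a(2) aM F F_large above zero_less_one] by blast
  have y_pos: "0 < y 0 t" for t using y(3)[of t] a by simp
  have "periodic (y 0)"
  proof (rule ccontr)
    assume "\<not> periodic (y 0)"
    then have "(y 0 \<longlongrightarrow> 0) at_top" using periodic_or_vanishing[where y = y and M = M] y y_pos by blast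
    then have "a \<le> 0" by (rule tendsto_lowerbound) (use y(3) in auto)
    then show False using a by simp
  qed
  moreover have "minimal_value a (y 0)" using y(2,3) by (auto simp: minimal_value_def)
  moreover have "solves lam nu (power_nonlinearity p) y" using y(1,4) solves_truncated_iff[of y M] by blast
  ultimately show ?thesis by blast
qed

lemma DERIV_imp_field_differentiable:
  "(g has_real_derivative g') (at t) \<Longrightarrow> g field_differentiable (at t)"
  by (auto simp: field_differentiable_def)

lemma ode_solution_solves:
  assumes v: "ode_solution (lam + nu) (lam * nu) p v" and nonneg: "\<And>t. v t \<ge> 0"
  shows "solves lam nu (power_nonlinearity p) (\<lambda>k. (deriv ^^ k) v)"
proof -
  have d: "((deriv ^^ k) v has_real_derivative (deriv ^^ Suc k) v t) (at t)" if "k < 4" for k t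
  proof -
    have "(deriv ^^ k) v field_differentiable (at t)" using v that by (simp add: ode_solution_def)
    then show ?thesis using field_differentiable_derivI by simp
  qed
  have "(deriv ^^ 4) v t = (lam + nu) * (deriv ^^ 2) v t - lam * nu * v t + power_nonlinearity p (v t)" for t
    using v nonneg[of t] by (simp add: ode_solution_def power_nonlinearity_def algebra_simps)
  then show ?thesis
    unfolding solves_def using d[of 0] d[of 1] d[of 2] d[of 3] by (simp add: eval_nat_numeral)
qed

lemma solves_ode_solution:
  assumes y: "solves lam nu (power_nonlinearity p) y" and nonneg: "\<And>t. y 0 t \<ge> 0"
  shows "ode_solution (lam + nu) (lam * nu) p (y 0)"
proof -
  note d = solvesD[OF y]
  have 1: "(deriv ^^ 1) (y 0) = y 1" using DERIV_imp_deriv[OF d(1)] by auto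
  have 2: "(deriv ^^ 2) (y 0) = y 2" using DERIV_imp_deriv[OF d(2)] 1 by (auto simp: eval_nat_numeral)
  have 3: "(deriv ^^ 3) (y 0) = y 3" using DERIV_imp_deriv[OF d(3)] 2 by (auto simp: eval_nat_numeral)
  have 4: "(deriv ^^ 4) (y 0) t = (lam + nu) * y 2 t - lam * nu * y 0 t + power_nonlinearity p (y 0 t)" for t
    using DERIV_imp_deriv[OF d(4)] 3 by (simp add: eval_nat_numeral)
  have "(deriv ^^ k) (y 0) field_differentiable (at t)" if "k < 4" for k t
  proof -
    have "k = 0 \<or> k = 1 \<or> k = 2 \<or> k = 3" using that by auto
    then show ?thesis
      using 1 2 3 d(1-4)[of t, THEN DERIV_imp_field_differentiable] by auto
  qed
  then show ?thesis
    unfolding ode_solution_def using 2 4 nonneg by (simp add: power_nonlinearity_def)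
qed

section \<open>Radial solutions of the partial differential equation\<close>

lemma partial_eqI: "(f has_derivative f') (at x) \<Longrightarrow> partial i f x = f' (axis i 1)"
  unfolding partial_def using frechet_derivative_at by metis

text \<open>The Emden-Fowler form of a radial function. Differentiation in \<open>|y|\<close> acts on the exponent and on
  the profile \<open>W\<close> only.\<close>

definition radial_profile :: "real \<Rightarrow> (real \<Rightarrow> real) \<Rightarrow> real^'n \<Rightarrow> real" where
  "radial_profile s W y = norm y powr (- s) * W (- ln (norm y))"

lemma radial_profile_has_derivative:
  fixes x :: "real^'n"
  assumes x: "x \<noteq> 0" and W: "\<And>t. (W has_real_derivative W' t) (at t)"
  shows "(radial_profile s W has_derivative
    (\<lambda>h. radial_profile (s + 2) (\<lambda>t. - (s * W t + W' t)) x * (x \<bullet> h))) (at x)"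
proof -
  have nx: "norm x > 0" using x by simp
  have "((\<lambda>r. r powr (- s) * W (- ln r)) has_real_derivative
     norm x powr (- s - 1) * - (s * W (- ln (norm x)) + W' (- ln (norm x)))) (at (norm x))"
  proof -
    have "((\<lambda>r. - ln r) has_real_derivative - (1 / norm x)) (at (norm x))"
      using nx by (auto intro!: derivative_eq_intros)
    from DERIV_chain2[OF W this]
    have "((\<lambda>r. W (- ln r)) has_real_derivative W' (- ln (norm x)) * - (1 / norm x)) (at (norm x))" .
    from DERIV_mult[OF has_real_derivative_powr[OF nx, of "- s"] this]
    show ?thesis
      using nx by (simp add: powr_diff field_simps)
  qed
  from has_derivative_compose[OF has_derivative_norm[OF x] this[unfolded has_field_derivative_def]]
  have "((\<lambda>y. norm y powr (- s) * W (- ln (norm y))) has_derivative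
     (\<lambda>h. norm x powr (- s - 1) * - (s * W (- ln (norm x)) + W' (- ln (norm x))) * (h \<bullet> sgn x))) (at x)" .
  moreover have "norm x powr (- s - 1) * - (s * W (- ln (norm x)) + W' (- ln (norm x))) * (h \<bullet> sgn x) =
    radial_profile (s + 2) (\<lambda>t. - (s * W t + W' t)) x * (x \<bullet> h)" for h
  proof -
    have exponent: "- s - 1 + - 1 = - (s + 2)" by simp
    have drop: "norm x powr (- s - 1) * inverse (norm x) = norm x powr (- (s + 2))"
      using nx powr_add[of "norm x" "- s - 1" "- 1"] unfolding exponent by (simp add: powr_minus)
    have "norm x powr (- s - 1) * - (s * W (- ln (norm x)) + W' (- ln (norm x))) * (h \<bullet> sgn x) =
      (norm x powr (- s - 1) * inverse (norm x)) * - (s * W (- ln (norm x)) + W' (- ln (norm x))) * (x \<bullet> h)"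
      by (simp add: sgn_div_norm inner_commute)
    then show ?thesis unfolding drop radial_profile_def .
  qed
  moreover have "radial_profile s W = (\<lambda>y::real^'n. norm y powr (- s) * W (- ln (norm y)))"
    by (simp add: radial_profile_def fun_eq_iff)
  ultimately show ?thesis by simp
qed

lemma partial_radial:
  fixes f :: "real^'n \<Rightarrow> real"
  assumes f: "\<And>y. y \<noteq> 0 \<Longrightarrow> f y = radial_profile s W y"
    and W: "\<And>t. (W has_real_derivative W' t) (at t)" and x: "x \<noteq> 0"
  shows "partial i f x = radial_profile (s + 2) (\<lambda>t. - (s * W t + W' t)) x * x $ i"
proof -
  have "(f has_derivative
    (\<lambda>h. radial_profile (s + 2) (\<lambda>t. - (s * W t + W' t)) x * (x \<bullet> h))) (at x)"
    by (rule has_derivative_transform_within_open[OF radial_profile_has_derivative[OF x W], of "- {0}"])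
       (use x f in auto)
  from partial_eqI[OF this] show ?thesis by (simp add: inner_axis)
qed

text \<open>This serves both for the divergence and, with \<open>F\<close> the family of partial derivatives of a radial
  function, for the Laplacian.\<close>

lemma sum_partials_radial_field:
  fixes F :: "'n::finite \<Rightarrow> real^'n \<Rightarrow> real"
  assumes F: "\<And>i y. y \<noteq> 0 \<Longrightarrow> F i y = radial_profile s Z y * y $ i"
    and Z: "\<And>t. (Z has_real_derivative Z' t) (at t)" and x: "x \<noteq> 0"
  shows "(\<Sum>i\<in>UNIV. partial i (F i) x) = radial_profile s (\<lambda>t. (real CARD('n) - s) * Z t - Z' t) x"
proof -
  let ?D = "radial_profile (s + 2) (\<lambda>t. - (s * Z t + Z' t)) x"
  have nx: "norm x > 0" using x by simp
  have "partial i (F i) x = radial_profile s Z x + ?D * (x $ i * x $ i)" for i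
  proof -
    have "((\<lambda>y. radial_profile s Z y * y $ i) has_derivative
      (\<lambda>h. radial_profile s Z x * h $ i + (?D * (x \<bullet> h)) * x $ i)) (at x)"
      by (intro has_derivative_mult radial_profile_has_derivative x Z
          bounded_linear_imp_has_derivative bounded_linear_vec_nth)
    then have "(F i has_derivative (\<lambda>h. radial_profile s Z x * h $ i + (?D * (x \<bullet> h)) * x $ i)) (at x)"
      by (rule has_derivative_transform_within_open[of _ _ _ _ "- {0}"]) (use x F in auto)
    from partial_eqI[OF this] show ?thesis by (simp add: inner_axis)
  qed
  then have "(\<Sum>i\<in>UNIV. partial i (F i) x) = real CARD('n) * radial_profile s Z x + ?D * (\<Sum>i\<in>UNIV. x $ i * x $ i)"
    by (simp add: sum.distrib sum_distrib_left)
  also have "(\<Sum>i\<in>UNIV. x $ i * x $ i) = (norm x)\<^sup>2"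
    by (simp add: power2_norm_eq_inner inner_vec_def)
  also have "?D * (norm x)\<^sup>2 = norm x powr (- s) * - (s * Z (- ln (norm x)) + Z' (- ln (norm x)))"
  proof -
    have "norm x powr (- (s + 2)) * (norm x)\<^sup>2 = norm x powr (- s)"
      using nx powr_add[of "norm x" "- (s + 2)" 2] by simp
    then show ?thesis by (simp add: radial_profile_def mult.assoc mult.commute mult.left_commute)
  qed
  finally show ?thesis by (simp add: radial_profile_def algebra_simps)
qed

lemma laplacian_radial:
  fixes f :: "real^'n \<Rightarrow> real"
  assumes f: "\<And>y. y \<noteq> 0 \<Longrightarrow> f y = radial_profile s W y"
    and W: "\<And>t. (W has_real_derivative W' t) (at t)"
    and W': "\<And>t. (W' has_real_derivative W'' t) (at t)" and x: "x \<noteq> 0"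
  shows "laplacian f x = radial_profile (s + 2)
    (\<lambda>t. W'' t + (2 * s + 2 - real CARD('n)) * W' t + s * (s + 2 - real CARD('n)) * W t) x"
proof -
  have "((\<lambda>t. - (s * W t + W' t)) has_real_derivative - (s * W' t + W'' t)) (at t)" for t
    by (intro DERIV_minus DERIV_add DERIV_cmult W W')
  then have "laplacian f x = radial_profile (s + 2)
    (\<lambda>t. (real CARD('n) - (s + 2)) * - (s * W t + W' t) - - (s * W' t + W'' t)) x"
    unfolding laplacian_def by (intro sum_partials_radial_field partial_radial[OF f W] x)
  then show ?thesis by (simp add: radial_profile_def algebra_simps)
qed

lemma powr_times_radial_profile:
  "norm y powr a * radial_profile s W y = radial_profile (s - a) W y"
  by (simp add: radial_profile_def powr_add[symmetric] mult.assoc[symmetric])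

lemma Ck_on_iterated_partial:
  assumes "Ck_on (Suc m) f S" "k \<le> m"
  shows "(partial j ^^ k) f differentiable_on S"
  using assms
proof (induction k arbitrary: m f)
  case (Suc k)
  then obtain m' where "m = Suc m'" by (cases m) auto
  then have "Ck_on (Suc m') (partial j f) S" "k \<le> m'" using Suc.prems by auto
  from Suc.IH[OF this] show ?case by (simp add: funpow_swap1)
qed auto

text \<open>Along a coordinate axis the derivative of a function is one of its partial derivatives, so
  differentiability of order \<open>k\<close> in the sense of partial derivatives passes to the profile.\<close>

lemma derivative_along_ray:
  fixes h :: "real^'n \<Rightarrow> real"
  assumes h: "h differentiable_on - {0}"
  shows "((\<lambda>t. exp (- c * t) * h (exp (- t) *\<^sub>R axis j 1)) has_real_derivative
    - c * (exp (- c * t) * h (exp (- t) *\<^sub>R axis j 1)) -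
    exp (- (c + 1) * t) * partial j h (exp (- t) *\<^sub>R axis j 1)) (at t)"
proof -
  let ?z = "exp (- t) *\<^sub>R (axis j 1 :: real^'n)"
  have z: "?z \<noteq> 0" by (simp add: axis_eq_0_iff)
  have "h differentiable (at ?z)"
    using h z by (simp add: differentiable_on_eq_differentiable_at open_Compl)
  then have hd: "(h has_derivative frechet_derivative h (at ?z)) (at ?z)"
    by (simp add: frechet_derivative_works)
  have lin: "linear (frechet_derivative h (at ?z))"
    using hd by (rule has_derivative_linear)
  have "((\<lambda>t. exp (- t) *\<^sub>R (axis j 1 :: real^'n)) has_derivative (\<lambda>s. (s * - exp (- t)) *\<^sub>R axis j 1)) (at t)"
    by (auto intro!: derivative_eq_intros)
  from has_derivative_compose[OF this hd]
  have "((\<lambda>t. h (exp (- t) *\<^sub>R axis j 1)) has_derivative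
     (\<lambda>s. (- exp (- t) * partial j h ?z) * s)) (at t)"
    by (simp add: linear_cmul[OF lin] linear_neg[OF lin] partial_def algebra_simps)
  then have 1: "((\<lambda>t. h (exp (- t) *\<^sub>R axis j 1)) has_real_derivative - exp (- t) * partial j h ?z) (at t)"
    unfolding has_field_derivative_def .
  have 2: "((\<lambda>t. exp (- c * t)) has_real_derivative - c * exp (- c * t)) (at t)"
    by (auto intro!: derivative_eq_intros)
  have "exp (- (c + 1) * t) = exp (- c * t) * exp (- t)"
    by (simp add: exp_add[symmetric] algebra_simps)
  then show ?thesis using DERIV_mult[OF 2 1] by (simp add: algebra_simps)
qed

lemma ray_profile_four_derivatives:
  fixes u :: "real^'n \<Rightarrow> real"
  assumes u: "Ck_on 4 u (- {0})" and v: "\<And>t. v t = exp (- \<gamma> * t) * u (exp (- t) *\<^sub>R axis j 1)"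
  obtains v1 v2 v3 v4 where
    "\<And>t. (v has_real_derivative v1 t) (at t)" "\<And>t. (v1 has_real_derivative v2 t) (at t)"
    "\<And>t. (v2 has_real_derivative v3 t) (at t)" "\<And>t. (v3 has_real_derivative v4 t) (at t)"
proof -
  define P where "P = (\<lambda>(k::nat) t. exp (- (\<gamma> + real k) * t) * (partial j ^^ k) u (exp (- t) *\<^sub>R axis j 1))"
  have P: "(P k has_real_derivative - (\<gamma> + real k) * P k t - P (Suc k) t) (at t)" if "k \<le> 3" for k t
  proof -
    have "(partial j ^^ k) u differentiable_on - {0}"
      by (rule Ck_on_iterated_partial[of 3]) (use u that in \<open>simp_all add: numeral_eq_Suc\<close>)
    moreover have exponent: "\<gamma> + real k + 1 = \<gamma> + real (Suc k)" by simp
    ultimately show ?thesis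
      using derivative_along_ray[of "(partial j ^^ k) u" "\<gamma> + real k" j t]
      unfolding P_def exponent by simp
  qed
  define D1 where "D1 = (\<lambda>k t. - (\<gamma> + real k) * P k t - P (Suc k) t)"
  define D2 where "D2 = (\<lambda>k t. - (\<gamma> + real k) * D1 k t - D1 (Suc k) t)"
  define D3 where "D3 = (\<lambda>k t. - (\<gamma> + real k) * D2 k t - D2 (Suc k) t)"
  define D4 where "D4 = (\<lambda>k t. - (\<gamma> + real k) * D3 k t - D3 (Suc k) t)"
  have d1: "(P k has_real_derivative D1 k t) (at t)" if "k \<le> 3" for k t
    using P[OF that] by (simp add: D1_def)
  have d2: "(D1 k has_real_derivative D2 k t) (at t)" if "k \<le> 2" for k t
    unfolding D1_def D2_def using that by (intro DERIV_diff DERIV_cmult d1[unfolded D1_def]) auto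
  have d3: "(D2 k has_real_derivative D3 k t) (at t)" if "k \<le> 1" for k t
    unfolding D2_def[of] D3_def using that
    by (intro DERIV_diff DERIV_cmult d2[unfolded D2_def]) auto
  have d4: "(D3 0 has_real_derivative D4 0 t) (at t)" for t
    unfolding D3_def D4_def by (intro DERIV_diff DERIV_cmult d3[unfolded D3_def]) auto
  have "v = P 0" by (auto simp: P_def v)
  then show thesis using that[of "D1 0" "D2 0" "D3 0" "D4 0"] d1[of 0] d2[of 0] d3[of 0] d4 by simp
qed


text \<open>With \<open>c = \<alpha> + 2\<close> and \<open>D = d/dt\<close>, the two Laplacians act on the profile as
  \<open>(D\<^sup>2 + c D - \<gamma> (\<gamma> + c)) (D\<^sup>2 - c D - \<gamma> (\<gamma> + c))\<close> and the divergence term as \<open>D\<^sup>2 - \<gamma>\<^sup>2\<close>. The odd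
  orders cancel by the choice of \<open>\<gamma>\<close>, and the hyperbola condition makes the powers
  of \<open>|x|\<close> on both sides equal.\<close>

lemma emden_fowler_equation:
  fixes u :: "real^'n \<Rightarrow> real" and v :: "real \<Rightarrow> real"
  assumes dim: "CARD('n) = n"
    and \<gamma>: "\<gamma> = (real n - 4 - \<alpha>) / 2"
    and p: "p > 1"
    and hyperbola: "(real n + \<alpha>) / 2 + (real n + \<beta>) / (p + 1) = real n - 2"
    and u_C4: "Ck_on 4 u (- {0})"
    and u_pos: "\<And>x. x \<noteq> 0 \<Longrightarrow> u x > 0"
    and u_pde: "\<And>x. x \<noteq> 0 \<Longrightarrow>
        laplacian (\<lambda>y. norm y powr (- \<alpha>) * laplacian u y) x
        + lam * divergence (\<lambda>y. norm y powr (- \<alpha> - 2) *\<^sub>R gradient u y) x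
        + \<mu> * norm x powr (- \<alpha> - 4) * u x
        = norm x powr \<beta> * u x powr p"
    and v: "\<And>x. x \<noteq> 0 \<Longrightarrow> v (- ln (norm x)) = norm x powr \<gamma> * u x"
  obtains v1 v2 v3 v4 where
    "\<And>t. (v has_real_derivative v1 t) (at t)" "\<And>t. (v1 has_real_derivative v2 t) (at t)"
    "\<And>t. (v2 has_real_derivative v3 t) (at t)" "\<And>t. (v3 has_real_derivative v4 t) (at t)"
    "\<And>t. v4 t - K2 n \<alpha> lam * v2 t + K0 n \<alpha> lam \<mu> * v t = v t powr p" "\<And>t. v t > 0"
proof -
  obtain j :: 'n where True by blast
  define z where "z = (\<lambda>t. exp (- t) *\<^sub>R (axis j 1 :: real^'n))"
  have z: "z t \<noteq> 0" "norm (z t) = exp (- t)" for t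
    by (simp_all add: z_def axis_eq_0_iff)
  have vz: "v t = exp (- \<gamma> * t) * u (z t)" for t
    using v[OF z(1), of t] by (simp add: z(2) exp_powr_real mult.commute)
  obtain v1 v2 v3 v4 where d:
    "\<And>t. (v has_real_derivative v1 t) (at t)" "\<And>t. (v1 has_real_derivative v2 t) (at t)"
    "\<And>t. (v2 has_real_derivative v3 t) (at t)" "\<And>t. (v3 has_real_derivative v4 t) (at t)"
    using ray_profile_four_derivatives[OF u_C4 vz[unfolded z_def]] by blast
  have v_pos: "v t > 0" for t using u_pos[OF z(1)] by (simp add: vz)
  have u: "u y = radial_profile \<gamma> v y" if "y \<noteq> 0" for y
    using that by (simp add: radial_profile_def v powr_minus)
  have n: "real n = 2 * \<gamma> + 4 + \<alpha>" using \<gamma> by simp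
  define c where "c = \<alpha> + 2"
  define W where "W = (\<lambda>t. v2 t - c * v1 t - \<gamma> * (\<gamma> + c) * v t)"
  define W1 where "W1 = (\<lambda>t. v3 t - c * v2 t - \<gamma> * (\<gamma> + c) * v1 t)"
  define W2 where "W2 = (\<lambda>t. v4 t - c * v3 t - \<gamma> * (\<gamma> + c) * v2 t)"
  define Z where "Z = (\<lambda>t. - (\<gamma> * v t + v1 t))"
  define Z1 where "Z1 = (\<lambda>t. - (\<gamma> * v1 t + v2 t))"
  have dW: "(W has_real_derivative W1 t) (at t)" "(W1 has_real_derivative W2 t) (at t)" for t
    unfolding W_def W1_def W2_def by (auto intro!: DERIV_diff DERIV_cmult d)
  have dZ: "(Z has_real_derivative Z1 t) (at t)" for t
    unfolding Z_def Z1_def by (intro DERIV_minus DERIV_add DERIV_cmult d)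
  have lap: "laplacian u y = radial_profile (\<gamma> + 2) W y" if "y \<noteq> 0" for y
    using laplacian_radial[OF u d(1,2) that] unfolding dim n W_def c_def by (simp add: algebra_simps)
  have weighted: "norm y powr (- \<alpha>) * laplacian u y = radial_profile (\<gamma> + c) W y" if "y \<noteq> 0" for y
    using that by (simp add: lap powr_times_radial_profile c_def algebra_simps)
  have bilap: "laplacian (\<lambda>y. norm y powr (- \<alpha>) * laplacian u y) y
      = radial_profile (\<gamma> + c + 2) (\<lambda>t. W2 t + c * W1 t - \<gamma> * (\<gamma> + c) * W t) y" if "y \<noteq> 0" for y
    using laplacian_radial[OF weighted dW that] unfolding dim n c_def by (simp add: algebra_simps)
  have flux: "(norm y powr (- \<alpha> - 2) *\<^sub>R gradient u y) $ i = radial_profile (\<gamma> + c + 2) Z y * y $ i"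
    if "y \<noteq> 0" for y i
  proof -
    have "(norm y powr (- \<alpha> - 2) *\<^sub>R gradient u y) $ i
      = (norm y powr (- \<alpha> - 2) * radial_profile (\<gamma> + 2) Z y) * y $ i"
      using partial_radial[OF u d(1) that] by (simp add: gradient_def Z_def)
    also have "norm y powr (- \<alpha> - 2) * radial_profile (\<gamma> + 2) Z y = radial_profile (\<gamma> + c + 2) Z y"
    proof -
      have "\<gamma> + 2 - (- \<alpha> - 2) = \<gamma> + c + 2" by (simp add: c_def)
      then show ?thesis by (simp only: powr_times_radial_profile)
    qed
    finally show ?thesis .
  qed
  have divg: "divergence (\<lambda>y. norm y powr (- \<alpha> - 2) *\<^sub>R gradient u y) y
      = radial_profile (\<gamma> + c + 2) (\<lambda>t. v2 t - \<gamma>\<^sup>2 * v t) y" if "y \<noteq> 0" for y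
  proof -
    have "divergence (\<lambda>y. norm y powr (- \<alpha> - 2) *\<^sub>R gradient u y) y
      = radial_profile (\<gamma> + c + 2) (\<lambda>t. (real CARD('n) - (\<gamma> + c + 2)) * Z t - Z1 t) y"
      unfolding divergence_def by (rule sum_partials_radial_field[OF flux dZ that])
    then show ?thesis
      unfolding dim n by (simp add: c_def Z_def Z1_def radial_profile_def algebra_simps power2_eq_square)
  qed
  have "v4 t - K2 n \<alpha> lam * v2 t + K0 n \<alpha> lam \<mu> * v t = v t powr p" for t
  proof -
    define \<rho> where "\<rho> = exp (- t)"
    have \<rho>: "\<rho> > 0" by (simp add: \<rho>_def)
    have profile: "radial_profile s g (z t) = \<rho> powr (- s) * g t" for s g
      by (simp add: radial_profile_def z(2) \<rho>_def)
    define E where "E = \<rho> powr (- (\<gamma> + c + 2))"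
    have E: "E > 0" using \<rho> by (simp add: E_def)
    have mass: "\<rho> powr (- \<alpha> - 4) * \<rho> powr (- \<gamma>) = E"
      by (simp add: E_def c_def powr_add[symmetric] algebra_simps)
    have critical: "\<beta> + - \<gamma> * p = - (\<gamma> + c + 2)"
    proof -
      define q where "q = (real n + \<beta>) / (p + 1)"
      have "q = \<gamma>" using hyperbola[folded q_def, unfolded n] by (simp add: field_simps)
      then have "real n + \<beta> = \<gamma> * (p + 1)" using p unfolding q_def by (simp add: field_simps)
      then show ?thesis using n by (simp add: c_def algebra_simps)
    qed
    have source: "\<rho> powr \<beta> * (\<rho> powr (- \<gamma>) * v t) powr p = E * v t powr p"
    proof -
      have "\<rho> powr \<beta> * (\<rho> powr (- \<gamma>) * v t) powr p = \<rho> powr (\<beta> + - \<gamma> * p) * v t powr p"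
        using v_pos[of t] powr_add[of \<rho> \<beta> "- \<gamma> * p"] by (simp add: powr_mult powr_powr)
      then show ?thesis unfolding critical E_def .
    qed
    have pde: "E * (W2 t + c * W1 t - \<gamma> * (\<gamma> + c) * W t) + lam * (E * (v2 t - \<gamma>\<^sup>2 * v t))
      + \<mu> * \<rho> powr (- \<alpha> - 4) * (\<rho> powr (- \<gamma>) * v t) = \<rho> powr \<beta> * (\<rho> powr (- \<gamma>) * v t) powr p"
      using u_pde[OF z(1), of t]
      unfolding bilap[OF z(1)] divg[OF z(1)] u[OF z(1)] profile z(2) \<rho>_def[symmetric] E_def .
    have mass_term: "\<mu> * \<rho> powr (- \<alpha> - 4) * (\<rho> powr (- \<gamma>) * v t) = E * (\<mu> * v t)"
      unfolding mass[symmetric] by (simp add: algebra_simps)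
    have "E * ((W2 t + c * W1 t - \<gamma> * (\<gamma> + c) * W t) + lam * (v2 t - \<gamma>\<^sup>2 * v t) + \<mu> * v t)
      = E * v t powr p"
      using pde unfolding source mass_term by (simp add: algebra_simps)
    then have factored: "(W2 t + c * W1 t - \<gamma> * (\<gamma> + c) * W t) + lam * (v2 t - \<gamma>\<^sup>2 * v t) + \<mu> * v t = v t powr p"
      using E by simp
    have K2: "K2 n \<alpha> lam = 2 * (\<gamma> * (\<gamma> + c)) + c\<^sup>2 - lam"
      unfolding K2_def n c_def by (simp add: power2_eq_square field_simps)
    have K0: "K0 n \<alpha> lam \<mu> = (\<gamma> * (\<gamma> + c))\<^sup>2 - lam * \<gamma>\<^sup>2 + \<mu>"
      unfolding K0_def n c_def by (simp add: power2_eq_square field_simps)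
    show ?thesis
      using factored unfolding K2 K0 by (simp add: W_def W1_def W2_def power2_eq_square algebra_simps)
  qed
  then show thesis using that d v_pos by blast
qed

text \<open>With \<open>a = n - 2\<close>, \<open>b = \<alpha> + 2\<close> the discriminant is \<open>(a b - lam)\<^sup>2 - 4 \<mu>\<close>, the value of the
  characteristic polynomial at \<open>\<gamma>\<^sup>2\<close> is \<open>\<mu>\<close>, and half the sum of the roots exceeds \<open>\<gamma>\<^sup>2\<close> by
  \<open>(a b - lam) / 2\<close>.\<close>

lemma real_decay_rates:
  assumes \<gamma>: "\<gamma> = (real n - 4 - \<alpha>) / 2" and \<mu>: "\<mu> > 0"
    and lam: "lam \<le> (real n - 2) * (\<alpha> + 2) - 2 * sqrt \<mu>"
  obtains lam' nu' where "lam' + nu' = K2 n \<alpha> lam" "lam' * nu' = K0 n \<alpha> lam \<mu>"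
    "\<gamma>\<^sup>2 < lam'" "\<gamma>\<^sup>2 < nu'"
proof (rule characteristic_roots[of "K0 n \<alpha> lam \<mu>" "K2 n \<alpha> lam" "\<gamma>\<^sup>2"])
  define a b where "a = real n - 2" and "b = \<alpha> + 2"
  have \<gamma>ab: "\<gamma> = (a - b) / 2" by (simp add: \<gamma> a_def b_def)
  have K2: "K2 n \<alpha> lam = (a\<^sup>2 + b\<^sup>2) / 2 - lam" by (simp add: K2_def a_def b_def)
  have K0: "K0 n \<alpha> lam \<mu> = (a - b)\<^sup>2 * (a + b)\<^sup>2 / 16 - lam * ((a - b) / 2)\<^sup>2 + \<mu>"
  proof -
    have "a - b = real n - 4 - \<alpha>" "a + b = real n + \<alpha>" by (simp_all add: a_def b_def)
    then show ?thesis by (simp add: K0_def)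
  qed
  have gap: "a * b - lam \<ge> 2 * sqrt \<mu>" using lam by (simp add: a_def b_def)
  have "(2 * sqrt \<mu>)\<^sup>2 \<le> (a * b - lam)\<^sup>2" using gap \<mu> by (intro power_mono) auto
  then have "4 * \<mu> \<le> (a * b - lam)\<^sup>2" using \<mu> by (simp add: power_mult_distrib)
  moreover have "(K2 n \<alpha> lam)\<^sup>2 - 4 * K0 n \<alpha> lam \<mu> = (a * b - lam)\<^sup>2 - 4 * \<mu>"
    unfolding K2 K0 by (simp add: power2_eq_square field_simps)
  ultimately show "4 * K0 n \<alpha> lam \<mu> \<le> (K2 n \<alpha> lam)\<^sup>2" by linarith
  have "sqrt \<mu> > 0" using \<mu> by simp
  then have "a * b - lam > 0" using gap by linarith
  moreover have "K2 n \<alpha> lam / 2 - \<gamma>\<^sup>2 = (a * b - lam) / 2"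
    unfolding K2 \<gamma>ab by (simp add: power2_eq_square field_simps)
  ultimately show "\<gamma>\<^sup>2 < K2 n \<alpha> lam / 2" by simp
  have "(\<gamma>\<^sup>2)\<^sup>2 - K2 n \<alpha> lam * \<gamma>\<^sup>2 + K0 n \<alpha> lam \<mu> = \<mu>"
    unfolding K2 K0 \<gamma>ab by (simp add: power2_eq_square field_simps)
  then show "0 < (\<gamma>\<^sup>2)\<^sup>2 - K2 n \<alpha> lam * \<gamma>\<^sup>2 + K0 n \<alpha> lam \<mu>" using \<mu> by simp
qed (use that in blast)

lemma decay_removes_singularity:
  fixes u :: "real^'n \<Rightarrow> real"
  assumes v: "\<And>x. x \<noteq> 0 \<Longrightarrow> v (- ln (norm x)) = norm x powr \<gamma> * u x"
    and u_pos: "\<And>x. x \<noteq> 0 \<Longrightarrow> u x > 0"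
    and decay: "\<And>t. t \<ge> T \<Longrightarrow> v t \<le> C * exp (- \<gamma> * t)"
  shows "Bfun u (at 0)"
proof (rule BfunI)
  have "norm (u x) \<le> C" if x: "x \<noteq> 0" "dist x 0 < exp (- T)" for x :: "real^'n"
  proof -
    have nx: "norm x > 0" using x by simp
    then have "ln (norm x) < - T" using x ln_less_cancel_iff[of "norm x" "exp (- T)"] by simp
    then have "norm x powr \<gamma> * u x \<le> C * exp (\<gamma> * ln (norm x))"
      using decay[of "- ln (norm x)"] v[OF x(1)] by simp
    also have "\<dots> = norm x powr \<gamma> * C" using nx by (simp add: powr_def)
    finally have "u x \<le> C" using nx by simp
    then show ?thesis using u_pos[OF x(1)] by simp
  qed
  then show "eventually (\<lambda>x. norm (u x) \<le> C) (at 0)"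
    unfolding eventually_at by (intro exI[of _ "exp (- T)"]) auto
qed

theorem theorem1p3:
  fixes n :: nat
    and \<alpha> \<beta> p lam \<mu> :: real
    and u :: "real^'n \<Rightarrow> real"
    and v :: "real \<Rightarrow> real"
  assumes dim: "CARD('n) = n"
    and n: "n \<ge> 5"
    and \<alpha>: "-2 < \<alpha>" "\<alpha> < real n - 4"
    and p: "p > 1"
    and hyperbola: "(real n + \<alpha>) / 2 + (real n + \<beta>) / (p + 1) = real n - 2"
    and \<mu>: "\<mu> > 0"
    and lam: "lam \<le> (real n - 2) * (\<alpha> + 2) - 2 * sqrt \<mu>"
    and u_C4: "Ck_on 4 u (- {0})"
    and u_pos: "\<And>x. x \<noteq> 0 \<Longrightarrow> u x > 0"
    and u_radial: "radial_off_origin u"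
    and u_pde: "\<And>x. x \<noteq> 0 \<Longrightarrow>
        laplacian (\<lambda>y. norm y powr (- \<alpha>) * laplacian u y) x
        + lam * divergence (\<lambda>y. norm y powr (- \<alpha> - 2) *\<^sub>R gradient u y) x
        + \<mu> * norm x powr (- \<alpha> - 4) * u x
        = norm x powr \<beta> * u x powr p"
    and u_sing: "nonremovable_singularity u"
    and v: "\<And>x. x \<noteq> 0 \<Longrightarrow> v (- ln (norm x)) = norm x powr ((real n - 4 - \<alpha>) / 2) * u x"
  shows "periodic v \<and>
         (\<forall>a. 0 < a \<and> a < K0 n \<alpha> lam \<mu> powr (1 / (p - 1)) \<longrightarrow>
           (\<exists>w. ode_solution (K2 n \<alpha> lam) (K0 n \<alpha> lam \<mu>) p w \<and> periodic w \<and> minimal_value a w \<and>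
              (\<forall>w'. ode_solution (K2 n \<alpha> lam) (K0 n \<alpha> lam \<mu>) p w' \<and> periodic w' \<and> minimal_value a w'
                 \<longrightarrow> (\<exists>\<tau>. \<forall>t. w' t = w (t + \<tau>)))))"
proof -
  define \<gamma> where "\<gamma> = (real n - 4 - \<alpha>) / 2"
  have \<gamma>: "\<gamma> > 0" using \<alpha> by (simp add: \<gamma>_def)
  obtain lam' nu' where roots: "lam' + nu' = K2 n \<alpha> lam" "lam' * nu' = K0 n \<alpha> lam \<mu>"
    "\<gamma>\<^sup>2 < lam'" "\<gamma>\<^sup>2 < nu'"
    using real_decay_rates[OF \<gamma>_def \<mu> lam] by blast
  have pos: "lam' > 0" "nu' > 0" using roots(3,4) zero_le_power2[of \<gamma>] by linarith+
  obtain v1 v2 v3 v4 where d: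
    "\<And>t. (v has_real_derivative v1 t) (at t)" "\<And>t. (v1 has_real_derivative v2 t) (at t)"
    "\<And>t. (v2 has_real_derivative v3 t) (at t)" "\<And>t. (v3 has_real_derivative v4 t) (at t)"
    and ode: "\<And>t. v4 t - K2 n \<alpha> lam * v2 t + K0 n \<alpha> lam \<mu> * v t = v t powr p"
    and v_pos: "\<And>t. v t > 0"
    using emden_fowler_equation[OF dim \<gamma>_def p hyperbola u_C4 u_pos u_pde v[folded \<gamma>_def]] by blast
  define y where "y = (\<lambda>k::nat. if k = 0 then v else if k = 1 then v1 else if k = 2 then v2 else v3)"
  have y: "y 0 = v" "y 1 = v1" "y 2 = v2" "y 3 = v3" by (simp_all add: y_def)
  have "v4 t = (lam' + nu') * v2 t - lam' * nu' * v t + power_nonlinearity p (v t)" for t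
    using ode[of t] v_pos[of t] unfolding roots by (simp add: power_nonlinearity_def max_def)
  then have sol: "solves lam' nu' (power_nonlinearity p) y"
    unfolding solves_def y using d by simp
  have "periodic v"
  proof (rule ccontr)
    assume "\<not> periodic v"
    then have "(v \<longlongrightarrow> 0) at_top"
      using positive_solution_periodic_or_vanishing[OF pos p sol] v_pos by (simp add: y)
    then obtain C T where "\<And>t. t \<ge> T \<Longrightarrow> v t \<le> C * exp (- \<gamma> * t)"
      using exponential_decay[OF sol p _ _ \<gamma> roots(3,4)] v_pos by (auto simp: y)
    then have "Bfun u (at 0)"
      using decay_removes_singularity[OF v[folded \<gamma>_def] u_pos] by blast
    then show False using u_sing by (simp add: nonremovable_singularity_def)
  qed
  moreover have "\<exists>w. ode_solution (K2 n \<alpha> lam) (K0 n \<alpha> lam \<mu>) p w \<and> periodic w \<and> minimal_value a w \<and>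
      (\<forall>w'. ode_solution (K2 n \<alpha> lam) (K0 n \<alpha> lam \<mu>) p w' \<and> periodic w' \<and> minimal_value a w'
         \<longrightarrow> (\<exists>\<tau>. \<forall>t. w' t = w (t + \<tau>)))"
    if a: "0 < a" "a < K0 n \<alpha> lam \<mu> powr (1 / (p - 1))" for a
  proof -
    obtain x where x: "solves lam' nu' (power_nonlinearity p) x" "periodic (x 0)" "minimal_value a (x 0)"
      using periodic_solution_exists[OF pos p a(1)] a(2) unfolding roots by blast
    have nonneg: "w t \<ge> 0" if "minimal_value a w" for w t
      using that a(1) by (meson less_imp_le minimal_value_def order_trans)
    have "ode_solution (K2 n \<alpha> lam) (K0 n \<alpha> lam \<mu>) p (x 0)"
      using solves_ode_solution[OF x(1) nonneg[OF x(3)]] unfolding roots .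
    moreover have "\<exists>\<tau>. \<forall>t. w' t = x 0 (t + \<tau>)"
      if w': "ode_solution (K2 n \<alpha> lam) (K0 n \<alpha> lam \<mu>) p w'" "minimal_value a w'" for w'
    proof -
      have "solves lam' nu' (power_nonlinearity p) (\<lambda>k. (deriv ^^ k) w')"
        using ode_solution_solves[of lam' nu' p w'] nonneg[OF w'(2)] w'(1) unfolding roots(1,2) by blast
      from positive_solution_determined_by_minimum[OF pos p a(1) x(1,3) this]
      show ?thesis using w'(2) by simp
    qed
    ultimately show ?thesis using x by blast
  qed
  ultimately show ?thesis by blast
qed

end
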